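(* Let $I$ be a feasible instance of $P\,|\,and\text{+}or\text{-}prec,\,p_j=1\,|\,\gamma$, $\gamma\in\{C_{max},\sum_jC_j\}$, with $n$ jobs, $m$ machines and $k_s$ successors. Then the algorithm AND+OR-ALG-SUCC (described in the context) returns in $\mathcal{O}(k_s^{k_s}\cdot 2^{k_s^2}\cdot m\cdot n^3)$ time the completion times of an optimal schedule for $I$.
   Context: An instance of $P\,|\,and\text{+}or\text{-}prec,\,p_j=1\,|\,\gamma$ consists of a set $J=\{1,\dots,n\}$ of unit-time jobs, a number $m$ of identical parallel machines, and for every job $j\in J$ a precedence constraint $\psi_j$, which is either the constant $\mathbb{1}$ ("true"), a conjunction of (unnegated) variables from $\{x_i : i\in J\}$, or a disjunction of (unnegated) variables from $\{x_i : i\in J\}$. A schedule is a tuple $(C_j)_{j\in J}$ of completion times $C_j\in\{1,2,\dots\}$ with $|\{j\in J : C_j=t\}|\le m$ for every $t$. It is feasible if for every $j\in J$ the formula $\psi_j$ is satisfied by the assignment $x_i=1$ if $C_i<C_j$ and $x_i=0$ otherwise. An instance is feasible if it has a feasible schedule. The objective to be minimized over feasible schedules is the makespan $C_{max}=\max_j C_j$ or the sum of completion times $\sum_j C_j$. If $x_i$ occurs in $\psi_j$, then $i$ is a predecessor of $j$ and $j$ is a successor of $i$. A job $j$ with $\psi_j\neq\mathbb{1}$ is called a successor; $J_s$ is the set of successors and $k_s=|J_s|$. $J_s$ is partitioned into the set $J_s^{and}$ of and-jobs (whose constraint is a conjunction) and the set $J_s^{or}$ of or-jobs (whose constraint is a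 disjunction). Algorithm AND+OR-ALG-SUCC: It runs through all configurations $(C_j)_{j\in J_s}\in\{1,\dots,n\}^{k_s}$ with $C_i-C_j\le k_s-1$ for all $i,j\in J_s$, with $|\{j\in J_s: C_j=t\}|\le m$ for every $t$, and with $C_i<C_j$ whenever $i\in J_s$ is a predecessor of $j\in J_s^{and}$. For each such configuration it does the following. (1) For every or-job $j$ that has a predecessor $i\in J_s$ with $C_i<C_j$, set $i_j=i$ for such an $i$. (2) Let $j_1,\dots,j_q$ be the or-jobs ordered by non-decreasing completion time, and consider them in this order. If no $i_{j_\ell}$ has been chosen yet, pick a set $S\subseteq\{j_\ell,\dots,j_q\}\cup J_s^{and}$ with $j_\ell\in S$, pick a job $i\in J$ whose successors in $\{j_\ell,\dots,j_q\}\cup J_s^{and}$ are precisely the jobs in $S$, and set $i_k=i$ for all $k\in S\cap J_s^{or}$; if no such $i$ exists, this choice of $S$ is infeasible and is abandoned. All possible choices of the sets $S$ are tried. (3) For each resulting $(i_j)_{j\in J_s^{or}}$, replace $\psi_j$ by $x_{i_j}$ for every $j\in J_s^{or}$, so that all constraints are conjunctions. For this modified instance, keep the successor completion times $(C_j)_{j\in J_s}$ fixed and insert the other jobs: go through the successors in order of non-decreasing completion time and give each not yet scheduled predecessor of the current successor $j$ the earliest possible completion time (the first time slot containing fewer than $m$ jobs); if some predecessor cannot be scheduled before $j$, discard this attempt. Finally insert all remaining jobs as early as possible. Among all schedules obtained, return the completion times of one with the smallest objective value.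
   Formalization: In step (2) the job i is picked only among non-successors (i in J without J_s); with an arbitrary pick from J the claim fails, e.g. J={j,a,b}, m=1, psi_j = x_a or x_b, psi_a = x_j, psi_b = 1, where always picking a discards every attempt. *)

theory Defs
  imports Main "HOL-Library.Monad_Syntax"
begin

section \<open>Instances and schedules\<close>

datatype prec = Always | And "nat set" | Or "nat set"

fun vars :: "prec \<Rightarrow> nat set" where
  "vars Always = {}"
| "vars (And A) = A"
| "vars (Or A) = A"

fun sat :: "prec \<Rightarrow> (nat \<Rightarrow> bool) \<Rightarrow> bool" where
  "sat Always x \<longleftrightarrow> True"
| "sat (And A) x \<longleftrightarrow> (\<forall>i\<in>A. x i)"
| "sat (Or A) x \<longleftrightarrow> (\<exists>i\<in>A. x i)"

fun is_And :: "prec \<Rightarrow> bool" where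
  "is_And (And A) \<longleftrightarrow> True"
| "is_And _ \<longleftrightarrow> False"

fun is_Or :: "prec \<Rightarrow> bool" where
  "is_Or (Or A) \<longleftrightarrow> True"
| "is_Or _ \<longleftrightarrow> False"

record inst =
  njobs :: nat
  machines :: nat
  psi :: "nat \<Rightarrow> prec"

definition jobs :: "inst \<Rightarrow> nat set" where
  "jobs I = {1..njobs I}"

text \<open>An empty conjunction would be the constant true, which is represented by \<^term>\<open>Always\<close> only;
  empty disjunctions (false) are not formulas of the problem.\<close>

definition wf_inst :: "inst \<Rightarrow> bool" where
  "wf_inst I \<longleftrightarrow> njobs I \<ge> 1 \<and>
     (\<forall>j\<in>jobs I. vars (psi I j) \<subseteq> jobs I \<and> (psi I j \<noteq> Always \<longrightarrow> vars (psi I j) \<noteq> {}))"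

definition succs :: "inst \<Rightarrow> nat set" where
  "succs I = {j \<in> jobs I. psi I j \<noteq> Always}"

definition schedule :: "inst \<Rightarrow> (nat \<Rightarrow> nat) \<Rightarrow> bool" where
  "schedule I C \<longleftrightarrow> (\<forall>j\<in>jobs I. C j \<ge> 1) \<and> (\<forall>t. card {j \<in> jobs I. C j = t} \<le> machines I)"

definition feasible_schedule :: "inst \<Rightarrow> (nat \<Rightarrow> nat) \<Rightarrow> bool" where
  "feasible_schedule I C \<longleftrightarrow> schedule I C \<and> (\<forall>j\<in>jobs I. sat (psi I j) (\<lambda>i. C i < C j))"

definition feasible_inst :: "inst \<Rightarrow> bool" where
  "feasible_inst I \<longleftrightarrow> (\<exists>C. feasible_schedule I C)"

datatype objective = Makespan | Total_completion

fun obj_value :: "objective \<Rightarrow> inst \<Rightarrow> (nat \<Rightarrow> nat) \<Rightarrow> nat" where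
  "obj_value Makespan I C = Max (C ` jobs I)"
| "obj_value Total_completion I C = (\<Sum>j\<in>jobs I. C j)"

definition optimal_schedule :: "objective \<Rightarrow> inst \<Rightarrow> (nat \<Rightarrow> nat) \<Rightarrow> bool" where
  "optimal_schedule \<gamma> I C \<longleftrightarrow> feasible_schedule I C \<and>
     (\<forall>C'. feasible_schedule I C' \<longrightarrow> obj_value \<gamma> I C \<le> obj_value \<gamma> I C')"


section \<open>Nondeterministic programs with running times\<close>

text \<open>
  A program is the set of its possible outcomes, each with the number of elementary steps taken.
  Nondeterminism models the choices the algorithm leaves open (``some such job'', ties when
  sorting), so a claim about all outcomes holds for every way of resolving them.

  The cost model is a random access machine with unit-cost arithmetic on numbers. Functions and
  sets on jobs or time slots stand for arrays (bit vectors) with \<^term>\<open>n\<close> entries. Reading an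
  entry is an elementary operation; creating an array or changing one entry copies the array and
  costs \<^term>\<open>n\<close> steps, so that the old version stays available to other branches of the search.
  Every iteration of a loop and every recursive call costs one step, which accounts for the
  boundedly many elementary operations made between two such steps.
\<close>

datatype 'a prog = Prog (runs: "('a \<times> nat) set")

definition ret :: "'a \<Rightarrow> 'a prog" where
  "ret x = Prog {(x, 0)}"

definition bind_prog :: "'a prog \<Rightarrow> ('a \<Rightarrow> 'b prog) \<Rightarrow> 'b prog" where
  "bind_prog p f = Prog {(y, s + t) | x y s t. (x, s) \<in> runs p \<and> (y, t) \<in> runs (f x)}"

adhoc_overloading Monad_Syntax.bind \<rightleftharpoons> bind_prog

definition spend :: "nat \<Rightarrow> unit prog" where
  "spend t = Prog {((), t)}"

definition tick :: "'a prog \<Rightarrow> 'a prog" where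
  "tick p = do {spend 1; p}"

definition alt :: "'a prog \<Rightarrow> 'a prog \<Rightarrow> 'a prog" where
  "alt p q = Prog (runs p \<union> runs q)"

definition pick :: "'a list \<Rightarrow> 'a prog" where
  "pick xs = Prog {(x, length xs) | x. x \<in> set xs}"

definition store :: "nat \<Rightarrow> (nat \<Rightarrow> 'b) \<Rightarrow> nat \<Rightarrow> 'b \<Rightarrow> (nat \<Rightarrow> 'b) prog" where
  "store n f x v = do {spend n; ret (f(x := v))}"

primrec loop :: "('a \<Rightarrow> 's \<Rightarrow> 's prog) \<Rightarrow> 'a list \<Rightarrow> 's \<Rightarrow> 's prog" where
  "loop f [] s = tick (ret s)"
| "loop f (x # xs) s = tick (do {s' \<leftarrow> f x s; loop f xs s'})"

primrec mfilter :: "('a \<Rightarrow> bool prog) \<Rightarrow> 'a list \<Rightarrow> 'a list prog" where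
  "mfilter p [] = tick (ret [])"
| "mfilter p (x # xs) = tick (do {b \<leftarrow> p x; ys \<leftarrow> mfilter p xs; ret (if b then x # ys else ys)})"

primrec mall :: "('a \<Rightarrow> bool prog) \<Rightarrow> 'a list \<Rightarrow> bool prog" where
  "mall p [] = tick (ret True)"
| "mall p (x # xs) = tick (do {b \<leftarrow> p x; c \<leftarrow> mall p xs; ret (b \<and> c)})"

primrec insort_prog :: "(nat \<Rightarrow> nat) \<Rightarrow> nat \<Rightarrow> nat list \<Rightarrow> nat list prog" where
  "insort_prog key x [] = tick (ret [x])"
| "insort_prog key x (y # ys) = tick (
     if key x < key y then ret (x # y # ys)
     else if key y < key x then do {zs \<leftarrow> insort_prog key x ys; ret (y # zs)}
     else alt (ret (x # y # ys)) (do {zs \<leftarrow> insort_prog key x ys; ret (y # zs)}))"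

primrec sort_prog :: "(nat \<Rightarrow> nat) \<Rightarrow> nat list \<Rightarrow> nat list prog" where
  "sort_prog key [] = tick (ret [])"
| "sort_prog key (x # xs) = tick (do {ys \<leftarrow> sort_prog key xs; insort_prog key x ys})"

primrec subsets_prog :: "nat \<Rightarrow> nat list \<Rightarrow> nat set list prog" where
  "subsets_prog n [] = tick (do {spend n; ret [{}]})"
| "subsets_prog n (x # xs) = tick (do {
     Ss \<leftarrow> subsets_prog n xs;
     loop (\<lambda>S out. do {spend n; ret (S # insert x S # out)}) Ss []})"


section \<open>The algorithm\<close>

abbreviation upto_n :: "inst \<Rightarrow> nat list" where
  "upto_n I \<equiv> [1..<Suc (njobs I)]"

text \<open>Completion times of some of the jobs are maps; \<^term>\<open>None\<close> means not yet scheduled.\<close>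

definition slot_loads :: "inst \<Rightarrow> (nat \<rightharpoonup> nat) \<Rightarrow> nat list \<Rightarrow> (nat \<Rightarrow> nat) prog" where
  "slot_loads I C js = do {
     spend (njobs I);
     loop (\<lambda>j load. store (njobs I) load (the (C j)) (load (the (C j)) + 1)) js (\<lambda>t. 0)}"

subsection \<open>Enumeration of the configurations\<close>

primrec assignments :: "nat \<Rightarrow> nat list \<Rightarrow> nat list \<Rightarrow> (nat \<rightharpoonup> nat) list prog" where
  "assignments n ts [] = tick (do {spend n; ret [Map.empty]})"
| "assignments n ts (j # js) = tick (do {
     Cs \<leftarrow> assignments n ts js;
     loop (\<lambda>C. loop (\<lambda>t out. do {C' \<leftarrow> store n C j (Some t); ret (C' # out)}) ts) Cs []})"

definition check_config :: "inst \<Rightarrow> nat list \<Rightarrow> nat list \<Rightarrow> nat \<Rightarrow> (nat \<rightharpoonup> nat) \<Rightarrow> bool prog" where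
  "check_config I js ands t\<^sub>0 C = do {
     later \<leftarrow> mall (\<lambda>j. ret (C j \<noteq> Some t\<^sub>0)) js;
     load \<leftarrow> slot_loads I C js;
     cap \<leftarrow> mall (\<lambda>t. ret (load t \<le> machines I)) (upto_n I);
     prc \<leftarrow> mall (\<lambda>j. mall (\<lambda>i. ret (i \<in> vars (psi I j) \<longrightarrow> the (C i) < the (C j))) js) ands;
     ret (\<not> later \<and> cap \<and> prc)}"

text \<open>The configurations are enumerated by the earliest completion time \<^term>\<open>t\<^sub>0\<close> of a successor:
  all successors then complete in the next \<^term>\<open>k\<^sub>s\<close> slots. The parameters \<^term>\<open>js\<close> and
  \<^term>\<open>ands\<close> list the successors and the and-jobs.\<close>

definition configs :: "inst \<Rightarrow> nat list \<Rightarrow> nat list \<Rightarrow> (nat \<rightharpoonup> nat) list prog" where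
  "configs I js ands =
     (if js = [] then assignments (njobs I) [] []
      else loop (\<lambda>t\<^sub>0 out. do {
             Cs \<leftarrow> assignments (njobs I) [t\<^sub>0..<min (t\<^sub>0 + length js) (Suc (njobs I))] js;
             loop (\<lambda>C out. do {
               ok \<leftarrow> check_config I js ands t\<^sub>0 C;
               ret (if ok then C # out else out)}) Cs out})
           (upto_n I) [])"

subsection \<open>Choosing one predecessor for every or-job\<close>

text \<open>The map \<^term>\<open>f\<close> sends an or-job \<^term>\<open>j\<close> to the chosen predecessor \<open>i\<^sub>j\<close>.\<close>

definition early_preds :: "inst \<Rightarrow> nat list \<Rightarrow> nat list \<Rightarrow> (nat \<rightharpoonup> nat) \<Rightarrow> (nat \<rightharpoonup> nat) prog" where
  "early_preds I js ors C = do {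
     spend (njobs I);
     loop (\<lambda>j f. do {
       cands \<leftarrow> mfilter (\<lambda>i. ret (i \<in> vars (psi I j) \<and> the (C i) < the (C j))) js;
       if cands = [] then ret f
       else do {i \<leftarrow> pick cands; store (njobs I) f j (Some i)}}) ors Map.empty}"

text \<open>
  The list argument of \<open>branch\<close> is the suffix \<open>j\<^sub>l, \<dots>, j\<^sub>q\<close> of the sorted or-jobs, and \<open>leaf\<close>
  processes a complete choice of predecessors, updating the best solution found so far.

  The job \<^term>\<open>i\<close> picked for \<^term>\<open>S\<close> has to be a non-successor. When it is picked, no
  predecessor of \<open>j\<^sub>l\<close> among the successors completes before \<open>j\<^sub>l\<close>, so a successor \<^term>\<open>i\<close>
  would always make the attempt fail; picking it although a non-successor with the same set
  \<^term>\<open>S\<close> exists could miss all feasible schedules.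
\<close>

primrec branch ::
  "inst \<Rightarrow> nat list \<Rightarrow> ((nat \<rightharpoonup> nat) \<Rightarrow> 'b \<Rightarrow> 'b prog) \<Rightarrow> nat list \<Rightarrow> (nat \<rightharpoonup> nat) \<Rightarrow> 'b \<Rightarrow> 'b prog"
where
  "branch I ands leaf [] f best = tick (leaf f best)"
| "branch I ands leaf (j # js) f best = tick (
     if f j \<noteq> None then branch I ands leaf js f best
     else do {
       spend (length js);
       let D = (j # js) @ ands;
       Ts \<leftarrow> subsets_prog (njobs I) (js @ ands);
       loop (\<lambda>T best. do {
         spend (njobs I);
         let S = insert j T;
         cands \<leftarrow> mfilter (\<lambda>i. if psi I i = Always then mall (\<lambda>k. ret (i \<in> vars (psi I k) \<longleftrightarrow> k \<in> S)) D
                              else ret False) (upto_n I);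
         if cands = [] then ret best
         else do {
           i \<leftarrow> pick cands;
           f' \<leftarrow> loop (\<lambda>k f. if k \<in> S then store (njobs I) f k (Some i) else ret f) (j # js) f;
           branch I ands leaf js f' best}}) Ts best})"

subsection \<open>Inserting the non-successors\<close>

definition replace_ors :: "inst \<Rightarrow> (nat \<rightharpoonup> nat) \<Rightarrow> inst" where
  "replace_ors I f = I\<lparr>psi := \<lambda>j. if is_Or (psi I j) then And {the (f j)} else psi I j\<rparr>"

primrec first_free :: "nat \<Rightarrow> (nat \<Rightarrow> nat) \<Rightarrow> nat list \<Rightarrow> nat option prog" where
  "first_free m load [] = tick (ret None)"
| "first_free m load (t # ts) = tick (if load t < m then ret (Some t) else first_free m load ts)"

text \<open>The state of the insertion consists of the completion times and the number of jobs per slot;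
  it is \<^term>\<open>None\<close> once the attempt has been discarded. Slots beyond \<^term>\<open>n\<close> are never needed.\<close>

type_synonym state = "((nat \<rightharpoonup> nat) \<times> (nat \<Rightarrow> nat)) option"

definition place :: "inst \<Rightarrow> nat \<Rightarrow> state \<Rightarrow> state prog" where
  "place I i st = (case st of
     None \<Rightarrow> ret None
   | Some (C, load) \<Rightarrow>
       if C i \<noteq> None then ret st
       else do {
         slot \<leftarrow> first_free (machines I) load (upto_n I);
         case slot of
           None \<Rightarrow> ret None
         | Some t \<Rightarrow> do {
             C' \<leftarrow> store (njobs I) C i (Some t);
             load' \<leftarrow> store (njobs I) load t (load t + 1);
             ret (Some (C', load'))}})"

definition place_before :: "inst \<Rightarrow> nat \<Rightarrow> nat \<Rightarrow> state \<Rightarrow> state prog" where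
  "place_before I j i st = do {
     st' \<leftarrow> place I i st;
     ret (case st' of
            None \<Rightarrow> None
          | Some (C, load) \<Rightarrow> if the (C i) < the (C j) then st' else None)}"

definition insert_jobs :: "inst \<Rightarrow> nat list \<Rightarrow> (nat \<rightharpoonup> nat) \<Rightarrow> (nat \<rightharpoonup> nat) option prog" where
  "insert_jobs I js C = do {
     load \<leftarrow> slot_loads I C js;
     order \<leftarrow> sort_prog (\<lambda>j. the (C j)) js;
     st \<leftarrow> loop (\<lambda>j. loop (\<lambda>i st. if i \<in> vars (psi I j) then place_before I j i st else ret st)
                    (upto_n I)) order (Some (C, load));
     st' \<leftarrow> loop (place I) (upto_n I) st;
     ret (map_option fst st')}"

type_synonym best = "((nat \<rightharpoonup> nat) \<times> nat) option"

definition better :: "(nat \<rightharpoonup> nat) \<times> nat \<Rightarrow> best \<Rightarrow> best prog" where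
  "better new best = (case best of
     None \<Rightarrow> ret (Some new)
   | Some old \<Rightarrow>
       if snd new < snd old then ret (Some new)
       else if snd old < snd new then ret best
       else alt (ret (Some new)) (ret best))"

text \<open>Charged explicitly: \<open>n\<^sup>2\<close> steps for writing down the modified constraints as a bit matrix, and
  \<^term>\<open>n\<close> steps for evaluating the objective in one pass over the jobs.\<close>

definition try_preds ::
  "objective \<Rightarrow> inst \<Rightarrow> nat list \<Rightarrow> (nat \<rightharpoonup> nat) \<Rightarrow> (nat \<rightharpoonup> nat) \<Rightarrow> best \<Rightarrow> best prog" where
  "try_preds \<gamma> I js C f best = do {
     spend (njobs I * njobs I);
     let I' = replace_ors I f;
     res \<leftarrow> insert_jobs I' js C;
     case res of
       None \<Rightarrow> ret best
     | Some C' \<Rightarrow> do {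
         spend (njobs I);
         better (C', obj_value \<gamma> I (\<lambda>j. the (C' j))) best}}"

subsection \<open>Main program\<close>

definition and_or_alg_succ :: "objective \<Rightarrow> inst \<Rightarrow> (nat \<rightharpoonup> nat) option prog" where
  "and_or_alg_succ \<gamma> I = do {
     js \<leftarrow> mfilter (\<lambda>j. ret (psi I j \<noteq> Always)) (upto_n I);
     ands \<leftarrow> mfilter (\<lambda>j. ret (is_And (psi I j))) js;
     ors \<leftarrow> mfilter (\<lambda>j. ret (is_Or (psi I j))) js;
     Cs \<leftarrow> configs I js ands;
     best \<leftarrow> loop (\<lambda>C best. do {
       f \<leftarrow> early_preds I js ors C;
       order \<leftarrow> sort_prog (\<lambda>j. the (C j)) ors;
       branch I ands (try_preds \<gamma> I js C) order f best}) Cs None;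
     ret (map_option fst best)}"


section \<open>The enumeration yields exactly the configurations\<close>

definition is_config :: "inst \<Rightarrow> (nat \<rightharpoonup> nat) \<Rightarrow> bool" where
  "is_config I C \<longleftrightarrow>
     dom C = succs I \<and>
     (\<forall>j\<in>succs I. the (C j) \<in> {1..njobs I}) \<and>
     (\<forall>i\<in>succs I. \<forall>j\<in>succs I. int (the (C i)) - int (the (C j)) \<le> int (card (succs I)) - 1) \<and>
     (\<forall>t. card {j \<in> succs I. the (C j) = t} \<le> machines I) \<and>
     (\<forall>i\<in>succs I. \<forall>j\<in>succs I. is_And (psi I j) \<and> i \<in> vars (psi I j) \<longrightarrow> the (C i) < the (C j))"

text \<open>The outcomes of a program, without the running times:\<close>

definition outs :: "'a prog \<Rightarrow> 'a set" where "outs p = fst ` runs p"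

lemma outs_bind: "outs (bind_prog p f) = (\<Union>x\<in>outs p. outs (f x))"
  unfolding outs_def bind_prog_def by (force simp: image_iff)

lemma outs_ret: "outs (ret x) = {x}" by (simp add: outs_def ret_def)

lemma outs_spend: "outs (spend x) = {()}" by (simp add: outs_def spend_def)

lemma outs_tick: "outs (tick p) = outs p" by (simp add: tick_def outs_bind outs_spend)

lemma outs_store: "outs (store n f x v) = {f(x:=v)}" by (simp add: store_def outs_bind outs_spend outs_ret)

lemmas outs_simps = outs_bind outs_ret outs_spend outs_tick outs_store

lemma outs_loop: "(\<And>x s. x \<in> set xs \<Longrightarrow> outs (f x s) = {g x s}) \<Longrightarrow> outs (loop f xs s) = {fold g xs s}"
  by (induction xs arbitrary: s) (simp_all add: outs_simps)

lemma outs_mall: "(\<And>x. x \<in> set xs \<Longrightarrow> outs (p x) = {P x}) \<Longrightarrow> outs (mall p xs) = {list_all P xs}"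
  by (induction xs) (simp_all add: outs_simps)

lemma fold_cons: "fold (\<lambda>x out. f x # out) xs out = rev (map f xs) @ out"
  by (induction xs arbitrary: out) auto

lemma fold_app: "fold (\<lambda>x out. f x @ out) xs out = concat (rev (map f xs)) @ out"
  by (induction xs arbitrary: out) auto

lemma fold_if: "fold (\<lambda>x out. if P x then x # out else out) xs out = rev (filter P xs) @ out"
  by (induction xs arbitrary: out) auto

primrec all_maps :: "nat list \<Rightarrow> nat list \<Rightarrow> (nat \<rightharpoonup> nat) list" where
 "all_maps ts [] = [Map.empty]"
| "all_maps ts (j # js) = concat (rev (map (\<lambda>C. rev (map (\<lambda>t. C(j \<mapsto> t)) ts)) (all_maps ts js)))"

lemma outs_assignments: "outs (assignments n ts js) = {all_maps ts js}"
proof (induction js)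
  case (Cons j js)
  have 1: "outs (loop (\<lambda>t out. store n C j (Some t) \<bind> (\<lambda>C'. ret (C' # out))) ts s) = {rev (map (\<lambda>t. C(j \<mapsto> t)) ts) @ s}" for C s
    by (subst outs_loop[where g="\<lambda>t out. C(j \<mapsto> t) # out"]) (simp_all add: outs_simps fold_cons)
  show ?case using Cons
    by (simp add: outs_simps, subst outs_loop[where g="\<lambda>C out. rev (map (\<lambda>t. C(j \<mapsto> t)) ts) @ out"])
     (simp_all add: 1 fold_app)
qed (simp add: outs_simps)

lemma set_all_maps: "distinct js \<Longrightarrow> set (all_maps ts js) = {C. dom C = set js \<and> ran C \<subseteq> set ts}"
proof (induction js)
  case (Cons j js)
  show ?case
  proof (intro set_eqI iffI)
    fix C assume "C \<in> set (all_maps ts (j # js))"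
    then obtain C' t where "C' \<in> set (all_maps ts js)" "t \<in> set ts" and C: "C = C'(j \<mapsto> t)" by auto
    then have C': "dom C' = set js" "ran C' \<subseteq> set ts" "t \<in> set ts" using Cons by auto
    have "C' j = None" using C'(1) Cons.prems by auto
    then have "ran C = insert t (ran C')" unfolding C by (rule ran_map_upd)
    then show "C \<in> {C. dom C = set (j # js) \<and> ran C \<subseteq> set ts}"
      using C' by (simp add: C)
  next
    fix C assume C: "C \<in> {C. dom C = set (j # js) \<and> ran C \<subseteq> set ts}"
    then obtain t where t: "C j = Some t" by (auto simp: dom_def)
    have "C(j := None) \<in> set (all_maps ts js)" using Cons C by (auto simp: ran_def)
    moreover have "t \<in> set ts" using C t by (auto simp: ran_def)
    moreover have "C = (C(j := None))(j \<mapsto> t)" using t by auto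
    ultimately have "\<exists>D\<in>set (all_maps ts js). C \<in> (\<lambda>t. D(j \<mapsto> t)) ` set ts"
      by (intro bexI[of _ "C(j := None)"] image_eqI)
    then show "C \<in> set (all_maps ts (j # js))" by simp
  qed
qed (auto simp: ran_def)

lemma fold_load: "fold (\<lambda>j load. load(c j := load (c j) + 1)) js l t = l t + length (filter (\<lambda>j. c j = t) js)" for c :: "nat \<Rightarrow> nat" and l :: "nat \<Rightarrow> nat"
  by (induction js arbitrary: l) auto

lemma outs_loads: "outs (slot_loads I C js) = {\<lambda>t. length (filter (\<lambda>j. the (C j) = t) js)}"
  unfolding slot_loads_def
  apply (simp add: outs_simps)
  apply (subst outs_loop[where g="\<lambda>j load. load(the (C j) := load (the (C j)) + 1)"])
   apply (simp_all add: outs_simps)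
  using fold_load[of "\<lambda>j. the (C j)" js "\<lambda>_. 0"] by (auto)

definition config_test where "config_test I js ands t0 C \<longleftrightarrow> \<not> list_all (\<lambda>j. C j \<noteq> Some t0) js \<and>
   list_all (\<lambda>t. length (filter (\<lambda>j. the (C j) = t) js) \<le> machines I) (upto_n I) \<and>
   list_all (\<lambda>j. list_all (\<lambda>i. i \<in> vars (psi I j) \<longrightarrow> the (C i) < the (C j)) js) ands"

lemma outs_check: "outs (check_config I js ands t0 C) = {config_test I js ands t0 C}"
proof -
  have a: "outs (mall (\<lambda>j. mall (\<lambda>i. ret (i \<in> vars (psi I j) \<longrightarrow> the (C i) < the (C j))) js) ands)
    = {list_all (\<lambda>j. list_all (\<lambda>i. i \<in> vars (psi I j) \<longrightarrow> the (C i) < the (C j)) js) ands}"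
    by (intro outs_mall outs_ret)
  have b: "outs (mall (\<lambda>j. ret (Q j)) xs) = {list_all Q xs}" for Q :: "nat \<Rightarrow> bool" and xs
    by (intro outs_mall outs_ret)
  show ?thesis unfolding check_config_def config_test_def
    by (simp add: outs_bind a b outs_loads outs_ret)
qed

lemma outs_configs: "outs (configs I js ands) = {if js = [] then [Map.empty] else
  concat (rev (map (\<lambda>t0. rev (filter (config_test I js ands t0) (all_maps [t0..<min (t0 + length js) (Suc (njobs I))] js))) (upto_n I)))}"
proof -
  have 1: "outs (loop (\<lambda>C out. check_config I js ands t\<^sub>0 C \<bind> (\<lambda>ok. ret (if ok then C # out else out))) Cs s)
     = {rev (filter (config_test I js ands t\<^sub>0) Cs) @ s}" for t\<^sub>0 Cs s
    by (subst outs_loop[where g="\<lambda>C out. if config_test I js ands t\<^sub>0 C then C # out else out"]) (simp_all add: outs_simps outs_check fold_if)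
  show ?thesis
  proof (cases "js = []")
    case True
    then show ?thesis by (simp add: configs_def outs_simps)
  next
    case False
    have "outs (configs I js ands) = {fold (\<lambda>t0 out. rev (filter (config_test I js ands t0)
        (all_maps [t0..<min (t0 + length js) (Suc (njobs I))] js)) @ out) (upto_n I) []}"
      unfolding configs_def if_not_P[OF False]
      by (intro outs_loop) (simp add: outs_bind outs_assignments 1 del: upt_Suc)
    then show ?thesis using False by (simp add: fold_app del: upt_Suc)
  qed
qed

lemma configs_correct:
  assumes "distinct js" "set js = succs I" "set ands = {j \<in> succs I. is_And (psi I j)}"
    and "Cs \<in> fst ` runs (configs I js ands)"
  shows "set Cs = {C. is_config I C}"
proof -
  have len: "length js = card (succs I)" using assms distinct_card by metis
  have cap: "length (filter (\<lambda>j. the (C j) = t) js) = card {j \<in> succs I. the (C j) = t}" for C :: "nat \<rightharpoonup> nat" and t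
    using assms(1) by (metis assms(2) distinct_card distinct_filter set_filter)
  show ?thesis
  proof (cases "js = []")
    case True
    then have "succs I = {}" using assms by auto
    then show ?thesis using assms(4) True unfolding outs_def[symmetric] outs_configs
      by (auto simp: is_config_def)
  next
    case False
    have Cs: "set Cs = (\<Union>t0\<in>{1..njobs I}. {C. config_test I js ands t0 C \<and> dom C = succs I \<and> ran C \<subseteq> {t0..<min (t0 + length js) (Suc (njobs I))}})"
      using assms(4) False unfolding outs_def[symmetric] outs_configs
      by (auto simp: set_all_maps[OF assms(1)] assms(2) simp del: upt_Suc; force)
    show ?thesis
    proof (intro set_eqI iffI)
      fix C assume "C \<in> set Cs"
      then obtain t0 where t0: "t0 \<in> {1..njobs I}" "config_test I js ands t0 C" "dom C = succs I" "ran C \<subseteq> {t0..<min (t0 + length js) (Suc (njobs I))}"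
        unfolding Cs by auto
      have r: "the (C j) \<in> {t0..<min (t0 + length js) (Suc (njobs I))}" if "j \<in> succs I" for j
        using t0(3,4) that by (force simp: ran_def dom_def)
      have rn: "the (C j) \<in> {1..njobs I}" if "j \<in> succs I" for j using r[OF that] t0(1) by auto
      have w: "int (the (C i)) - int (the (C j)) \<le> int (card (succs I)) - 1" if "i \<in> succs I" "j \<in> succs I" for i j
        using r[OF that(1)] r[OF that(2)] len by auto
      have c: "card {j \<in> succs I. the (C j) = t} \<le> machines I" for t
      proof (cases "t \<in> {1..njobs I}")
        case True then show ?thesis using t0(2) unfolding config_test_def cap by (auto simp: list_all_iff simp del: upt_Suc)
      next
        case False then have "{j \<in> succs I. the (C j) = t} = {}" using rn by auto
        then show ?thesis by (metis card.empty le0)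
      qed
      show "C \<in> {C. is_config I C}" using t0 rn w c assms(2,3)
        unfolding is_config_def config_test_def by (auto simp: list_all_iff)
    next
      fix C assume "C \<in> {C. is_config I C}"
      then have C: "dom C = succs I" "\<And>j. j \<in> succs I \<Longrightarrow> the (C j) \<in> {1..njobs I}"
        "\<And>i j. i \<in> succs I \<Longrightarrow> j \<in> succs I \<Longrightarrow> int (the (C i)) - int (the (C j)) \<le> int (card (succs I)) - 1"
        "\<And>t. card {j \<in> succs I. the (C j) = t} \<le> machines I"
        "\<And>i j. i \<in> succs I \<Longrightarrow> j \<in> succs I \<Longrightarrow> is_And (psi I j) \<Longrightarrow> i \<in> vars (psi I j) \<Longrightarrow> the (C i) < the (C j)"
        unfolding is_config_def by auto
      have ne: "succs I \<noteq> {}" "finite (succs I)" using False assms(2)[symmetric] by auto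
      define t0 where "t0 = Min ((\<lambda>j. the (C j)) ` succs I)"
      have "t0 \<in> (\<lambda>j. the (C j)) ` succs I" unfolding t0_def using ne by (intro Min_in) auto
      then obtain j0 where j0: "j0 \<in> succs I" "the (C j0) = t0" by auto
      have ge: "t0 \<le> the (C j)" if "j \<in> succs I" for j unfolding t0_def using ne that by auto
      have "ran C \<subseteq> {t0..<min (t0 + length js) (Suc (njobs I))}"
      proof
        fix t assume "t \<in> ran C"
        then obtain j where j: "C j = Some t" by (auto simp: ran_def)
        then have js: "j \<in> succs I" using C(1) by auto
        show "t \<in> {t0..<min (t0 + length js) (Suc (njobs I))}"
          using ge[OF js] C(2)[OF js] C(3)[OF js j0(1)] j j0 len by auto
      qed
      moreover have "config_test I js ands t0 C"
      proof -
        have "C j0 = Some t0" using j0 C(1) by force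
        then show ?thesis using j0 C(4,5) assms(2,3) unfolding config_test_def cap by (auto simp: list_all_iff)
      qed
      moreover have "t0 \<in> {1..njobs I}" using C(2)[OF j0(1)] j0(2) by simp
      ultimately show "C \<in> set Cs" unfolding Cs using C(1) by auto
    qed
  qed
qed

end

theory Submission
  imports Defs "HOL-Library.Multiset" "HOL-Combinatorics.Transposition"
begin

text \<open>
  Soundness is direct. For optimality, take an optimal schedule that first minimizes the total
  completion time and then maximizes the total completion time of the successors. It has no empty
  slot, and exchanging a successor with a non-successor in the next slot shows that the successors
  occupy consecutive slots, so its successor completion times form a configuration. For this
  configuration the schedule guides the search: for an or-job \<open>j\<close> without chosen predecessor, some
  non-successor \<open>p\<close> precedes it in the schedule, and \<open>S\<close> is taken to be the set of the remaining
  successors of \<open>p\<close>. Any other job \<open>i\<close> with this set can be swapped with \<open>p\<close>: the constraints still to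
  be met do not distinguish the two, and \<open>p\<close> has not been chosen before, since otherwise it would have
  been chosen for \<open>j\<close> as well. Finally, the greedy insertion completes at least as many jobs by any
  time as every schedule with the same successor completion times.

  The search tree below one configuration has at most \<open>2 ^ (k * (k - 1) div 2)\<close> leaves. The
  insertion at a leaf takes time \<open>O((k + 1) * n\<^sup>2)\<close>, and the gap to \<open>2 ^ k\<^sup>2\<close> absorbs the factor
  \<open>k + 1\<close>.
\<close>

section \<open>Outcomes and running times of programs\<close>

text \<open>Every claim is about all outcomes, and this shapes the argument. The program decides
  which eligible job is picked, so no single schedule can be the target of the search. What is
  carried down the search tree is the existence of a guiding schedule of unchanged objective value,
  rebuilt after each pick; only the completion times of the successors stay fixed in it. At a leaf
  the guide shows that the insertion succeeds, but the schedule found may be a different one. The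
  two are compared by the number of jobs finished by each time, on which both objectives depend
  monotonically. The best solution found so far is threaded through all loops and recursive calls.
  Preservation and attainment are therefore proved for arbitrary predicates on this accumulator. The
  number of machines does not influence the cost in this model. It enters the final bound only
  because a feasible instance has at least one machine.\<close>

lemma outs_alt: "outs (alt p q) = outs p \<union> outs q"
  by (auto simp: outs_def alt_def)

lemma outs_pick: "outs (pick xs) = set xs"
  by (force simp: outs_def pick_def)

lemma outs_mfilter:
  "(\<And>x. x \<in> set xs \<Longrightarrow> outs (p x) = {P x}) \<Longrightarrow> outs (mfilter p xs) = {filter P xs}"
  by (induction xs) (simp_all add: outs_simps)

text \<open>The invariant may refer to the part of the list already processed, which the insertion
  needs: what is known about its state depends on the jobs handled so far. The induction runs over
  loops started after an arbitrary prefix.\<close>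

lemma loop_prefix_induct:
  assumes "s' \<in> outs (loop f xs s)" "Inv [] s"
    "\<And>ys x zs s s'. xs = ys @ x # zs \<Longrightarrow> Inv ys s \<Longrightarrow> s' \<in> outs (f x s) \<Longrightarrow> Inv (ys @ [x]) s'"
  shows "Inv xs s'"
proof -
  have "Inv (us @ vs) s'" if "xs = us @ vs" "Inv us s" "s' \<in> outs (loop f vs s)" for us vs s
    using that
  proof (induction vs arbitrary: us s)
    case Nil
    then show ?case by (simp add: outs_simps)
  next
    case (Cons v vs)
    then obtain s1 where s1: "s1 \<in> outs (f v s)" "s' \<in> outs (loop f vs s1)"
      by (auto simp: outs_simps)
    have "Inv (us @ [v]) s1" using assms(3) Cons.prems s1 by blast
    then have "Inv ((us @ [v]) @ vs) s'" using Cons.IH Cons.prems(1) s1(2) by force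
    then show ?case by simp
  qed
  from this[of "[]" xs s] assms show ?thesis by simp
qed

lemma loop_invariant:
  assumes "s' \<in> outs (loop f xs s)" "R s"
    and "\<And>x s s'. x \<in> set xs \<Longrightarrow> R s \<Longrightarrow> s' \<in> outs (f x s) \<Longrightarrow> R s'"
  shows "R s'"
proof (rule loop_prefix_induct[OF assms(1), where Inv = "\<lambda>_. R"])
  show "R s'" if "xs = ys @ x # zs" "R s" "s' \<in> outs (f x s)" for ys x zs s s'
    using assms(3)[OF _ that(2,3)] that(1) by simp
qed (fact assms(2))

text \<open>This is how one good iteration \<open>y\<close> decides the result of an exhaustive
  search: \<open>R\<close> holds until \<open>y\<close> is first met, \<open>y\<close> turns
  \<open>R\<close> into \<open>T\<close>, and all other iterations keep whichever of the two
  holds.\<close>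

lemma loop_reaches:
  assumes "s' \<in> outs (loop f xs s)" "R s" "y \<in> set xs"
    and "\<And>x s s'. x \<in> set xs \<Longrightarrow> R s \<Longrightarrow> s' \<in> outs (f x s) \<Longrightarrow> R s'"
    and "\<And>x s s'. x \<in> set xs \<Longrightarrow> T s \<Longrightarrow> s' \<in> outs (f x s) \<Longrightarrow> T s'"
    and "\<And>s s'. R s \<Longrightarrow> s' \<in> outs (f y s) \<Longrightarrow> T s'"
  shows "T s'"
proof -
  have "(y \<in> set xs \<longrightarrow> T s') \<and> (y \<notin> set xs \<longrightarrow> R s')"
  proof (rule loop_prefix_induct[OF assms(1),
        where Inv = "\<lambda>ys s. (y \<in> set ys \<longrightarrow> T s) \<and> (y \<notin> set ys \<longrightarrow> R s)"])
    fix ys x zs s s'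
    assume x: "xs = ys @ x # zs" and Inv: "(y \<in> set ys \<longrightarrow> T s) \<and> (y \<notin> set ys \<longrightarrow> R s)"
      and s': "s' \<in> outs (f x s)"
    have "x \<in> set xs" using x by simp
    then show "(y \<in> set (ys @ [x]) \<longrightarrow> T s') \<and> (y \<notin> set (ys @ [x]) \<longrightarrow> R s')"
      using Inv assms(4)[OF _ _ s'] assms(5)[OF _ _ s'] assms(6)[of s s'] s' by (cases "x = y") auto
  qed (use assms(2) in simp)
  then show ?thesis using assms(3) by blast
qed

section \<open>Outcomes of sorting, subset enumeration and slot search\<close>

lemma outs_insort:
  assumes "zs \<in> outs (insort_prog key x ys)" "sorted_wrt (\<lambda>a b. key a \<le> key b) ys"
  shows "mset zs = add_mset x (mset ys)" "sorted_wrt (\<lambda>a b. key a \<le> key b) zs"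
proof -
  have "mset zs = add_mset x (mset ys) \<and> sorted_wrt (\<lambda>a b. key a \<le> key b) zs"
    using assms
  proof (induction ys arbitrary: zs)
    case Nil
    then show ?case by (simp add: outs_simps)
  next
    case (Cons y ys)
    consider (ahead) "zs = x # y # ys" "key x \<le> key y"
      | (behind) zs' where "zs = y # zs'" "zs' \<in> outs (insort_prog key x ys)" "key y \<le> key x"
      using Cons.prems(1) by (auto simp: outs_simps outs_alt split: if_splits)
    then show ?case
    proof cases
      case ahead
      then show ?thesis using Cons.prems(2) by fastforce
    next
      case behind
      have IH: "mset zs' = add_mset x (mset ys)" "sorted_wrt (\<lambda>a b. key a \<le> key b) zs'"
        using Cons behind by auto
      have "set zs' = insert x (set ys)" using IH(1) by (metis set_mset_add_mset_insert set_mset_mset)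
      then show ?thesis using IH behind Cons.prems(2) by auto
    qed
  qed
  then show "mset zs = add_mset x (mset ys)" "sorted_wrt (\<lambda>a b. key a \<le> key b) zs" by auto
qed

text \<open>Ties are broken nondeterministically, so the outcome is not a function of the input.
  Being a sorted permutation is all that is used later.\<close>

lemma outs_sort:
  assumes "ys \<in> outs (sort_prog key xs)"
  shows "mset ys = mset xs" "sorted_wrt (\<lambda>a b. key a \<le> key b) ys"
proof -
  have "mset ys = mset xs \<and> sorted_wrt (\<lambda>a b. key a \<le> key b) ys"
    using assms
  proof (induction xs arbitrary: ys)
    case (Cons x xs)
    then obtain zs where "zs \<in> outs (sort_prog key xs)" "ys \<in> outs (insort_prog key x zs)"
      by (auto simp: outs_simps)
    then show ?case using Cons.IH outs_insort by fastforce
  qed (simp add: outs_simps)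
  then show "mset ys = mset xs" "sorted_wrt (\<lambda>a b. key a \<le> key b) ys" by auto
qed

lemma outs_subsets_step:
  "outs (loop (\<lambda>S out. bind_prog (spend n) (\<lambda>_. ret (S # insert x S # out))) Ss out) =
   {fold (\<lambda>S out. S # insert x S # out) Ss out}"
  by (intro outs_loop) (simp add: outs_simps)

lemma set_fold_subsets:
  "set (fold (\<lambda>S out. S # insert x S # out) Ss out) = set Ss \<union> insert x ` set Ss \<union> set out"
  by (induction Ss arbitrary: out) auto

lemma length_fold_subsets:
  "length (fold (\<lambda>S out. S # insert x S # out) Ss out) = 2 * length Ss + length out"
  by (induction Ss arbitrary: out) auto

text \<open>Repeated elements of \<open>xs\<close> lead to repeated subsets. The length is therefore
  recorded separately; it determines the number of iterations in a search node.\<close>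

lemma outs_subsets:
  assumes "Ss \<in> outs (subsets_prog n xs)"
  shows "set Ss = Pow (set xs)" "length Ss = 2 ^ length xs"
proof -
  have "set Ss = Pow (set xs) \<and> length Ss = 2 ^ length xs"
    using assms
  proof (induction xs arbitrary: Ss)
    case (Cons x xs)
    then obtain Ts where "Ts \<in> outs (subsets_prog n xs)"
      and "Ss = fold (\<lambda>S out. S # insert x S # out) Ts []"
      by (auto simp: outs_bind outs_tick outs_subsets_step)
    then show ?case
      using Cons.IH by (auto simp: set_fold_subsets length_fold_subsets Pow_insert)
  qed (simp add: outs_simps)
  then show "set Ss = Pow (set xs)" "length Ss = 2 ^ length xs" by auto
qed

lemma outs_first_free: "outs (first_free m load ts) = {find (\<lambda>t. load t < m) ts}"
  by (induction ts) (simp_all add: outs_simps)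

section \<open>Upper bounds on running times\<close>

text \<open>Nonemptiness is part of the notion because a program without runs would satisfy every bound.\<close>

definition within :: "'a prog \<Rightarrow> nat \<Rightarrow> bool" where
  "within p b \<longleftrightarrow> outs p \<noteq> {} \<and> (\<forall>(x, t)\<in>runs p. t \<le> b)"

lemma within_mono: "within p a \<Longrightarrow> a \<le> b \<Longrightarrow> within p b"
  unfolding within_def by fastforce

lemma within_ret: "within (ret x) b"
  by (simp add: within_def outs_ret) (simp add: ret_def)

lemma within_spend: "within (spend t) t"
  by (simp add: within_def outs_spend) (simp add: spend_def)

lemma within_bind:
  assumes "within p a" "\<And>x. x \<in> outs p \<Longrightarrow> within (f x) b"
  shows "within (bind_prog p f) (a + b)"
proof -
  have "t \<le> a + b" if yt: "(y, t) \<in> runs (bind_prog p f)" for y t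
  proof -
    obtain x s1 s2 where st: "(x, s1) \<in> runs p" "(y, s2) \<in> runs (f x)" "t = s1 + s2"
      using yt by (auto simp: bind_prog_def)
    then have "x \<in> outs p" unfolding outs_def by force
    then have "s1 \<le> a" "s2 \<le> b" using assms st unfolding within_def by fastforce+
    then show ?thesis using st by simp
  qed
  moreover have "outs (bind_prog p f) \<noteq> {}"
    using assms by (auto simp: outs_bind within_def)
  ultimately show ?thesis by (auto simp: within_def)
qed

lemma within_tick: "within p b \<Longrightarrow> within (tick p) (Suc b)"
  unfolding tick_def using within_bind[OF within_spend[of 1], of "\<lambda>_. p" b] by simp

lemma within_alt: "within p b \<Longrightarrow> within q b \<Longrightarrow> within (alt p q) b"
  unfolding within_def outs_alt by (auto simp: alt_def)

lemma within_if: "(P \<Longrightarrow> within p b) \<Longrightarrow> (\<not> P \<Longrightarrow> within q b) \<Longrightarrow> within (if P then p else q) b"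
  by simp

lemma within_pick: "xs \<noteq> [] \<Longrightarrow> within (pick xs) (length xs)"
  unfolding within_def outs_pick by (auto simp: pick_def)

lemma within_store: "within (store n f x v) n"
  unfolding store_def
  by (rule within_mono, rule within_bind, rule within_spend, rule within_ret[where b = 0]) simp

lemma within_loop_invariant:
  assumes "\<And>x s. x \<in> set xs \<Longrightarrow> R s \<Longrightarrow> within (f x s) b" "R s"
    and "\<And>x s s'. x \<in> set xs \<Longrightarrow> R s \<Longrightarrow> s' \<in> outs (f x s) \<Longrightarrow> R s'"
  shows "within (loop f xs s) (length xs * (b + 1) + 1)"
  using assms
proof (induction xs arbitrary: s)
  case Nil
  then show ?case using within_tick[OF within_ret[where b = 0]] by simp
next
  case (Cons x xs)
  have "within (tick (bind_prog (f x s) (loop f xs))) (Suc (b + (length xs * (b + 1) + 1)))"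
  proof (intro within_tick within_bind)
    show "within (f x s) b" using Cons.prems by simp
    fix s' assume "s' \<in> outs (f x s)"
    then have "R s'" using Cons.prems(2,3) by (meson list.set_intros(1))
    then show "within (loop f xs s') (length xs * (b + 1) + 1)"
      by (intro Cons.IH) (use Cons.prems in \<open>meson list.set_intros(2)\<close>)+
  qed
  then show ?case by (simp add: algebra_simps)
qed

lemma within_loop:
  assumes "\<And>x s. x \<in> set xs \<Longrightarrow> within (f x s) b"
  shows "within (loop f xs s) (length xs * (b + 1) + 1)"
  by (rule within_loop_invariant[where R = "\<lambda>_. True"]) (use assms in auto)

lemma within_mfilter:
  assumes "\<And>x. x \<in> set xs \<Longrightarrow> within (p x) b"
  shows "within (mfilter p xs) (length xs * (b + 1) + 1)"
  using assms
proof (induction xs)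
  case Nil
  then show ?case using within_tick[OF within_ret[where b = 0]] by simp
next
  case (Cons x xs)
  have "within (mfilter p (x # xs)) (Suc (b + ((length xs * (b + 1) + 1) + 0)))"
    unfolding mfilter.simps
    by (intro within_tick within_bind Cons.IH within_ret) (use Cons.prems in auto)
  then show ?case by (simp add: algebra_simps)
qed

lemma within_mall:
  assumes "\<And>x. x \<in> set xs \<Longrightarrow> within (p x) b"
  shows "within (mall p xs) (length xs * (b + 1) + 1)"
  using assms
proof (induction xs)
  case Nil
  then show ?case using within_tick[OF within_ret[where b = 0]] by simp
next
  case (Cons x xs)
  have "within (mall p (x # xs)) (Suc (b + ((length xs * (b + 1) + 1) + 0)))"
    unfolding mall.simps
    by (intro within_tick within_bind Cons.IH within_ret) (use Cons.prems in auto)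
  then show ?case by (simp add: algebra_simps)
qed

lemma within_insort: "within (insort_prog key x ys) (length ys + 1)"
proof (induction ys)
  case Nil
  then show ?case using within_tick[OF within_ret[where b = 0]] by simp
next
  case (Cons y ys)
  have 1: "within (bind_prog (insort_prog key x ys) (\<lambda>zs. ret (y # zs))) (length ys + 1 + 0)"
    by (intro within_bind Cons.IH within_ret)
  show ?case
    using 1 by (auto intro!: within_tick within_ret within_alt simp del: One_nat_def)
qed

lemma within_sort: "within (sort_prog key xs) ((length xs + 1)\<^sup>2)"
proof (induction xs)
  case Nil
  then show ?case using within_tick[OF within_ret[where b = 0]] by simp
next
  case (Cons x xs)
  have "within (sort_prog key (x # xs)) (Suc ((length xs + 1)\<^sup>2 + (length xs + 1)))"
    unfolding sort_prog.simps
  proof (intro within_tick within_bind Cons.IH)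
    fix ys assume "ys \<in> outs (sort_prog key xs)"
    then have "length ys = length xs" using outs_sort(1) mset_eq_length by blast
    then show "within (insort_prog key x ys) (length xs + 1)" using within_insort[of key x ys] by simp
  qed
  then show ?case by (rule within_mono) (simp add: power2_eq_square)
qed

text \<open>The subtracted \<open>2\<close> is a saving for \<open>within_branch\<close>, where it
  pays for the step of the node itself and the final step of its loop over the subsets.\<close>

lemma within_subsets: "within (subsets_prog n xs) (2 ^ length xs * (n + 3) - 2)"
proof (induction xs)
  case Nil
  have "within (subsets_prog n []) (Suc (n + 0))"
    unfolding subsets_prog.simps by (intro within_tick within_bind within_spend within_ret)
  then show ?case by (rule within_mono) simp
next
  case (Cons x xs)
  have "within (subsets_prog n (x # xs))
    (Suc (2 ^ length xs * (n + 3) - 2 + (2 ^ length xs * ((n + 0) + 1) + 1)))"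
    unfolding subsets_prog.simps
  proof (intro within_tick within_bind Cons.IH)
    fix Ss assume "Ss \<in> outs (subsets_prog n xs)"
    then have "length Ss = 2 ^ length xs" by (rule outs_subsets)
    then show "within (loop (\<lambda>S out. bind_prog (spend n) (\<lambda>_. ret (S # insert x S # out))) Ss [])
        (2 ^ length xs * ((n + 0) + 1) + 1)"
      using within_loop[of Ss "\<lambda>S out. bind_prog (spend n) (\<lambda>_. ret (S # insert x S # out))" "n + 0" "[]"]
      by (metis within_bind within_spend within_ret)
  qed
  moreover have "Suc (p * (n + 3) - 2 + (p * ((n + 0) + 1) + 1)) \<le> 2 * p * (n + 3) - 2"
    if "1 \<le> p" for p
  proof -
    define q where "q = p * n"
    have eqs: "2 * p * (n + 3) = 2 * q + 6 * p" "p * (n + 3) = q + 3 * p" "p * (n + 0 + 1) = q + p"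
      by (simp_all add: q_def algebra_simps)
    show ?thesis unfolding eqs using that by simp
  qed
  from this[of "2 ^ length xs"] have "Suc (2 ^ length xs * (n + 3) - 2 + (2 ^ length xs * ((n + 0) + 1) + 1))
      \<le> 2 ^ length (x # xs) * (n + 3) - 2"
    by simp
  ultimately show ?case by (rule within_mono)
qed

section \<open>Counting jobs in time slots\<close>

lemma finite_jobs: "finite (jobs I)" and card_jobs: "card (jobs I) = njobs I"
  by (simp_all add: jobs_def)

lemma card_slots_less:
  fixes C :: "nat \<Rightarrow> nat"
  assumes "finite A" "\<And>j. j \<in> A \<Longrightarrow> 1 \<le> C j"
  shows "card {j \<in> A. C j < t} = (\<Sum>s\<in>{1..<t}. card {j \<in> A. C j = s})"
proof -
  have "{j \<in> A. C j < t} = (\<Union>s\<in>{1..<t}. {j \<in> A. C j = s})" using assms(2) by auto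
  then show ?thesis using assms(1) by (simp add: card_UN_disjoint disjoint_iff)
qed

lemma schedule_card_less:
  assumes "schedule I C"
  shows "card {j \<in> jobs I. C j < t} \<le> machines I * (t - 1)"
proof -
  have "card {j \<in> jobs I. C j < t} = (\<Sum>s\<in>{1..<t}. card {j \<in> jobs I. C j = s})"
    using assms finite_jobs by (intro card_slots_less) (auto simp: schedule_def)
  also have "\<dots> \<le> (\<Sum>s\<in>{1..<t}. machines I)"
    using assms by (intro sum_mono) (auto simp: schedule_def)
  finally show ?thesis by (simp add: mult.commute)
qed

text \<open>Layer-cake formula: \<open>C j\<close> is the number of thresholds \<open>t\<close>
  below it.\<close>

lemma sum_eq_sum_card_greater:
  fixes C :: "'a \<Rightarrow> nat"
  assumes "finite A" "\<And>j. j \<in> A \<Longrightarrow> C j \<le> N"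
  shows "(\<Sum>j\<in>A. C j) = (\<Sum>t<N. card {j \<in> A. t < C j})"
proof -
  have "(\<Sum>j\<in>A. C j) = (\<Sum>j\<in>A. \<Sum>t<N. if t < C j then 1 else 0)"
  proof (rule sum.cong[OF refl])
    fix j assume "j \<in> A"
    then have "{..<N} \<inter> {t. t < C j} = {..<C j}" using assms(2) by force
    then show "C j = (\<Sum>t<N. if t < C j then 1 else 0)" by (simp add: sum.If_cases)
  qed
  also have "\<dots> = (\<Sum>t<N. \<Sum>j\<in>A. if t < C j then 1 else 0)" by (rule sum.swap)
  also have "\<dots> = (\<Sum>t<N. card {j \<in> A. t < C j})"
    using assms(1) by (simp add: sum.If_cases Int_def)
  finally show ?thesis .
qed

text \<open>Both objectives can be read off from the number of jobs unfinished at each time: the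
  makespan is the first time at which none is left, and the sum of completion times is the sum of
  these numbers. Comparing counts instead of individual jobs matters because the greedy insertion
  may order the non-successors differently from an optimal schedule.\<close>

lemma obj_value_mono_counts:
  assumes "wf_inst I" and "\<And>t. card {j \<in> jobs I. C' j \<le> t} \<le> card {j \<in> jobs I. C j \<le> t}"
  shows "obj_value \<gamma> I C \<le> obj_value \<gamma> I C'"
proof -
  have ne: "jobs I \<noteq> {}" using assms(1) by (auto simp: jobs_def wf_inst_def)
  have less: "card {j \<in> jobs I. t < C j} \<le> card {j \<in> jobs I. t < C' j}" for t
  proof -
    have "card {j \<in> jobs I. t < D j} = njobs I - card {j \<in> jobs I. D j \<le> t}" for D
    proof -
      have "{j \<in> jobs I. t < D j} = jobs I - {j \<in> jobs I. D j \<le> t}" by auto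
      then show ?thesis using finite_jobs[of I] card_jobs by (simp add: card_Diff_subset)
    qed
    then show ?thesis using assms(2)[of t] by simp
  qed
  show ?thesis
  proof (cases \<gamma>)
    case Makespan
    let ?M = "Max (C' ` jobs I)"
    have "{j \<in> jobs I. ?M < C' j} = {}" using finite_jobs by (auto simp: not_less)
    then have "card {j \<in> jobs I. ?M < C j} = 0" using less[of ?M] by (metis card.empty le_zero_eq)
    then have "\<forall>j\<in>jobs I. C j \<le> ?M" using finite_jobs[of I] by (auto simp: not_less)
    then show ?thesis using Makespan ne finite_jobs by simp
  next
    case Total_completion
    define N where "N = Max ((C ` jobs I) \<union> (C' ` jobs I))"
    have "C j \<le> N \<and> C' j \<le> N" if "j \<in> jobs I" for j
      unfolding N_def using that finite_jobs by (auto intro!: Max_ge)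
    then have "sum C (jobs I) = (\<Sum>t<N. card {j \<in> jobs I. t < C j})"
      "sum C' (jobs I) = (\<Sum>t<N. card {j \<in> jobs I. t < C' j})"
      using finite_jobs by (simp_all add: sum_eq_sum_card_greater)
    then show ?thesis using Total_completion less by (simp add: sum_mono)
  qed
qed

lemma obj_value_mono:
  assumes "wf_inst I" "\<And>j. j \<in> jobs I \<Longrightarrow> C j \<le> C' j"
  shows "obj_value \<gamma> I C \<le> obj_value \<gamma> I C'"
  using assms(1)
proof (rule obj_value_mono_counts)
  fix t
  show "card {j \<in> jobs I. C' j \<le> t} \<le> card {j \<in> jobs I. C j \<le> t}"
    using assms(2) finite_jobs by (intro card_mono) (auto intro: le_trans)
qed

text \<open>Job \<open>1\<close> exists and occupies some slot, which a schedule on zero machines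
  would have to leave empty.\<close>

lemma feasible_imp_machines: "wf_inst I \<Longrightarrow> schedule I C \<Longrightarrow> 1 \<le> machines I"
proof (rule ccontr)
  assume I: "wf_inst I" "schedule I C" and "\<not> 1 \<le> machines I"
  then have "machines I = 0" by simp
  then have "card {j \<in> jobs I. C j = C 1} = 0"
    using I(2) unfolding schedule_def by (metis le_zero_eq)
  then have "1 \<notin> jobs I" using finite_jobs[of I] by auto
  then show False using I(1) by (simp add: jobs_def wf_inst_def)
qed

section \<open>Inserting the non-successors\<close>

text \<open>The last conjunct is what makes the insertion greedy: loads only grow, so the slots that were
  full when a job was placed behind them remain full.\<close>

definition partial_sched :: "inst \<Rightarrow> (nat \<rightharpoonup> nat) \<Rightarrow> (nat \<rightharpoonup> nat) \<Rightarrow> (nat \<Rightarrow> nat) \<Rightarrow> bool" where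
  "partial_sched I C D load \<longleftrightarrow>
     C \<subseteq>\<^sub>m D \<and> dom D \<subseteq> jobs I \<and> ran D \<subseteq> {1..njobs I} \<and>
     (\<forall>t. load t = card {j \<in> dom D. the (D j) = t}) \<and> (\<forall>t. load t \<le> machines I) \<and>
     (\<forall>i \<in> dom D - dom C. \<forall>t\<in>{1..<the (D i)}. load t = machines I)"

lemma partial_schedD:
  assumes "partial_sched I C D load"
  shows "C \<subseteq>\<^sub>m D" "dom C \<subseteq> dom D" "dom D \<subseteq> jobs I" "j \<in> dom D \<Longrightarrow> the (D j) \<in> {1..njobs I}"
    "load t = card {j \<in> dom D. the (D j) = t}" "load t \<le> machines I"
    "i \<in> dom D - dom C \<Longrightarrow> 1 \<le> t \<Longrightarrow> t < the (D i) \<Longrightarrow> load t = machines I"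
proof -
  show CD: "C \<subseteq>\<^sub>m D" using assms by (simp add: partial_sched_def)
  then show "dom C \<subseteq> dom D" by (rule map_le_implies_dom_le)
  show "dom D \<subseteq> jobs I" "load t = card {j \<in> dom D. the (D j) = t}" "load t \<le> machines I"
    using assms unfolding partial_sched_def by fast+
  show "load t = machines I" if "i \<in> dom D - dom C" "1 \<le> t" "t < the (D i)"
    using assms that unfolding partial_sched_def by (meson atLeastLessThan_iff)
  have "ran D \<subseteq> {1..njobs I}" using assms by (simp add: partial_sched_def)
  then show "the (D j) \<in> {1..njobs I}" if "j \<in> dom D" using that by (force simp: ran_def)
qed

lemma outs_place:
  "outs (place I i (Some (D, load))) =
    {if i \<in> dom D then Some (D, load) else
     (case find (\<lambda>t. load t < machines I) (upto_n I) of None \<Rightarrow> None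
      | Some t \<Rightarrow> Some (D(i \<mapsto> t), load(t := load t + 1)))}"
  by (auto simp: place_def outs_simps outs_first_free dom_def split: option.splits simp del: upt_Suc)

lemma outs_place_None: "outs (place I i None) = {None}"
  by (simp add: place_def outs_simps)

lemma partial_sched_card_less:
  assumes "partial_sched I C D load"
  shows "card {j \<in> dom D. the (D j) < t} = (\<Sum>s\<in>{1..<t}. load s)"
proof -
  have "1 \<le> the (D j)" if "j \<in> dom D" for j
    using partial_schedD(4)[OF assms] that by simp
  then show ?thesis
    using partial_schedD(3,5)[OF assms] finite_subset[OF _ finite_jobs, of "dom D" I]
    by (simp add: card_slots_less)
qed

text \<open>Failure is recorded as fullness of all \<open>njobs I\<close> slots, since this is what
  the later counting arguments refute. For a newly placed job the full slots are stated for the old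
  \<open>load\<close>, so that these arguments can count the jobs present before the
  placement.\<close>

lemma partial_sched_place:
  assumes D: "partial_sched I C D load" and i: "i \<in> jobs I"
    and st: "st' \<in> outs (place I i (Some (D, load)))"
  shows "(\<exists>D' load'. st' = Some (D', load') \<and> partial_sched I C D' load' \<and> D \<subseteq>\<^sub>m D' \<and>
            dom D' = insert i (dom D) \<and>
            (i \<notin> dom D \<longrightarrow> (\<forall>t\<in>{1..<the (D' i)}. load t = machines I)))
      \<or> (st' = None \<and> i \<notin> dom D \<and> (\<forall>t\<in>{1..njobs I}. load t = machines I))"
proof (cases "i \<in> dom D")
  case True
  then show ?thesis using D st by (auto simp: outs_place)
next
  case False
  show ?thesis
  proof (cases "find (\<lambda>t. load t < machines I) (upto_n I)")
    case None
    then have "\<forall>t\<in>{1..njobs I}. \<not> load t < machines I"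
      by (auto simp: find_None_iff simp del: upt_Suc)
    then have "\<forall>t\<in>{1..njobs I}. load t = machines I"
      using partial_schedD(6)[OF D] le_neq_implies_less by blast
    then show ?thesis using None False st by (simp add: outs_place del: upt_Suc)
  next
    case (Some t)
    then obtain k where k: "k < length (upto_n I)" "t = upto_n I ! k" "load t < machines I"
      "\<And>l. l < k \<Longrightarrow> \<not> load (upto_n I ! l) < machines I"
      unfolding find_Some_iff by auto
    have t: "t = Suc k" "k < njobs I" using k(1,2) by (simp_all del: upt_Suc)
    have full: "load s = machines I" if "s \<in> {1..<t}" for s
    proof -
      have "\<not> load (upto_n I ! (s - 1)) < machines I" using that t by (intro k(4)) auto
      moreover have "upto_n I ! (s - 1) = s" using that t by (simp del: upt_Suc)
      moreover have "load s \<le> machines I" by (rule partial_schedD(6)[OF D])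
      ultimately show ?thesis by simp
    qed
    let ?D = "D(i \<mapsto> t)" let ?load = "load(t := load t + 1)"
    have fin: "finite (dom D)" using finite_subset[OF partial_schedD(3)[OF D] finite_jobs] .
    have "?load s = card {j \<in> dom ?D. the (?D j) = s}" for s
    proof -
      have "{j \<in> dom ?D. the (?D j) = s} = (if s = t then {i} else {}) \<union> {j \<in> dom D. the (D j) = s}"
        using False by auto
      then show ?thesis using D fin False by (auto simp: partial_sched_def)
    qed
    moreover have "?load s \<le> machines I" for s
      using D k(3) by (auto simp: partial_sched_def)
    moreover have "?load s = machines I" if "j \<in> dom ?D - dom C" "s \<in> {1..<the (?D j)}" for j s
    proof (cases "s = t")
      \<comment> \<open>This case is contradictory: an earlier inserted job beyond slot
        \<open>t\<close> would mean that \<open>t\<close> was already full, but \<open>t\<close> was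
        free.\<close>
      case True
      then have "j \<in> dom D - dom C" "1 \<le> s" "s < the (D j)" using that by (auto split: if_splits)
      then have "load s = machines I" by (rule partial_schedD(7)[OF D])
      then show ?thesis using True k(3) by simp
    next
      case s: False
      show ?thesis
      proof (cases "j = i")
        case True
        then show ?thesis using that full s by simp
      next
        case False
        then have "j \<in> dom D - dom C" "1 \<le> s" "s < the (D j)" using that by auto
        then have "load s = machines I" by (rule partial_schedD(7)[OF D])
        then show ?thesis using s by simp
      qed
    qed
    moreover have "C \<subseteq>\<^sub>m ?D" "D \<subseteq>\<^sub>m ?D"
      using D False by (auto simp: partial_sched_def map_le_def dom_def)
    moreover have "ran ?D \<subseteq> {1..njobs I}"
      using D False t by (auto simp: partial_sched_def ran_def)
    moreover have "dom ?D \<subseteq> jobs I" using D i by (auto simp: partial_sched_def)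
    ultimately have "partial_sched I C ?D ?load" by (auto simp: partial_sched_def)
    moreover have "st' = Some (?D, ?load)"
      using st Some False by (simp add: outs_place del: upt_Suc)
    ultimately show ?thesis using \<open>D \<subseteq>\<^sub>m ?D\<close> full by auto
  qed
qed

lemma outs_place_before:
  "outs (place_before I j i st) = (\<lambda>st'. case st' of None \<Rightarrow> None
     | Some (D, load) \<Rightarrow> if the (D i) < the (D j) then st' else None) ` outs (place I i st)"
  by (auto simp: place_before_def outs_simps)

lemma map_le_the: "C \<subseteq>\<^sub>m D \<Longrightarrow> j \<in> dom C \<Longrightarrow> the (D j) = the (C j)"
  by (simp add: map_le_def)

definition placed_preds :: "inst \<Rightarrow> nat set \<Rightarrow> (nat \<rightharpoonup> nat) \<Rightarrow> bool" where
  "placed_preds I A D \<longleftrightarrow> (\<forall>j\<in>A. \<forall>i\<in>vars (psi I j). i \<in> dom D \<and> the (D i) < the (D j))"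

lemma placed_preds_mono:
  assumes "placed_preds I A D" "D \<subseteq>\<^sub>m D'" "A \<subseteq> dom D"
  shows "placed_preds I A D'"
  using assms unfolding placed_preds_def
  by (metis map_le_implies_dom_le map_le_the subset_eq)

text \<open>Placed jobs never move, so an inequality tested by \<open>place_before\<close> survives
  all later extensions of the map. The outer invariant covers the finished successors, the inner one
  also the predecessors of the current successor scanned so far.\<close>

lemma insert_preds_sound:
  assumes D: "partial_sched I C D load" and js: "set js = dom C" "dom C \<subseteq> jobs I"
    and vars: "\<And>j. j \<in> dom C \<Longrightarrow> vars (psi I j) \<subseteq> jobs I"
    and order: "set order = set js"
    and st: "st \<in> outs (loop (\<lambda>j. loop (\<lambda>i st. if i \<in> vars (psi I j) then place_before I j i st else ret st)
                    (upto_n I)) order (Some (D, load)))"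
  shows "st = None \<or> (\<exists>D' load'. st = Some (D', load') \<and> partial_sched I C D' load' \<and> placed_preds I (dom C) D')"
proof -
  define Inv where "Inv A st \<longleftrightarrow> st = None \<or> (\<exists>D' load'. st = Some (D', load') \<and>
      partial_sched I C D' load' \<and> placed_preds I A D')" for A and st :: state
  have "Inv (set order) st"
  proof (rule loop_prefix_induct[OF st, where Inv = "\<lambda>ys. Inv (set ys)"])
    show "Inv (set []) (Some (D, load))" using D by (simp add: Inv_def placed_preds_def)
    fix ys j zs st st'
    assume split: "order = ys @ j # zs" and ys: "Inv (set ys) st"
      and st': "st' \<in> outs (loop (\<lambda>i st. if i \<in> vars (psi I j) then place_before I j i st else ret st)
                    (upto_n I) st)"
    have jC: "j \<in> dom C" "set ys \<subseteq> dom C" using split order js by auto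
    define Inv' where "Inv' B st \<longleftrightarrow> st = None \<or> (\<exists>D' load'. st = Some (D', load') \<and>
      partial_sched I C D' load' \<and> placed_preds I (set ys) D' \<and>
      (\<forall>i\<in>B \<inter> vars (psi I j). i \<in> dom D' \<and> the (D' i) < the (D' j)))" for B and st :: state
    have "Inv' (set (upto_n I)) st'"
    proof (rule loop_prefix_induct[OF st', where Inv = "\<lambda>us. Inv' (set us)"])
      show "Inv' (set []) st" using ys by (simp add: Inv_def Inv'_def)
      fix us i vs st st'
      assume split': "upto_n I = us @ i # vs" and us: "Inv' (set us) st"
        and st': "st' \<in> outs (if i \<in> vars (psi I j) then place_before I j i st else ret st)"
      show "Inv' (set (us @ [i])) st'"
      proof (cases "i \<in> vars (psi I j) \<and> st' \<noteq> None")
        case False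
        then show ?thesis using us st' by (auto simp: Inv'_def outs_ret outs_place_before outs_place_None split: if_splits)
      next
        case True
        then obtain st1 where st1: "st1 \<in> outs (place I i st)"
          "st' = (case st1 of None \<Rightarrow> None | Some (D, load) \<Rightarrow> if the (D i) < the (D j) then st1 else None)"
          using st' by (auto simp: outs_place_before)
        then obtain D2 load2 where D2: "st1 = Some (D2, load2)" "the (D2 i) < the (D2 j)" "st' = st1"
          using True by (auto split: option.splits if_splits)
        have "st \<noteq> None" using st1(1) D2(1) by (cases st) (auto simp: outs_place_None)
        then obtain D1 load1 where D1: "st = Some (D1, load1)" "partial_sched I C D1 load1"
          "placed_preds I (set ys) D1"
          "\<forall>i\<in>set us \<inter> vars (psi I j). i \<in> dom D1 \<and> the (D1 i) < the (D1 j)"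
          using us by (auto simp: Inv'_def)
        have "i \<in> jobs I" using split' True vars jC by blast
        from partial_sched_place[OF D1(2) this st1(1)[unfolded D1(1)]] D2(1)
        have 2: "partial_sched I C D2 load2" "D1 \<subseteq>\<^sub>m D2" "dom D2 = insert i (dom D1)" by auto
        have domC: "dom C \<subseteq> dom D1"
          by (rule partial_schedD(2)[OF D1(2)])
        have "placed_preds I (set ys) D2" using D1(3) 2(2) subset_trans[OF jC(2) domC] by (rule placed_preds_mono)
        moreover have "i' \<in> dom D2 \<and> the (D2 i') < the (D2 j)"
          if "i' \<in> set us \<inter> vars (psi I j)" for i'
        proof -
          have "i' \<in> dom D1" "j \<in> dom D1" "the (D1 i') < the (D1 j)" using D1(4) that jC(1) domC by auto
          then show ?thesis using 2(3) map_le_the[OF 2(2)] by simp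
        qed
        ultimately show ?thesis using 2 D2 by (auto simp: Inv'_def)
      qed
    qed
    moreover have "vars (psi I j) \<subseteq> set (upto_n I)" using vars[OF jC(1)] by (auto simp: jobs_def)
    ultimately show "Inv (set (ys @ [j])) st'"
      unfolding Inv_def Inv'_def placed_preds_def by (auto simp: Int_absorb1 simp del: upt_Suc)
  qed
  then show ?thesis using order js by (simp add: Inv_def)
qed

text \<open>This phase cannot fail: if all \<open>njobs I\<close> slots were full, with at least one
  machine each, then at least \<open>njobs I\<close> jobs would be placed already, although
  \<open>i\<close> is not among them.\<close>

lemma insert_rest:
  assumes D: "partial_sched I C D load"
    and st: "st \<in> outs (loop (place I) (upto_n I) (Some (D, load)))"
    and m: "1 \<le> machines I"
  shows "\<exists>D' load'. st = Some (D', load') \<and> partial_sched I C D' load' \<and> D \<subseteq>\<^sub>m D' \<and> dom D' = jobs I"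
proof -
  define Inv where "Inv B st \<longleftrightarrow> (\<exists>D' load'. st = Some (D', load') \<and>
      partial_sched I C D' load' \<and> D \<subseteq>\<^sub>m D' \<and> B \<subseteq> dom D')" for B and st :: state
  have "Inv (set (upto_n I)) st"
  proof (rule loop_prefix_induct[OF st, where Inv = "\<lambda>us. Inv (set us)"])
    show "Inv (set []) (Some (D, load))" using D by (simp add: Inv_def)
    fix us i vs st st'
    assume split: "upto_n I = us @ i # vs" and us: "Inv (set us) st" and st': "st' \<in> outs (place I i st)"
    obtain D1 load1 where D1: "st = Some (D1, load1)" "partial_sched I C D1 load1"
      "D \<subseteq>\<^sub>m D1" "set us \<subseteq> dom D1" using us by (auto simp: Inv_def)
    have "i \<in> set (upto_n I)" unfolding split by simp
    then have i: "i \<in> jobs I" by (auto simp: jobs_def)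
    have False if "st' = None" "i \<notin> dom D1" "\<forall>t\<in>{1..njobs I}. load1 t = machines I"
    proof -
      have "njobs I \<le> (\<Sum>t\<in>{1..njobs I}. load1 t)" using that(3) m by simp
      also have "\<dots> = card {j \<in> dom D1. the (D1 j) < Suc (njobs I)}"
        unfolding partial_sched_card_less[OF D1(2)] by (simp add: atLeastLessThanSuc_atLeastAtMost)
      also have "\<dots> \<le> card (jobs I - {i})"
        using that(2) partial_schedD(3)[OF D1(2)] finite_jobs by (intro card_mono) auto
      also have "\<dots> < card (jobs I)" using i finite_jobs by (intro card_Diff1_less)
      finally show False by (simp add: card_jobs)
    qed
    with partial_sched_place[OF D1(2) i st'[unfolded D1(1)]]
    obtain D2 load2 where "st' = Some (D2, load2)" "partial_sched I C D2 load2" "D1 \<subseteq>\<^sub>m D2"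
      "dom D2 = insert i (dom D1)" by blast
    then show "Inv (set (us @ [i])) st'"
      using D1 by (auto simp: Inv_def intro: map_le_trans)
  qed
  moreover have "set (upto_n I) = jobs I" by (auto simp: jobs_def)
  ultimately obtain D' load' where "st = Some (D', load')" "partial_sched I C D' load'" "D \<subseteq>\<^sub>m D'"
    "jobs I \<subseteq> dom D'" by (auto simp: Inv_def)
  then show ?thesis using partial_schedD(3)[of I C D' load'] by blast
qed

lemma insert_rest_None: "outs (loop (place I) us None) = {None}"
  by (induction us) (simp_all add: outs_simps outs_place_None)

text \<open>If no slot before the completion time of \<open>j\<close> is free, the jobs filling these slots and the job
  to be placed are more jobs than any feasible schedule can complete before \<open>j\<close>.\<close>

lemma insert_preds_complete:
  assumes C: "partial_sched I C C load0" and js: "set order = dom C"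
    and vars: "\<And>j. j \<in> dom C \<Longrightarrow> vars (psi I j) \<subseteq> jobs I"
    and sorted: "sorted_wrt (\<lambda>a b. the (C a) \<le> the (C b)) order"
    and C': "schedule I C'" "\<And>j. j \<in> dom C \<Longrightarrow> C' j = the (C j)"
      "\<And>i j. j \<in> dom C \<Longrightarrow> i \<in> vars (psi I j) \<Longrightarrow> C' i < C' j"
    and st: "st \<in> outs (loop (\<lambda>j. loop (\<lambda>i st. if i \<in> vars (psi I j) then place_before I j i st else ret st)
                    (upto_n I)) order (Some (C, load0)))"
  shows "st \<noteq> None"
proof -
  \<comment> \<open>An inserted job is a predecessor of some processed successor, so it precedes
    that successor in \<open>C'\<close> as well as in \<open>D\<close>. This is what makes the jobs
    of \<open>D\<close> before the current deadline a subset of those of \<open>C'\<close>.\<close>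
  define Inv where "Inv A st \<longleftrightarrow> (\<exists>D load. st = Some (D, load) \<and> partial_sched I C D load \<and>
      (\<forall>i\<in>dom D - dom C. \<exists>j\<in>A. the (D i) < the (C j) \<and> C' i < the (C j)))" for A and st :: state
  have "Inv (set order) st"
  proof (rule loop_prefix_induct[OF st, where Inv = "\<lambda>ys. Inv (set ys)"])
    show "Inv (set []) (Some (C, load0))" using C by (simp add: Inv_def)
    fix ys j zs st st'
    assume split: "order = ys @ j # zs" and ys: "Inv (set ys) st"
      and st': "st' \<in> outs (loop (\<lambda>i st. if i \<in> vars (psi I j) then place_before I j i st else ret st)
                    (upto_n I) st)"
    have jC: "j \<in> dom C" using split js by auto
    \<comment> \<open>Here the order of processing is used: earlier deadlines imply the current
      one.\<close>
    have late: "the (C j') \<le> the (C j)" if "j' \<in> insert j (set ys)" for j'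
      using sorted that unfolding split by (auto simp: sorted_wrt_append)
    show "Inv (set (ys @ [j])) st'"
    proof (rule loop_invariant[OF st'])
      show "Inv (set (ys @ [j])) st"
      proof -
        obtain D load where "st = Some (D, load)" "partial_sched I C D load"
          "\<forall>i\<in>dom D - dom C. \<exists>j\<in>set ys. the (D i) < the (C j) \<and> C' i < the (C j)"
          using ys by (auto simp: Inv_def)
        then show ?thesis unfolding Inv_def by (intro exI[of _ D] exI[of _ load]) auto
      qed
      fix i st st'
      assume i0: "i \<in> set (upto_n I)" and inv: "Inv (set (ys @ [j])) st"
        and st': "st' \<in> outs (if i \<in> vars (psi I j) then place_before I j i st else ret st)"
      show "Inv (set (ys @ [j])) st'"
      proof (cases "i \<in> vars (psi I j)")
        case False
        then show ?thesis using inv st' by (simp add: outs_ret)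
      next
        case True
        obtain D load where D: "st = Some (D, load)" "partial_sched I C D load"
          and inv': "\<forall>i\<in>dom D - dom C. \<exists>j\<in>set (ys @ [j]). the (D i) < the (C j) \<and> C' i < the (C j)"
          using inv by (auto simp: Inv_def)
        have i: "i \<in> jobs I" using i0 by (auto simp: jobs_def)
        have CD: "C \<subseteq>\<^sub>m D" by (rule partial_schedD(1)[OF D(2)])
        have nonsucc: "the (D x) < the (C j) \<and> C' x < the (C j)" if x: "x \<in> dom D - dom C" for x
        proof -
          obtain j' where "j' \<in> insert j (set ys)" "the (D x) < the (C j')" "C' x < the (C j')"
            using inv'[rule_format, OF x] by auto
          then show ?thesis using late[of j'] by auto
        qed
        have ij: "C' i < the (C j)" using C' True jC by metis
        obtain st1 where st1: "st1 \<in> outs (place I i st)"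
          "st' = (case st1 of None \<Rightarrow> None | Some (D, load) \<Rightarrow> if the (D i) < the (D j) then st1 else None)"
          using st' True by (auto simp: outs_place_before)
        show ?thesis
        proof (cases "i \<in> dom D")
          case iD: True
          have "the (D i) < the (D j)"
            using nonsucc[of i] iD ij C'(2) map_le_the[OF CD] jC by (cases "i \<in> dom C") auto
          moreover have "st1 = st" using st1(1) iD by (auto simp: D(1) outs_place)
          ultimately show ?thesis using st1(2) D(1) inv by simp
        next
          case iD: False
          have notfull: "\<not> (\<forall>t\<in>{1..<the (C j)}. load t = machines I)"
          proof
            assume "\<forall>t\<in>{1..<the (C j)}. load t = machines I"
            then have "machines I * (the (C j) - 1) = card {x \<in> dom D. the (D x) < the (C j)}"
              unfolding partial_sched_card_less[OF D(2)] by simp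
            also have "\<dots> < card {x \<in> jobs I. C' x < the (C j)}"
            proof (rule psubset_card_mono)
              have "C' x < the (C j)" if "x \<in> dom D" "the (D x) < the (C j)" for x
                using nonsucc[of x] that C'(2)[of x] map_le_the[OF CD, of x] by (cases "x \<in> dom C") auto
              then have "{x \<in> dom D. the (D x) < the (C j)} \<subseteq> {x \<in> jobs I. C' x < the (C j)}"
                using partial_schedD(3)[OF D(2)] by auto
              then show "{x \<in> dom D. the (D x) < the (C j)} \<subset> {x \<in> jobs I. C' x < the (C j)}"
                using i iD ij by auto
            qed (simp add: finite_jobs)
            also have "\<dots> \<le> machines I * (the (C j) - 1)" by (rule schedule_card_less[OF C'(1)])
            finally show False by simp
          qed
          \<comment> \<open>The slots before \<open>j\<close> are among the \<open>njobs I\<close>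
            slots scanned by \<open>place\<close>, so a free one among them is found.\<close>
          have Cj: "the (C j) \<le> njobs I"
            using partial_schedD(4)[OF C jC] by simp
          have "\<not> (\<forall>t\<in>{1..njobs I}. load t = machines I)" using notfull Cj by auto
          with partial_sched_place[OF D(2) i st1(1)[unfolded D(1)]] iD
          obtain D' load' where D': "st1 = Some (D', load')" "partial_sched I C D' load'"
            "D \<subseteq>\<^sub>m D'" "dom D' = insert i (dom D)" "\<forall>t\<in>{1..<the (D' i)}. load t = machines I"
            by blast
          have "\<not> the (C j) \<le> the (D' i)" using D'(5) notfull by auto
          moreover have "the (D' j) = the (C j)"
            by (rule map_le_the[OF partial_schedD(1)[OF D'(2)] jC])
          moreover have "\<exists>j\<in>set (ys @ [j]). the (D' x) < the (C j) \<and> C' x < the (C j)"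
            if "x \<in> dom D' - dom C" for x
          proof (cases "x = i")
            case True
            then show ?thesis using \<open>\<not> the (C j) \<le> the (D' i)\<close> ij by auto
          next
            case False
            then show ?thesis using that inv' D'(4) map_le_the[OF D'(3), of x] by auto
          qed
          ultimately show ?thesis using D' st1(2) by (auto simp: Inv_def)
        qed
      qed
    qed
  qed
  then show ?thesis by (auto simp: Inv_def)
qed

text \<open>If some inserted job finishes after \<open>t\<close>, then all slots up to
  \<open>t\<close> are full and no schedule can finish more jobs by then. Otherwise only jobs of
  \<open>dom C\<close> are unfinished at \<open>t\<close>, and their times are the same in both
  schedules.\<close>

lemma partial_sched_dominates:
  assumes D: "partial_sched I C D load" "dom D = jobs I"
    and C': "schedule I C'" "\<And>j. j \<in> dom C \<Longrightarrow> C' j = the (C j)"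
  shows "card {j \<in> jobs I. C' j \<le> t} \<le> card {j \<in> jobs I. the (D j) \<le> t}"
proof (cases "\<exists>i\<in>dom D - dom C. t < the (D i)")
  case True
  then obtain i where i: "i \<in> dom D - dom C" "t < the (D i)" by blast
  have "card {j \<in> dom D. the (D j) < Suc t} = (\<Sum>s\<in>{1..<Suc t}. load s)"
    by (rule partial_sched_card_less[OF D(1)])
  also have "\<dots> = (\<Sum>s\<in>{1..<Suc t}. machines I)"
    using i partial_schedD(7)[OF D(1) i(1)] by (intro sum.cong) auto
  finally have "card {j \<in> dom D. the (D j) < Suc t} = machines I * (Suc t - 1)" by simp
  then have "card {j \<in> jobs I. the (D j) \<le> t} = machines I * t"
    by (simp add: D(2) less_Suc_eq_le)
  moreover have "card {j \<in> jobs I. C' j \<le> t} \<le> machines I * t"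
    using schedule_card_less[OF C'(1), of "Suc t"] by (simp add: less_Suc_eq_le)
  ultimately show ?thesis by simp
next
  case False
  have CD: "C \<subseteq>\<^sub>m D" by (rule partial_schedD(1)[OF D(1)])
  have le: "the (D j) \<le> t" if "j \<in> jobs I" "C' j \<le> t" for j
  proof (cases "j \<in> dom C")
    case True
    then show ?thesis using C'(2)[OF True] map_le_the[OF CD True] that(2) by simp
  next
    case nC: False
    have "j \<in> dom D" using D(2) that(1) by simp
    then show ?thesis using False nC by (meson DiffI not_less)
  qed
  show ?thesis
    by (rule card_mono) (use le in \<open>auto simp: finite_jobs\<close>)
qed

lemma partial_sched_schedule:
  assumes "partial_sched I C D load" "dom D = jobs I"
  shows "schedule I (\<lambda>j. the (D j))"
  unfolding schedule_def
proof (intro conjI ballI allI)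
  show "1 \<le> the (D j)" if "j \<in> jobs I" for j
    using partial_schedD(4)[OF assms(1)] assms(2) that by simp
  show "card {j \<in> jobs I. the (D j) = t} \<le> machines I" for t
  proof -
    have "load t = card {j \<in> dom D. the (D j) = t}" "load t \<le> machines I"
      by (rule partial_schedD[OF assms(1)])+
    then show ?thesis using assms(2) by simp
  qed
qed

section \<open>The insertion procedure as a whole\<close>

locale insertion =
  fixes I :: inst and js :: "nat list" and C :: "nat \<rightharpoonup> nat"
  assumes js: "distinct js" "set js = dom C" "dom C \<subseteq> jobs I"
    and ran: "ran C \<subseteq> {1..njobs I}"
    and cap: "\<And>t. card {j \<in> dom C. the (C j) = t} \<le> machines I"
    and vars: "\<And>j. j \<in> dom C \<Longrightarrow> vars (psi I j) \<subseteq> jobs I"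
    and machines: "1 \<le> machines I"
begin

lemma outs_insert_jobs:
  assumes "res \<in> outs (insert_jobs I js C)"
  obtains order st st' load where
    "order \<in> outs (sort_prog (\<lambda>j. the (C j)) js)"
    "partial_sched I C C load"
    "st \<in> outs (loop (\<lambda>j. loop (\<lambda>i st. if i \<in> vars (psi I j) then place_before I j i st else ret st)
                    (upto_n I)) order (Some (C, load)))"
    "st' \<in> outs (loop (place I) (upto_n I) st)" "res = map_option fst st'"
proof -
  define load where "load = (\<lambda>t. length (filter (\<lambda>j. the (C j) = t) js))"
  have "load t = card {j \<in> dom C. the (C j) = t}" for t
    unfolding load_def js(2)[symmetric] set_filter[symmetric]
    using js(1) by (intro distinct_card[symmetric] distinct_filter)
  then have "partial_sched I C C load"
    using js ran cap by (simp add: partial_sched_def)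
  moreover obtain order st st' where "order \<in> outs (sort_prog (\<lambda>j. the (C j)) js)"
    "st \<in> outs (loop (\<lambda>j. loop (\<lambda>i st. if i \<in> vars (psi I j) then place_before I j i st else ret st)
                    (upto_n I)) order (Some (C, load)))"
    "st' \<in> outs (loop (place I) (upto_n I) st)" "res = map_option fst st'"
    using assms unfolding insert_jobs_def outs_bind outs_loads outs_ret load_def[symmetric] by blast
  ultimately show thesis using that by blast
qed

lemma set_order: "order \<in> outs (sort_prog (\<lambda>j. the (C j)) js) \<Longrightarrow> set order = dom C"
  using outs_sort(1) js(2) by (metis set_mset_mset)

text \<open>The comparison in the last conclusion is with every schedule that agrees on
  \<open>dom C\<close>: it rests on machine capacities alone. The order of precedence between
  non-successors and successors enters only through \<open>insert_jobs_complete\<close>.\<close>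

lemma insert_jobs_sound:
  assumes "Some D \<in> outs (insert_jobs I js C)"
  shows "dom D = jobs I" "schedule I (\<lambda>j. the (D j))"
    "j \<in> dom C \<Longrightarrow> i \<in> vars (psi I j) \<Longrightarrow> the (D i) < the (D j)"
    "schedule I C' \<Longrightarrow> (\<And>j. j \<in> dom C \<Longrightarrow> C' j = the (C j)) \<Longrightarrow>
      card {j \<in> jobs I. C' j \<le> t} \<le> card {j \<in> jobs I. the (D j) \<le> t}"
proof -
  obtain order st st' load where r:
    "order \<in> outs (sort_prog (\<lambda>j. the (C j)) js)"
    "partial_sched I C C load"
    "st \<in> outs (loop (\<lambda>j. loop (\<lambda>i st. if i \<in> vars (psi I j) then place_before I j i st else ret st)
                    (upto_n I)) order (Some (C, load)))"
    "st' \<in> outs (loop (place I) (upto_n I) st)" "Some D = map_option fst st'"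
    using assms by (rule outs_insert_jobs)
  have "st \<noteq> None"
  proof
    assume "st = None"
    then have "st' = None" using r(4) insert_rest_None by blast
    then show False using r(5) by simp
  qed
  moreover have "set order = set js" using set_order[OF r(1)] js(2) by simp
  ultimately obtain D1 load1 where D1: "st = Some (D1, load1)" "partial_sched I C D1 load1"
    "placed_preds I (dom C) D1"
    using insert_preds_sound[OF r(2) js(2,3) vars _ r(3)] by blast
  from insert_rest[OF D1(2) r(4)[unfolded D1(1)] machines]
  obtain D' load' where D': "st' = Some (D', load')" "partial_sched I C D' load'" "D1 \<subseteq>\<^sub>m D'"
    "dom D' = jobs I" by blast
  have "D' = D" using r(5) D'(1) by simp
  note D = D'(2-4)[unfolded this]
  have preds: "placed_preds I (dom C) D"
    using D1(3) D(2) partial_schedD(2)[OF D1(2)] by (rule placed_preds_mono)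
  show "dom D = jobs I" by (fact D(3))
  show "schedule I (\<lambda>j. the (D j))" by (rule partial_sched_schedule[OF D(1,3)])
  show "the (D i) < the (D j)" if "j \<in> dom C" "i \<in> vars (psi I j)"
    using preds that by (simp add: placed_preds_def)
  show "card {j \<in> jobs I. C' j \<le> t} \<le> card {j \<in> jobs I. the (D j) \<le> t}"
    if "schedule I C'" "\<And>j. j \<in> dom C \<Longrightarrow> C' j = the (C j)"
    by (rule partial_sched_dominates[OF D(1,3) that])
qed

lemma insert_jobs_complete:
  assumes C': "schedule I C'" "\<And>j. j \<in> dom C \<Longrightarrow> C' j = the (C j)"
      "\<And>i j. j \<in> dom C \<Longrightarrow> i \<in> vars (psi I j) \<Longrightarrow> C' i < C' j"
  shows "None \<notin> outs (insert_jobs I js C)"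
proof
  assume "None \<in> outs (insert_jobs I js C)"
  then obtain order st st' load where r:
    "order \<in> outs (sort_prog (\<lambda>j. the (C j)) js)"
    "partial_sched I C C load"
    "st \<in> outs (loop (\<lambda>j. loop (\<lambda>i st. if i \<in> vars (psi I j) then place_before I j i st else ret st)
                    (upto_n I)) order (Some (C, load)))"
    "st' \<in> outs (loop (place I) (upto_n I) st)" "None = map_option fst st'"
    by (rule outs_insert_jobs)
  have "st \<noteq> None"
    by (rule insert_preds_complete[OF r(2) set_order[OF r(1)] vars outs_sort(2)[OF r(1)] C' r(3)])
  moreover have "set order = set js" using set_order[OF r(1)] js(2) by simp
  ultimately obtain D1 load1 where D1: "st = Some (D1, load1)" "partial_sched I C D1 load1"
    using insert_preds_sound[OF r(2) js(2,3) vars _ r(3)] by blast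
  from insert_rest[OF D1(2) r(4)[unfolded D1(1)] machines] have "st' \<noteq> None" by blast
  then show False using r(5) by simp
qed

end

section \<open>Swapping jobs\<close>

lemma bij_betw_transpose_jobs:
  "a \<in> jobs I \<Longrightarrow> b \<in> jobs I \<Longrightarrow> bij_betw (Transposition.transpose a b) (jobs I) (jobs I)"
  by (simp add: bij_betw_def)

text \<open>Jobs have unit length and machines are identical, so exchanging two jobs leaves the load
  of every slot unchanged.\<close>

lemma schedule_swap:
  assumes "schedule I C" "a \<in> jobs I" "b \<in> jobs I"
  shows "schedule I (C \<circ> Transposition.transpose a b)"
proof -
  let ?p = "Transposition.transpose a b"
  have bij: "bij_betw ?p (jobs I) (jobs I)" using assms(2,3) by (rule bij_betw_transpose_jobs)
  have "card {j \<in> jobs I. C (?p j) = t} = card {j \<in> jobs I. C j = t}" for t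
  proof (rule bij_betw_same_card[OF bij_betw_subset[OF bij]])
    show "?p ` {j \<in> jobs I. C (?p j) = t} = {j \<in> jobs I. C j = t}"
      using bij_betw_imp_surj_on[OF bij] by (auto simp: image_iff)
  qed simp
  moreover have "?p j \<in> jobs I" if "j \<in> jobs I" for j using bij that by (rule bij_betwE[rule_format])
  ultimately show ?thesis using assms(1) by (simp add: schedule_def)
qed

lemma obj_value_swap:
  assumes "a \<in> jobs I" "b \<in> jobs I"
  shows "obj_value \<gamma> I (C \<circ> Transposition.transpose a b) = obj_value \<gamma> I C"
proof -
  let ?p = "Transposition.transpose a b"
  have bij: "bij_betw ?p (jobs I) (jobs I)" using assms by (rule bij_betw_transpose_jobs)
  show ?thesis
  proof (cases \<gamma>)
    case Makespan
    have "(C \<circ> ?p) ` jobs I = C ` jobs I"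
      using bij_betw_imp_surj_on[OF bij] by (simp only: image_comp[symmetric])
    then show ?thesis using Makespan by (simp only: obj_value.simps)
  next
    case Total_completion
    then show ?thesis using sum.reindex_bij_betw[OF bij, of C] by simp
  qed
qed

section \<open>Choosing the predecessors\<close>

definition partial_choice :: "inst \<Rightarrow> (nat \<rightharpoonup> nat) \<Rightarrow> bool" where
  "partial_choice I f \<longleftrightarrow> (\<forall>j i. f j = Some i \<longrightarrow> is_Or (psi I j) \<and> i \<in> vars (psi I j))"

definition eligible :: "inst \<Rightarrow> nat list \<Rightarrow> nat set \<Rightarrow> nat \<Rightarrow> bool" where
  "eligible I ks S i \<longleftrightarrow> i \<in> jobs I \<and> psi I i = Always \<and> (\<forall>k\<in>set ks. i \<in> vars (psi I k) \<longleftrightarrow> k \<in> S)"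

definition assign :: "nat set \<Rightarrow> nat \<Rightarrow> (nat \<rightharpoonup> nat) \<Rightarrow> (nat \<rightharpoonup> nat)" where
  "assign S i f = (\<lambda>k. if k \<in> S then Some i else f k)"

text \<open>A name for the loop body of \<open>branch\<close>, so that its outcomes and its cost can
  be analysed apart from the recursion.\<close>

definition branch_body where
  "branch_body I ands leaf j js f T best = do {
         spend (njobs I);
         let S = insert j T;
         cands \<leftarrow> mfilter (\<lambda>i. if psi I i = Always then mall (\<lambda>k. ret (i \<in> vars (psi I k) \<longleftrightarrow> k \<in> S)) ((j # js) @ ands)
                              else ret False) (upto_n I);
         if cands = [] then ret best
         else do {
           i \<leftarrow> pick cands;
           f' \<leftarrow> loop (\<lambda>k f. if k \<in> S then store (njobs I) f k (Some i) else ret f) (j # js) f;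
           branch I ands leaf js f' best}}"

lemma branch_Cons:
  "branch I ands leaf (j # js) f best = tick (
     if f j \<noteq> None then branch I ands leaf js f best
     else do {
       spend (length js);
       Ts \<leftarrow> subsets_prog (njobs I) (js @ ands);
       loop (branch_body I ands leaf j js f) Ts best})"
  by (simp only: branch.simps branch_body_def[abs_def] Let_def)

lemma outs_cands:
  "outs (mfilter (\<lambda>i. if psi I i = Always then mall (\<lambda>k. ret (i \<in> vars (psi I k) \<longleftrightarrow> k \<in> S)) ks
      else ret False) (upto_n I)) =
   {filter (\<lambda>i. psi I i = Always \<and> list_all (\<lambda>k. i \<in> vars (psi I k) \<longleftrightarrow> k \<in> S) ks) (upto_n I)}"
proof (rule outs_mfilter)
  fix i
  have "outs (mall (\<lambda>k. ret (i \<in> vars (psi I k) \<longleftrightarrow> k \<in> S)) ks) = {list_all (\<lambda>k. i \<in> vars (psi I k) \<longleftrightarrow> k \<in> S) ks}"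
    by (intro outs_mall outs_ret)
  then show "outs (if psi I i = Always then mall (\<lambda>k. ret (i \<in> vars (psi I k) \<longleftrightarrow> k \<in> S)) ks else ret False)
     = {psi I i = Always \<and> list_all (\<lambda>k. i \<in> vars (psi I k) \<longleftrightarrow> k \<in> S) ks}"
    by (simp add: outs_ret)
qed

lemma set_cands:
  "set (filter (\<lambda>i. psi I i = Always \<and> list_all (\<lambda>k. i \<in> vars (psi I k) \<longleftrightarrow> k \<in> S) ks) (upto_n I)) =
   {i. eligible I ks S i}"
  by (auto simp: eligible_def jobs_def list_all_iff)

lemma outs_assign:
  "outs (loop (\<lambda>k f. if k \<in> S then store n f k (Some i) else ret f) ks f) = {assign (S \<inter> set ks) i f}"
proof -
  have "outs (loop (\<lambda>k f. if k \<in> S then store n f k (Some i) else ret f) ks f) =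
      {fold (\<lambda>k f. if k \<in> S then f(k \<mapsto> i) else f) ks f}"
    by (rule outs_loop) (simp add: outs_simps)
  moreover have "fold (\<lambda>k f. if k \<in> S then f(k \<mapsto> i) else f) ks f = assign (S \<inter> set ks) i f"
    by (induction ks arbitrary: f) (auto simp: assign_def fun_eq_iff)
  ultimately show ?thesis by simp
qed

lemma outs_branch_body:
  assumes "b \<in> outs (branch_body I ands leaf j js f T best)"
  shows "(Collect (eligible I ((j # js) @ ands) (insert j T)) = {} \<and> b = best) \<or>
    (\<exists>i. eligible I ((j # js) @ ands) (insert j T) i \<and>
      b \<in> outs (branch I ands leaf js (assign (insert j T \<inter> set (j # js)) i f) best))"
proof -
  define cands where "cands = filter (\<lambda>i. psi I i = Always \<and>
    list_all (\<lambda>k. i \<in> vars (psi I k) \<longleftrightarrow> k \<in> insert j T) ((j # js) @ ands)) (upto_n I)"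
  have cands: "set cands = Collect (eligible I ((j # js) @ ands) (insert j T))"
    unfolding cands_def by (rule set_cands)
  have "b \<in> outs (if cands = [] then ret best else
      bind_prog (pick cands) (\<lambda>i.
        bind_prog (loop (\<lambda>k f. if k \<in> insert j T then store (njobs I) f k (Some i) else ret f) (j # js) f)
          (\<lambda>f'. branch I ands leaf js f' best)))"
    using assms unfolding branch_body_def Let_def outs_bind outs_cands outs_spend cands_def[symmetric]
    by (simp del: loop.simps)
  then show ?thesis
  proof (cases "cands = []")
    case True
    then show ?thesis using \<open>b \<in> outs (if _ then _ else _)\<close> cands by (simp add: outs_ret)
  next
    case False
    with \<open>b \<in> outs (if _ then _ else _)\<close> obtain i where "i \<in> set cands"
      "b \<in> outs (branch I ands leaf js (assign (insert j T \<inter> set (j # js)) i f) best)"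
      unfolding if_not_P[OF False] outs_bind outs_pick outs_assign by blast
    then show ?thesis using cands by blast
  qed
qed

lemma partial_choice_assign:
  assumes "partial_choice I f" "eligible I ks S i" "set js \<subseteq> set ks" "\<And>j. j \<in> set js \<Longrightarrow> is_Or (psi I j)"
  shows "partial_choice I (assign (S \<inter> set js) i f)"
  using assms by (auto simp: partial_choice_def eligible_def assign_def split: if_splits)

text \<open>Each job of \<open>A\<close>, later the set of all or-jobs, either has a chosen
  predecessor or is still listed. Hence \<open>f\<close> is defined on all of \<open>A\<close> at a
  leaf, and the hypothesis about \<open>leaf\<close> has to cover complete choices only.\<close>

lemma branch_preserves:
  assumes leaf: "\<And>f best b. partial_choice I f \<Longrightarrow> A \<subseteq> dom f \<Longrightarrow> R best \<Longrightarrow> b \<in> outs (leaf f best) \<Longrightarrow> R b"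
    and "b \<in> outs (branch I ands leaf js f best)" "partial_choice I f" "A \<subseteq> dom f \<union> set js" "R best"
    and "\<And>j. j \<in> set js \<Longrightarrow> is_Or (psi I j)"
  shows "R b"
  using assms(2-)
proof (induction js arbitrary: f best b)
  case Nil
  then show ?case using leaf[of f best b] by (simp add: outs_tick)
next
  case (Cons j js)
  show ?case
  proof (cases "f j = None")
    case False
    then have "b \<in> outs (branch I ands leaf js f best)"
      using Cons.prems(1) by (simp add: branch_Cons outs_tick del: branch.simps)
    moreover have "A \<subseteq> dom f \<union> set js" using Cons.prems(3) False by auto
    ultimately show ?thesis using Cons.IH[of b f best] Cons.prems by simp
  next
    case True
    then obtain Ts where Ts: "Ts \<in> outs (subsets_prog (njobs I) (js @ ands))"
      "b \<in> outs (loop (branch_body I ands leaf j js f) Ts best)"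
      using Cons.prems(1) by (auto simp: branch_Cons outs_simps simp del: branch.simps)
    show ?thesis
    proof (rule loop_invariant[OF Ts(2)])
      show "R best" by (fact Cons.prems)
      fix T best b assume "R best" and b: "b \<in> outs (branch_body I ands leaf j js f T best)"
      from outs_branch_body[OF b] show "R b"
      proof
        assume "\<exists>i. eligible I ((j # js) @ ands) (insert j T) i \<and>
          b \<in> outs (branch I ands leaf js (assign (insert j T \<inter> set (j # js)) i f) best)"
        then obtain i where i: "eligible I ((j # js) @ ands) (insert j T) i"
          "b \<in> outs (branch I ands leaf js (assign (insert j T \<inter> set (j # js)) i f) best)" by blast
        have "partial_choice I (assign (insert j T \<inter> set (j # js)) i f)"
          by (rule partial_choice_assign[OF Cons.prems(2) i(1)]) (use Cons.prems(5) in auto)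
        moreover have "A \<subseteq> dom (assign (insert j T \<inter> set (j # js)) i f) \<union> set js"
          using Cons.prems(3) by (auto simp: assign_def split: if_splits)
        ultimately show "R b" using Cons.IH[OF i(2)] \<open>R best\<close> Cons.prems(5) by simp
      qed (use \<open>R best\<close> in simp)
    qed
  qed
qed

section \<open>Guiding schedules in the search tree\<close>

text \<open>A schedule of objective value \<open>v\<close> that respects the configuration \<open>C\<close> and the predecessors chosen
  so far. The last conjunct says that a chosen non-successor has been assigned to all later or-jobs it
  precedes, so it cannot be needed for a further or-job.\<close>

definition witness ::
  "objective \<Rightarrow> inst \<Rightarrow> (nat \<rightharpoonup> nat) \<Rightarrow> nat \<Rightarrow> (nat \<rightharpoonup> nat) \<Rightarrow> nat list \<Rightarrow> (nat \<Rightarrow> nat) \<Rightarrow> bool" where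
  "witness \<gamma> I C v f js W \<longleftrightarrow>
     schedule I W \<and> obj_value \<gamma> I W = v \<and> (\<forall>j\<in>succs I. W j = the (C j)) \<and>
     (\<forall>j\<in>succs I. is_And (psi I j) \<longrightarrow> (\<forall>i\<in>vars (psi I j). W i < W j)) \<and>
     (\<forall>j i. f j = Some i \<longrightarrow> W i < W j) \<and>
     (\<forall>j\<in>set js. f j = None \<longrightarrow> (\<exists>i\<in>vars (psi I j). psi I i = Always \<and> W i < W j)) \<and>
     (\<forall>j i. f j = Some i \<and> psi I i = Always \<longrightarrow> (\<forall>k\<in>set js. i \<in> vars (psi I k) \<longrightarrow> f k \<noteq> None))"

text \<open>The swap is made only if \<open>i\<close> does not precede \<open>j\<close> already.
  Then \<open>i\<close> moves forward and \<open>p\<close> is the only job that moves back, so only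
  constraints relying on \<open>p\<close> are at risk. And-jobs that contain \<open>p\<close>
  contain \<open>i\<close> too, no earlier choice is \<open>p\<close>, and a listed or-job that
  stays unassigned lies outside \<open>S\<close> and does not contain \<open>p\<close>. The subset
  \<open>T\<close> leaves out \<open>j\<close> because \<open>branch\<close> adds it to every
  subset.\<close>

lemma witness_step:
  assumes wf: "wf_inst I" and W: "witness \<gamma> I C v f (j # js) W" and f: "partial_choice I f" "f j = None"
    and js: "\<And>k. k \<in> set (j # js) \<Longrightarrow> k \<in> succs I \<and> is_Or (psi I k)"
    and ands: "set ands = {k \<in> succs I. is_And (psi I k)}"
    and sorted: "\<And>k. k \<in> set js \<Longrightarrow> the (C j) \<le> the (C k)"
  obtains T where "T \<subseteq> set (js @ ands)" "\<exists>i. eligible I ((j # js) @ ands) (insert j T) i"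
    "\<And>i. eligible I ((j # js) @ ands) (insert j T) i \<Longrightarrow>
        \<exists>W'. witness \<gamma> I C v (assign (insert j T \<inter> set (j # js)) i f) js W'"
proof -
  have sched: "schedule I W" and obj: "obj_value \<gamma> I W = v" and WC: "\<And>k. k \<in> succs I \<Longrightarrow> W k = the (C k)"
    and Wand: "\<And>k i. k \<in> succs I \<Longrightarrow> is_And (psi I k) \<Longrightarrow> i \<in> vars (psi I k) \<Longrightarrow> W i < W k"
    and Wf: "\<And>k i. f k = Some i \<Longrightarrow> W i < W k"
    and Wor: "\<And>k. k \<in> set (j # js) \<Longrightarrow> f k = None \<Longrightarrow> \<exists>i\<in>vars (psi I k). psi I i = Always \<and> W i < W k"
    and closed: "\<And>k i l. f k = Some i \<Longrightarrow> psi I i = Always \<Longrightarrow> l \<in> set (j # js) \<Longrightarrow> i \<in> vars (psi I l) \<Longrightarrow> f l \<noteq> None"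
    using W unfolding witness_def by blast+
  obtain p where p: "p \<in> vars (psi I j)" "psi I p = Always" "W p < W j"
    using Wor[of j] f(2) by auto
  have jI: "j \<in> jobs I" using js[of j] by (simp add: succs_def)
  then have pI: "p \<in> jobs I" using wf p(1) by (auto simp: wf_inst_def)
  have p_new: "f k \<noteq> Some p" for k using closed[of k p j] p f(2) by auto
  define S where "S = {k \<in> set ((j # js) @ ands). p \<in> vars (psi I k)}"
  have jS: "j \<in> S" using p by (simp add: S_def)
  show thesis
  proof (rule that[of "S - {j}"])
    show "S - {j} \<subseteq> set (js @ ands)" by (auto simp: S_def)
    have S: "insert j (S - {j}) = S" using jS by auto
    show "\<exists>i. eligible I ((j # js) @ ands) (insert j (S - {j})) i"
      unfolding S using p pI by (auto simp: eligible_def S_def)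
    fix i assume "eligible I ((j # js) @ ands) (insert j (S - {j})) i"
    then have i: "i \<in> jobs I" "psi I i = Always"
      and twin: "\<And>k. k \<in> set ((j # js) @ ands) \<Longrightarrow> i \<in> vars (psi I k) \<longleftrightarrow> p \<in> vars (psi I k)"
      unfolding S by (auto simp: eligible_def S_def)
    define W' where "W' = (if W i < W j then W else W \<circ> Transposition.transpose i p)"
    define g where "g = assign (S \<inter> set (j # js)) i f"
    have succ: "W' k = W k" if "psi I k \<noteq> Always" for k
      using that i p by (auto simp: W'_def Transposition.transpose_def)
    have early: "W' i < W j" using p(3) by (auto simp: W'_def)
    have other: "W' l \<le> W l" if "l \<noteq> p" for l
      using that p(3) by (auto simp: W'_def Transposition.transpose_def)
    have "schedule I W'" "obj_value \<gamma> I W' = v"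
      using sched obj i pI by (auto simp: W'_def schedule_swap obj_value_swap simp del: obj_value.simps)
    moreover have "W' k = the (C k)" if "k \<in> succs I" for k
      using WC[OF that] succ that by (simp add: succs_def)
    moreover have "W' l < W' k" if k: "k \<in> succs I" "is_And (psi I k)" and l: "l \<in> vars (psi I k)" for k l
    proof -
      have "W' k = W k" using succ k by (simp add: succs_def)
      moreover have "W' l < W k"
      proof (cases "l = p")
        case True
        then have "W i < W k" "W p < W k" using twin[of k] k l ands Wand by auto
        then show ?thesis using True by (simp add: W'_def)
      next
        case False
        then show ?thesis using other[of l] Wand[OF k l] by simp
      qed
      ultimately show ?thesis by simp
    qed
    moreover have "W' l < W' k" if g: "g k = Some l" for k l
    proof (cases "k \<in> S \<inter> set (j # js)")
      case True
      \<comment> \<open>The or-jobs are sorted by completion time, so the single inequality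
        \<open>W' i < W j\<close> serves all jobs of \<open>S\<close> that receive
        \<open>i\<close>.\<close>
      then have k: "l = i" "W' k = W k" "W j \<le> W k"
        using g js[of k] succ[of k] sorted WC[of j] WC[of k] js[of j] by (auto simp: g_def assign_def succs_def)
      then show ?thesis using early by simp
    next
      case False
      have fk: "f k = Some l" using g unfolding g_def assign_def if_not_P[OF False] .
      then have "W' k = W k" using f(1) succ[of k] by (force simp: partial_choice_def)
      moreover have "W' l \<le> W l" using other p_new fk by metis
      ultimately show ?thesis using Wf[OF fk] by simp
    qed
    moreover have "\<exists>l\<in>vars (psi I k). psi I l = Always \<and> W' l < W' k" if k: "k \<in> set js" "g k = None" for k
    proof -
      have nS: "k \<notin> S" and fk: "f k = None" using k by (auto simp: g_def assign_def split: if_splits)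
      then have "p \<notin> vars (psi I k)" using k(1) by (auto simp: S_def)
      moreover obtain l where "l \<in> vars (psi I k)" "psi I l = Always" "W l < W k"
        using Wor[of k] k fk by auto
      moreover have "W' k = W k" using js[of k] k succ by (auto simp: succs_def)
      ultimately show ?thesis using other[of l] by (metis le_less_trans)
    qed
    moreover have "g l \<noteq> None"
      if "g k = Some r" "psi I r = Always" "l \<in> set js" "r \<in> vars (psi I l)" for k r l
    proof (cases "l \<in> S")
      case True
      then show ?thesis using that(3) by (simp add: g_def assign_def)
    next
      case False
      then have "i \<notin> vars (psi I l)" using twin[of l] that(3) by (auto simp: S_def)
      then have "r \<noteq> i" using that(4) by blast
      then have "f k = Some r" using that(1) by (simp add: g_def assign_def split: if_split_asm)
      then have "f l \<noteq> None" using closed that by auto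
      then show ?thesis by (simp add: g_def assign_def)
    qed
    ultimately have "witness \<gamma> I C v g js W'" unfolding witness_def by blast
    then show "\<exists>W'. witness \<gamma> I C v (assign (insert j (S - {j}) \<inter> set (j # js)) i f) js W'"
      unfolding S g_def by blast
  qed
qed

text \<open>The subset supplied by \<open>witness_step\<close> is among those tried. The guiding
  schedule for the recursive call depends on the job picked for it, so the induction is over all
  \<open>W\<close>. Subtrees of other subsets keep \<open>P\<close> and \<open>Q\<close> by
  \<open>branch_preserves\<close>.\<close>

lemma branch_reaches:
  assumes wf: "wf_inst I" and ands: "set ands = {k \<in> succs I. is_And (psi I k)}"
    and leaf: "\<And>f best b. partial_choice I f \<Longrightarrow> A \<subseteq> dom f \<Longrightarrow> P best \<Longrightarrow> b \<in> outs (leaf f best) \<Longrightarrow> P b"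
      "\<And>f best b. partial_choice I f \<Longrightarrow> A \<subseteq> dom f \<Longrightarrow> Q best \<Longrightarrow> b \<in> outs (leaf f best) \<Longrightarrow> Q b"
      "\<And>f W best b. partial_choice I f \<Longrightarrow> A \<subseteq> dom f \<Longrightarrow> P best \<Longrightarrow> witness \<gamma> I C v f [] W \<Longrightarrow>
        b \<in> outs (leaf f best) \<Longrightarrow> Q b"
    and "b \<in> outs (branch I ands leaf js f best)" "partial_choice I f" "A \<subseteq> dom f \<union> set js" "P best"
    and "\<And>k. k \<in> set js \<Longrightarrow> k \<in> succs I \<and> is_Or (psi I k)"
    and "sorted_wrt (\<lambda>a b. the (C a) \<le> the (C b)) js" "witness \<gamma> I C v f js W"
  shows "Q b"
  using assms(6-)
proof (induction js arbitrary: f best b W)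
  case Nil
  then show ?case using leaf(3)[of f best W b] by (simp add: outs_tick)
next
  case (Cons j js)
  show ?case
  proof (cases "f j = None")
    case False
    then have "b \<in> outs (branch I ands leaf js f best)"
      using Cons.prems(1) by (simp add: branch_Cons outs_tick del: branch.simps)
    moreover have "A \<subseteq> dom f \<union> set js" using Cons.prems(3) False by auto
    moreover have "witness \<gamma> I C v f js W" using Cons.prems(7) by (auto simp: witness_def)
    ultimately show ?thesis using Cons.IH[of b f best W] Cons.prems by simp
  next
    case True
    then obtain Ts where Ts: "Ts \<in> outs (subsets_prog (njobs I) (js @ ands))"
      "b \<in> outs (loop (branch_body I ands leaf j js f) Ts best)"
      using Cons.prems(1) by (auto simp: branch_Cons outs_simps simp del: branch.simps)
    obtain T where T: "T \<subseteq> set (js @ ands)" "\<exists>i. eligible I ((j # js) @ ands) (insert j T) i"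
      "\<And>i. eligible I ((j # js) @ ands) (insert j T) i \<Longrightarrow>
          \<exists>W'. witness \<gamma> I C v (assign (insert j T \<inter> set (j # js)) i f) js W'"
      using witness_step[OF wf Cons.prems(7,2) True Cons.prems(5) ands] Cons.prems(6) by auto
    have sub: "partial_choice I (assign (insert j T \<inter> set (j # js)) i f)"
      "A \<subseteq> dom (assign (insert j T \<inter> set (j # js)) i f) \<union> set js"
      if "eligible I ((j # js) @ ands) (insert j T) i" for i T
    proof -
      show "partial_choice I (assign (insert j T \<inter> set (j # js)) i f)"
        by (rule partial_choice_assign[OF Cons.prems(2) that]) (use Cons.prems(5) in auto)
      show "A \<subseteq> dom (assign (insert j T \<inter> set (j # js)) i f) \<union> set js"
        using Cons.prems(3) by (auto simp: assign_def split: if_splits)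
    qed
    have or: "is_Or (psi I k)" if "k \<in> set js" for k using Cons.prems(5) that by simp
    \<comment> \<open>Any subset, suitable or not, preserves what all leaves preserve. This is
      needed for both \<open>P\<close> and \<open>Q\<close>.\<close>
    have keep: "R b" if R: "R best" and b: "b \<in> outs (branch_body I ands leaf j js f T best)"
      and leafR: "\<And>f best b. partial_choice I f \<Longrightarrow> A \<subseteq> dom f \<Longrightarrow> R best \<Longrightarrow> b \<in> outs (leaf f best) \<Longrightarrow> R b"
      for R T best b
      using outs_branch_body[OF b]
    proof
      assume "\<exists>i. eligible I ((j # js) @ ands) (insert j T) i \<and>
          b \<in> outs (branch I ands leaf js (assign (insert j T \<inter> set (j # js)) i f) best)"
      then obtain i where i: "eligible I ((j # js) @ ands) (insert j T) i"
          "b \<in> outs (branch I ands leaf js (assign (insert j T \<inter> set (j # js)) i f) best)" by blast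
      show "R b"
        by (rule branch_preserves[where R = R, OF _ i(2) sub[OF i(1)] R or]) (rule leafR)
    qed (use R in simp)
    have "T \<in> set Ts" using T(1) outs_subsets(1)[OF Ts(1)] by simp
    show ?thesis
    proof (rule loop_reaches[where R = P and T = Q, OF Ts(2) Cons.prems(4) \<open>T \<in> set Ts\<close>])
      fix T' best b assume "P best" "b \<in> outs (branch_body I ands leaf j js f T' best)"
      then show "P b" by (rule keep) (fact leaf(1))
    next
      fix T' best b assume "Q best" "b \<in> outs (branch_body I ands leaf j js f T' best)"
      then show "Q b" by (rule keep) (fact leaf(2))
    next
      fix best b assume P: "P best" and b: "b \<in> outs (branch_body I ands leaf j js f T best)"
      from outs_branch_body[OF b] T(2)
      obtain i where i: "eligible I ((j # js) @ ands) (insert j T) i"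
          "b \<in> outs (branch I ands leaf js (assign (insert j T \<inter> set (j # js)) i f) best)" by blast
      from T(3)[OF i(1)] obtain W' where
        W': "witness \<gamma> I C v (assign (insert j T \<inter> set (j # js)) i f) js W'" by blast
      show "Q b"
        by (rule Cons.IH[OF i(2) sub[OF i(1)] P _ _ W']) (use Cons.prems(5,6) in auto)
    qed
  qed
qed

section \<open>Optimal schedules with contiguous successors\<close>

text \<open>Constraints contain no negated variables, so making more variables true cannot falsify
  them.\<close>

lemma sat_mono: "sat p x \<Longrightarrow> (\<And>i. i \<in> vars p \<Longrightarrow> x i \<Longrightarrow> y i) \<Longrightarrow> sat p y"
  by (cases p) auto

lemma feasible_scheduleI:
  assumes "feasible_schedule I C" "schedule I C'"
    and "\<And>i j. i \<in> jobs I \<Longrightarrow> j \<in> succs I \<Longrightarrow> C i < C j \<Longrightarrow> C' i < C' j" and "wf_inst I"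
  shows "feasible_schedule I C'"
  unfolding feasible_schedule_def
proof (intro conjI ballI)
  fix j assume j: "j \<in> jobs I"
  show "sat (psi I j) (\<lambda>i. C' i < C' j)"
  proof (cases "psi I j = Always")
    case False
    have "sat (psi I j) (\<lambda>i. C i < C j)" using assms(1) j by (simp add: feasible_schedule_def)
    then show ?thesis
      by (rule sat_mono) (use assms(3,4) j False in \<open>auto simp: succs_def wf_inst_def\<close>)
  qed simp
qed (fact assms(2))

text \<open>A lexicographic choice among the optimal schedules. The total completion time is a
  measure that removing an empty slot decreases strictly, whatever the objective is; swapping two
  jobs leaves it unchanged, so the second criterion can then be used for swaps.\<close>

definition compact :: "objective \<Rightarrow> inst \<Rightarrow> (nat \<Rightarrow> nat) \<Rightarrow> bool" where
  "compact \<gamma> I C \<longleftrightarrow> optimal_schedule \<gamma> I C \<and>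
     (\<forall>C'. optimal_schedule \<gamma> I C' \<longrightarrow> sum C (jobs I) < sum C' (jobs I) \<or>
        sum C (jobs I) = sum C' (jobs I) \<and> sum C' (succs I) \<le> sum C (succs I))"

lemma compact_exists:
  assumes "feasible_inst I"
  obtains C where "compact \<gamma> I C"
proof -
  have "\<exists>C. feasible_schedule I C" using assms by (simp add: feasible_inst_def)
  then obtain C0 where C0: "optimal_schedule \<gamma> I C0"
    using ex_has_least_nat[of "feasible_schedule I" _ "obj_value \<gamma> I"]
    by (auto simp: optimal_schedule_def)
  obtain C1 where C1: "optimal_schedule \<gamma> I C1"
    "\<And>C. optimal_schedule \<gamma> I C \<Longrightarrow> sum C1 (jobs I) \<le> sum C (jobs I)"
    using ex_has_least_nat[of "optimal_schedule \<gamma> I" C0 "\<lambda>C. sum C (jobs I)"] C0 by blast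
  let ?P = "\<lambda>C. optimal_schedule \<gamma> I C \<and> sum C (jobs I) = sum C1 (jobs I)"
  \<comment> \<open>The maximum of the second criterion exists because the total completion time is
    now fixed and bounds the part due to the successors.\<close>
  have "sum C (succs I) < Suc (sum C1 (jobs I))" if "?P C" for C
  proof -
    have "sum C (succs I) \<le> sum C (jobs I)"
      by (rule sum_mono2) (auto simp: succs_def finite_jobs)
    then show ?thesis using that by simp
  qed
  then obtain C2 where C2: "?P C2" "\<And>C. ?P C \<Longrightarrow> sum C (succs I) \<le> sum C2 (succs I)"
    using ex_has_greatest_nat[of ?P C1 "\<lambda>C. sum C (succs I)"] C1(1) by blast
  have "compact \<gamma> I C2"
    unfolding compact_def
  proof (intro conjI allI impI)
    fix C assume C: "optimal_schedule \<gamma> I C"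
    then show "sum C2 (jobs I) < sum C (jobs I) \<or>
        sum C2 (jobs I) = sum C (jobs I) \<and> sum C (succs I) \<le> sum C2 (succs I)"
      using C1(2)[OF C] C2(1) C2(2)[of C] by linarith
  qed (use C2 in simp)
  then show thesis by (rule that)
qed

context
  fixes I \<gamma> C
  assumes wf: "wf_inst I" and C: "compact \<gamma> I C"
begin

lemma compact_feasible: "feasible_schedule I C" and compact_schedule: "schedule I C"
  using C by (simp_all add: compact_def optimal_schedule_def feasible_schedule_def)

text \<open>An empty slot could be removed.\<close>

lemma compact_no_empty_slot:
  assumes "j \<in> jobs I" "1 \<le> t" "t \<le> C j"
  shows "\<exists>i\<in>jobs I. C i = t"
proof (rule ccontr)
  assume empty: "\<not> (\<exists>i\<in>jobs I. C i = t)"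
  define C' where "C' = (\<lambda>j. if t < C j then C j - 1 else C j)"
  have slot: "{j \<in> jobs I. C' j = s} = {j \<in> jobs I. C j = (if s < t then s else Suc s)}" if "s \<noteq> 0" for s
    using empty that by (auto simp: C'_def)
  have pos: "1 \<le> C i" if "i \<in> jobs I" for i
    using compact_schedule that by (simp add: schedule_def)
  have pos': "1 \<le> C' i" if "i \<in> jobs I" for i
    using pos[OF that] assms(2) by (auto simp: C'_def)
  have "card {j \<in> jobs I. C' j = s} \<le> machines I" for s
  proof (cases "s = 0")
    case True
    then have "{j \<in> jobs I. C' j = s} = {}" using pos' by fastforce
    then show ?thesis by (metis card.empty le0)
  next
    case False
    then show ?thesis using compact_schedule slot[OF False] by (simp add: schedule_def)
  qed
  then have "schedule I C'" using pos' by (simp add: schedule_def)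
  then have feas: "feasible_schedule I C'"
  proof (rule feasible_scheduleI[OF compact_feasible])
    fix i k assume "i \<in> jobs I" "C i < C k"
    moreover have "C i \<noteq> t" using empty \<open>i \<in> jobs I\<close> by blast
    ultimately show "C' i < C' k" by (auto simp: C'_def)
  qed (fact wf)
  have le: "C' i \<le> C i" for i by (simp add: C'_def)
  have "obj_value \<gamma> I C' \<le> obj_value \<gamma> I C" using wf le by (intro obj_value_mono) auto
  then have "optimal_schedule \<gamma> I C'"
    using C feas unfolding compact_def optimal_schedule_def by (meson le_trans)
  moreover have "sum C' (jobs I) < sum C (jobs I)"
  proof (rule sum_strict_mono_ex1)
    have "t < C j" using assms empty le_neq_implies_less by blast
    then show "\<exists>i\<in>jobs I. C' i < C i" using assms(1) by (intro bexI[of _ j]) (auto simp: C'_def)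
  qed (simp_all add: finite_jobs le)
  ultimately show False using C[unfolded compact_def, THEN conjunct2, rule_format, of C'] by simp
qed

text \<open>Each of the slots \<open>1\<close> to \<open>C j\<close> is occupied, and different
  slots are occupied by different jobs.\<close>

lemma compact_le_njobs:
  assumes "j \<in> jobs I"
  shows "C j \<le> njobs I"
proof -
  have "{1..C j} \<subseteq> C ` jobs I" using compact_no_empty_slot[OF assms] by fastforce
  then have "card {1..C j} \<le> card (C ` jobs I)" by (intro card_mono) (simp_all add: finite_jobs)
  also have "\<dots> \<le> card (jobs I)" by (rule card_image_le) (fact finite_jobs)
  finally show ?thesis by (simp add: card_jobs)
qed

text \<open>A successor could be exchanged with a non-successor in the next slot, unless that slot contains a
  successor as well.\<close>

lemma compact_next_slot:
  assumes a: "a \<in> succs I" and b: "b \<in> succs I" "C a < C b"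
  shows "\<exists>i\<in>succs I. C i = Suc (C a)"
proof (rule ccontr)
  assume none: "\<not> (\<exists>i\<in>succs I. C i = Suc (C a))"
  have "b \<in> jobs I" using b by (simp add: succs_def)
  then obtain x where x: "x \<in> jobs I" "C x = Suc (C a)"
    using compact_no_empty_slot[of b "Suc (C a)"] b(2) by auto
  have xs: "x \<notin> succs I" using none x by blast
  have aI: "a \<in> jobs I" using a by (simp add: succs_def)
  define C' where "C' = C \<circ> Transposition.transpose a x"
  have C': "C' a = Suc (C a)" "C' x = C a" "\<And>j. j \<noteq> a \<Longrightarrow> j \<noteq> x \<Longrightarrow> C' j = C j"
    using x by (auto simp: C'_def)
  have "feasible_schedule I C'"
  proof (rule feasible_scheduleI[OF compact_feasible])
    show "schedule I C'" unfolding C'_def by (rule schedule_swap[OF compact_schedule aI x(1)])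
    fix i j assume ij: "i \<in> jobs I" "j \<in> succs I" "C i < C j"
    \<comment> \<open>A successor after \<open>a\<close> is at least two slots later, as the next
      slot contains none. So delaying \<open>a\<close> by one slot keeps it before \<open>j\<close>,
      and \<open>x\<close> only moves forward.\<close>
    have "j \<noteq> x" "C j \<noteq> Suc (C a)" using ij xs none by auto
    then show "C' i < C' j"
      using ij C' x(2) by (cases "j = a"; cases "i = a"; cases "i = x") auto
  qed (fact wf)
  moreover have "obj_value \<gamma> I C' = obj_value \<gamma> I C"
    unfolding C'_def by (rule obj_value_swap[OF aI x(1)])
  ultimately have "optimal_schedule \<gamma> I C'"
    using C unfolding compact_def optimal_schedule_def by simp
  moreover have "sum C' (jobs I) = sum C (jobs I)"
    unfolding C'_def using obj_value_swap[OF aI x(1), of Total_completion C] by simp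
  moreover have "sum C (succs I) < sum C' (succs I)"
  proof (rule sum_strict_mono_ex1)
    show "finite (succs I)" using finite_jobs by (simp add: succs_def)
    show "\<forall>j\<in>succs I. C j \<le> C' j"
    proof
      fix j assume "j \<in> succs I"
      then show "C j \<le> C' j" using xs C' by (cases "j = a"; cases "j = x") auto
    qed
    show "\<exists>j\<in>succs I. C j < C' j" using a C'(1) by (intro bexI[of _ a]) simp_all
  qed
  ultimately show False using C[unfolded compact_def, THEN conjunct2, rule_format, of C'] by simp
qed

text \<open>Every slot from \<open>C a\<close> to \<open>C b\<close> contains a successor, by
  induction on the distance from \<open>C a\<close>. Hence this interval has at most
  \<open>card (succs I)\<close> slots.\<close>

lemma compact_window:
  assumes a: "a \<in> succs I" and b: "b \<in> succs I"
  shows "int (C b) - int (C a) \<le> int (card (succs I)) - 1"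
proof -
  have fin: "finite (succs I)" using finite_jobs by (simp add: succs_def)
  have "C a + d \<in> C ` succs I" if "C a + d \<le> C b" for d
    using that
  proof (induction d)
    case 0
    then show ?case using a by simp
  next
    case (Suc d)
    then obtain i where i: "i \<in> succs I" "C i = C a + d" by auto
    have "\<exists>l\<in>succs I. C l = C a + Suc d" using compact_next_slot[OF i(1) b] Suc.prems i(2) by simp
    then show ?case by (metis imageI)
  qed
  then have "{C a..C b} \<subseteq> C ` succs I"
    by (metis atLeastAtMost_iff le_Suc_ex subsetI)
  then have "card {C a..C b} \<le> card (C ` succs I)" using fin by (intro card_mono) auto
  also have "\<dots> \<le> card (succs I)" using fin by (rule card_image_le)
  finally have "Suc (C b) - C a \<le> card (succs I)" by simp
  moreover have "0 < card (succs I)" using a fin by (auto simp: card_gt_0_iff)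
  ultimately show ?thesis by linarith
qed

lemma compact_is_config: "is_config I (\<lambda>j. if j \<in> succs I then Some (C j) else None)"
  unfolding is_config_def
proof (intro conjI ballI allI impI)
  fix j assume j: "j \<in> succs I"
  then have "j \<in> jobs I" by (simp add: succs_def)
  then show "the (if j \<in> succs I then Some (C j) else None) \<in> {1..njobs I}"
    using j compact_le_njobs compact_schedule by (simp add: schedule_def)
  fix i assume i: "i \<in> succs I"
  show "int (the (if i \<in> succs I then Some (C i) else None)) -
      int (the (if j \<in> succs I then Some (C j) else None)) \<le> int (card (succs I)) - 1"
    using compact_window[OF j i] i j by simp
next
  fix t
  have "card {j \<in> succs I. the (if j \<in> succs I then Some (C j) else None) = t} \<le> card {j \<in> jobs I. C j = t}"
    using finite_jobs by (intro card_mono) (auto simp: succs_def)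
  also have "\<dots> \<le> machines I" using compact_schedule by (simp add: schedule_def)
  finally show "card {j \<in> succs I. the (if j \<in> succs I then Some (C j) else None) = t} \<le> machines I" .
next
  fix i j assume ij: "i \<in> succs I" "j \<in> succs I" "is_And (psi I j) \<and> i \<in> vars (psi I j)"
  then have "sat (psi I j) (\<lambda>i. C i < C j)"
    using compact_feasible by (simp add: feasible_schedule_def succs_def)
  then show "the (if i \<in> succs I then Some (C i) else None) < the (if j \<in> succs I then Some (C j) else None)"
    using ij by (cases "psi I j") auto
qed (auto simp: dom_def)

end

section \<open>Running time of the parts of the algorithm\<close>

lemma length_upto_n: "length (upto_n I) = njobs I"
  by simp

lemma within_slot_loads: "within (slot_loads I C js) (njobs I + (length js * (njobs I + 1) + 1))"
  unfolding slot_loads_def by (intro within_bind within_spend within_loop within_store)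

lemma length_all_maps: "length (all_maps ts js) = length ts ^ length js"
  by (induction js) (simp_all add: length_concat rev_map comp_def sum_list_triv mult.commute)

text \<open>The factor \<open>length js + 1\<close> is due to slot lists of length one, for which
  every level of the recursion costs the same. With \<open>ts\<close> nonempty the number of maps
  does not shrink from one level to the next.\<close>

lemma within_assignments:
  assumes "ts \<noteq> []"
  shows "within (assignments n ts js) ((length js + 1) * length ts ^ length js * (n + 5))"
proof (induction js)
  case Nil
  have "within (assignments n ts []) (Suc (n + 0))"
    unfolding assignments.simps by (intro within_tick within_bind within_spend within_ret)
  then show ?case by (rule within_mono) simp
next
  case (Cons j js)
  let ?p = "length js" let ?K = "length ts" let ?X = "length ts ^ length js"
  have "within (assignments n ts (j # js))
    (Suc ((?p + 1) * ?X * (n + 5) + (?X * ((?K * ((n + 0) + 1) + 1) + 1) + 1)))"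
    unfolding assignments.simps
  proof (intro within_tick within_bind Cons.IH)
    fix Cs assume "Cs \<in> outs (assignments n ts js)"
    then have len: "length Cs = ?X" by (simp add: outs_assignments length_all_maps)
    show "within (loop (\<lambda>C. loop (\<lambda>t out. bind_prog (store n C j (Some t)) (\<lambda>C'. ret (C' # out))) ts) Cs [])
        (?X * ((?K * ((n + 0) + 1) + 1) + 1) + 1)"
      unfolding len[symmetric] by (intro within_loop within_bind within_store within_ret)
  qed
  moreover have "Suc ((p + 1) * X * (n + 5) + (X * ((K * ((n + 0) + 1) + 1) + 1) + 1))
      \<le> (p + 2) * (K * X) * (n + 5)" if KX: "1 \<le> K" "1 \<le> X" for p K X :: nat
  proof -
    \<comment> \<open>After this substitution the inequality holds coefficient by coefficient
      between polynomials in natural numbers. Several later cost estimates use the same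
      device.\<close>
    obtain K' X' where "K = 1 + K'" "X = 1 + X'" using le_Suc_ex[OF KX(1)] le_Suc_ex[OF KX(2)] by blast
    then show ?thesis by (simp add: algebra_simps)
  qed
  from this[of ?K ?X ?p] assms have "Suc ((?p + 1) * ?X * (n + 5) + (?X * ((?K * ((n + 0) + 1) + 1) + 1) + 1))
      \<le> (length (j # js) + 1) * ?K ^ length (j # js) * (n + 5)"
    by (simp add: Suc_le_eq)
  ultimately show ?case by (rule within_mono)
qed

lemma within_check_config:
  assumes "length ands \<le> length js" "length js \<le> njobs I" "1 \<le> njobs I"
  shows "within (check_config I js ands t\<^sub>0 C) (10 * (length js + 1) * njobs I)"
proof -
  let ?k = "length js" let ?n = "njobs I" let ?a = "length ands"
  have "within (check_config I js ands t\<^sub>0 C)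
    ((?k * (0 + 1) + 1) + ((?n + (?k * (?n + 1) + 1)) + ((length (upto_n I) * (0 + 1) + 1) +
      ((?a * ((?k * (0 + 1) + 1) + 1) + 1) + 0))))"
    unfolding check_config_def by (intro within_bind within_mall within_ret within_slot_loads)
  moreover have "(k * (0 + 1) + 1) + ((n + (k * (n + 1) + 1)) + ((n * (0 + 1) + 1) +
      ((a * ((k * (0 + 1) + 1) + 1) + 1) + 0))) \<le> 10 * (k + 1) * n"
    if le: "a \<le> k" "k \<le> n" "1 \<le> n" for a k n :: nat
  proof -
    obtain d e where "k = a + d" "n = k + e" using le_Suc_ex[OF le(1)] le_Suc_ex[OF le(2)] by blast
    then show ?thesis using le(3) by (simp add: algebra_simps)
  qed
  from this[OF assms] have "(?k * (0 + 1) + 1) + ((?n + (?k * (?n + 1) + 1)) + ((length (upto_n I) * (0 + 1) + 1) +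
      ((?a * ((?k * (0 + 1) + 1) + 1) + 1) + 0))) \<le> 10 * (?k + 1) * ?n"
    unfolding length_upto_n .
  ultimately show ?thesis by (rule within_mono)
qed

text \<open>Once the earliest completion time is fixed, each successor has at most
  \<open>length js\<close> slots to choose from; this replaces the base \<open>n\<close> of the
  power by \<open>k\<close>. Without successors, \<open>0 ^ 0 = 1\<close> accounts for the empty
  configuration.\<close>

lemma length_configs:
  assumes "Cs \<in> outs (configs I js ands)" "1 \<le> njobs I"
  shows "length Cs \<le> njobs I * length js ^ length js"
proof (cases "js = []")
  case True
  then show ?thesis using assms by (simp add: outs_configs)
next
  case False
  let ?f = "\<lambda>t0. rev (filter (config_test I js ands t0)
    (all_maps [t0..<min (t0 + length js) (Suc (njobs I))] js))"
  have "length (?f t0) \<le> length js ^ length js" for t0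
  proof -
    have "length (?f t0) \<le> length (all_maps [t0..<min (t0 + length js) (Suc (njobs I))] js)"
      by simp
    also have "\<dots> \<le> length js ^ length js"
      unfolding length_all_maps by (intro power_mono) auto
    finally show ?thesis .
  qed
  then have "sum_list (map (length \<circ> ?f) ts) \<le> length ts * length js ^ length js" for ts
    by (induction ts) (simp_all add: add_mono)
  from this[of "upto_n I"] show ?thesis
    using assms(1) False unfolding outs_configs length_upto_n
    by (simp add: length_concat rev_map[symmetric] sum_list_rev comp_def del: upt_Suc)
qed

lemma within_configs:
  assumes "length ands \<le> length js" "length js \<le> njobs I" "1 \<le> njobs I"
  shows "within (configs I js ands) (20 * (length js + 1) * length js ^ length js * (njobs I)\<^sup>2)"
proof (cases "js = []")
  case True
  have "within (assignments (njobs I) [] []) (Suc (njobs I + 0))"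
    unfolding assignments.simps by (intro within_tick within_bind within_spend within_ret)
  moreover have "Suc (njobs I + 0) \<le> 20 * (length js + 1) * length js ^ length js * (njobs I)\<^sup>2"
    using True assms(3) by (cases "njobs I") (simp_all add: power2_eq_square algebra_simps)
  ultimately show ?thesis using True within_mono by (simp add: configs_def)
next
  case False
  let ?k = "length js" let ?n = "njobs I" let ?X = "length js ^ length js"
  let ?body = "(?k + 1) * ?X * (?n + 5) + (?X * ((10 * (?k + 1) * ?n + 0) + 1) + 1)"
  have "within (configs I js ands) (length (upto_n I) * (?body + 1) + 1)"
    unfolding configs_def if_not_P[OF False]
  proof (intro within_loop within_bind)
    fix t0 assume "t0 \<in> set (upto_n I)"
    then have t0: "1 \<le> t0" "t0 \<le> ?n" by auto
    let ?ts = "[t0..<min (t0 + ?k) (Suc ?n)]"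
    have ts: "?ts \<noteq> []" using t0 False by (cases js) auto
    have "length ?ts \<le> ?k" by simp
    then have pow: "length ?ts ^ ?k \<le> ?X" by (intro power_mono) auto
    show "within (assignments ?n ?ts js) ((?k + 1) * ?X * (?n + 5))"
      by (rule within_mono[OF within_assignments[OF ts]]) (intro mult_le_mono pow order_refl)
    fix out Cs assume "Cs \<in> outs (assignments ?n ?ts js)"
    then have "length Cs \<le> ?X" using pow by (simp add: outs_assignments length_all_maps)
    moreover have "within (loop (\<lambda>C out. bind_prog (check_config I js ands t0 C)
        (\<lambda>ok. ret (if ok then C # out else out))) Cs out) (length Cs * ((10 * (?k + 1) * ?n + 0) + 1) + 1)"
      using assms by (intro within_loop within_bind within_check_config within_ret)
    ultimately show "within (loop (\<lambda>C out. bind_prog (check_config I js ands t0 C)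
        (\<lambda>ok. ret (if ok then C # out else out))) Cs out) (?X * ((10 * (?k + 1) * ?n + 0) + 1) + 1)"
      by (elim within_mono) (intro add_le_mono mult_le_mono order_refl)
  qed
  moreover have "length (upto_n I) * (?body + 1) + 1 \<le> 20 * (?k + 1) * ?X * ?n\<^sup>2"
  proof -
    define Y where "Y = (?k + 1) * ?X"
    have X: "?X \<le> Y" by (simp add: Y_def)
    have "1 \<le> ?X" using False by (simp add: Suc_le_eq)
    have "?body + 1 = Y * ?n + 5 * Y + 10 * (Y * ?n) + ?X + 2"
      by (simp add: Y_def algebra_simps)
    also have "\<dots> \<le> 19 * (Y * ?n)"
    proof -
      have "Y \<le> Y * ?n" using assms(3) by simp
      then show ?thesis using X \<open>1 \<le> ?X\<close> by linarith
    qed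
    finally have "?n * (?body + 1) + 1 \<le> ?n * (19 * (Y * ?n)) + 1"
      by (intro add_le_mono mult_le_mono order_refl)
    also have "\<dots> \<le> 20 * (Y * ?n\<^sup>2)"
    proof -
      have "1 \<le> Y" using X \<open>1 \<le> ?X\<close> by linarith
      then have "1 * 1 \<le> Y * ?n\<^sup>2" using assms(3) by (intro mult_le_mono) simp_all
      moreover have "?n * (19 * (Y * ?n)) = 19 * (Y * ?n\<^sup>2)" by (simp add: power2_eq_square)
      ultimately show ?thesis by linarith
    qed
    finally show ?thesis by (simp only: length_upto_n Y_def mult.assoc)
  qed
  ultimately show ?thesis by (rule within_mono)
qed

lemma within_early_preds:
  assumes "length ors \<le> length js" "length js \<le> njobs I" "1 \<le> njobs I"
  shows "within (early_preds I js ors C) (6 * (length js + 1) * njobs I)"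
proof -
  let ?k = "length js" let ?n = "njobs I" let ?q = "length ors"
  have "within (early_preds I js ors C) (?n + (?q * (((?k * (0 + 1) + 1) + (?k + ?n)) + 1) + 1))"
    unfolding early_preds_def
  proof (intro within_bind within_spend within_loop within_mfilter within_ret)
    fix j f cands assume "cands \<in> outs (mfilter (\<lambda>i. ret (i \<in> vars (psi I j) \<and> the (C i) < the (C j))) js)"
    moreover have "outs (mfilter (\<lambda>i. ret (i \<in> vars (psi I j) \<and> the (C i) < the (C j))) js) =
        {filter (\<lambda>i. i \<in> vars (psi I j) \<and> the (C i) < the (C j)) js}"
      by (intro outs_mfilter outs_ret)
    ultimately have "length cands \<le> ?k" by simp
    then have "within (bind_prog (pick cands) (\<lambda>i. store ?n f j (Some i))) (?k + ?n)" if "cands \<noteq> []"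
      by (intro within_bind within_store within_mono[OF within_pick[OF that]])
    then show "within (if cands = [] then ret f else bind_prog (pick cands) (\<lambda>i. store ?n f j (Some i))) (?k + ?n)"
      by (simp add: within_ret)
  qed
  moreover have "n + (q * (((k * (0 + 1) + 1) + (k + n)) + 1) + 1) \<le> 6 * (k + 1) * n"
    if le: "q \<le> k" "k \<le> n" "1 \<le> n" for q k n :: nat
  proof -
    obtain d e where "k = q + d" "n = k + e" using le_Suc_ex[OF le(1)] le_Suc_ex[OF le(2)] by blast
    then show ?thesis using le(3) by (simp add: algebra_simps)
  qed
  note this[OF assms]
  ultimately show ?thesis by (rule within_mono)
qed

lemma within_first_free: "within (first_free m load ts) (length ts + 1)"
proof (induction ts)
  case Nil
  then show ?case using within_tick[OF within_ret[where b = 0]] by simp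
next
  case (Cons t ts)
  have "within (first_free m load (t # ts)) (Suc (length ts + 1))"
    unfolding first_free.simps by (intro within_tick within_if within_ret Cons.IH)
  then show ?case by simp
qed

lemma within_place: "within (place I i st) (3 * njobs I + 1)"
proof (cases st)
  case None
  then show ?thesis by (simp add: place_def within_ret)
next
  case (Some p)
  then obtain C load where p: "st = Some (C, load)" by (cases p) auto
  have "within (bind_prog (first_free (machines I) load (upto_n I)) (\<lambda>slot.
     case slot of None \<Rightarrow> ret None
       | Some t \<Rightarrow> bind_prog (store (njobs I) C i (Some t)) (\<lambda>C'.
           bind_prog (store (njobs I) load t (load t + 1)) (\<lambda>load'. ret (Some (C', load'))))))
     ((length (upto_n I) + 1) + (njobs I + (njobs I + 0)))" (is "within ?p _")
  proof (intro within_bind within_first_free)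
    fix slot
    have "within (bind_prog (store (njobs I) C i (Some t)) (\<lambda>C'.
        bind_prog (store (njobs I) load t (load t + 1)) (\<lambda>load'. ret (Some (C', load')))))
        (njobs I + (njobs I + 0))" for t
      by (intro within_bind within_store within_ret)
    then show "within (case slot of None \<Rightarrow> ret None
       | Some t \<Rightarrow> bind_prog (store (njobs I) C i (Some t)) (\<lambda>C'.
           bind_prog (store (njobs I) load t (load t + 1)) (\<lambda>load'. ret (Some (C', load')))))
        (njobs I + (njobs I + 0))"
      by (cases slot) (simp_all add: within_ret)
  qed
  then have "within ?p (3 * njobs I + 1)" by (rule within_mono) simp
  moreover have "place I i st = (if C i \<noteq> None then ret st else ?p)"
    unfolding p place_def by (simp only: option.case prod.case)
  ultimately show ?thesis using within_if[OF within_ret] by (simp only:)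
qed

lemma within_place_before: "within (place_before I j i st) (3 * njobs I + 1)"
proof -
  have "within (place_before I j i st) (3 * njobs I + 1 + 0)"
    unfolding place_before_def by (intro within_bind within_place within_ret)
  then show ?thesis by simp
qed

text \<open>There is one pass over all jobs for each successor and a final one for the rest, hence
  \<open>length js + 1\<close> passes. Scanning the slots and copying the arrays makes each
  placement linear in \<open>njobs I\<close>.\<close>

lemma within_insert_jobs:
  assumes "length js \<le> njobs I" "1 \<le> njobs I"
  shows "within (insert_jobs I js C) (20 * (length js + 1) * (njobs I)\<^sup>2)"
proof -
  let ?k = "length js" let ?n = "njobs I"
  have "within (insert_jobs I js C)
    ((?n + (?k * (?n + 1) + 1)) + ((?k + 1)\<^sup>2 +
      ((?k * ((length (upto_n I) * ((3 * ?n + 1) + 1) + 1) + 1) + 1) +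
        ((length (upto_n I) * ((3 * ?n + 1) + 1) + 1) + 0))))"
    unfolding insert_jobs_def
  proof (intro within_bind within_slot_loads within_sort within_ret)
    fix load order assume "order \<in> outs (sort_prog (\<lambda>j. the (C j)) js)"
    then have len: "length order = ?k" using outs_sort(1) mset_eq_length by blast
    show "within (loop (\<lambda>j. loop (\<lambda>i st. if i \<in> vars (psi I j) then place_before I j i st else ret st)
          (upto_n I)) order (Some (C, load)))
        (?k * ((length (upto_n I) * ((3 * ?n + 1) + 1) + 1) + 1) + 1)"
      unfolding len[symmetric]
    proof (intro within_loop)
      show "within (if i \<in> vars (psi I j) then place_before I j i st else ret st) (3 * ?n + 1)" for i j st
        by (intro within_if within_place_before within_ret)
    qed
    show "within (loop (place I) (upto_n I) st) (length (upto_n I) * ((3 * ?n + 1) + 1) + 1)" for st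
      by (intro within_loop within_place)
  qed
  moreover have "(n + (k * (n + 1) + 1)) + ((k + 1)\<^sup>2 +
      ((k * ((n * ((3 * n + 1) + 1) + 1) + 1) + 1) + ((n * ((3 * n + 1) + 1) + 1) + 0))) \<le> 20 * (k + 1) * n\<^sup>2"
    if le: "k \<le> n" "1 \<le> n" for k n :: nat
  proof -
    have 1: "(k + 1)\<^sup>2 \<le> (k + 1) * (2 * n)"
      unfolding power2_eq_square using le by (intro mult_le_mono) simp_all
    obtain e where "n = 1 + e" using le_Suc_ex[OF le(2)] by blast
    then have 2: "(n + (k * (n + 1) + 1)) + ((k + 1) * (2 * n) +
      ((k * ((n * ((3 * n + 1) + 1) + 1) + 1) + 1) + ((n * ((3 * n + 1) + 1) + 1) + 0))) \<le> 20 * (k + 1) * n\<^sup>2"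
      by (simp add: power2_eq_square algebra_simps)
    show ?thesis by (rule le_trans[OF _ 2]) (intro add_le_mono order_refl 1)
  qed
  from this[OF assms] have "(?n + (?k * (?n + 1) + 1)) + ((?k + 1)\<^sup>2 +
      ((?k * ((length (upto_n I) * ((3 * ?n + 1) + 1) + 1) + 1) + 1) +
        ((length (upto_n I) * ((3 * ?n + 1) + 1) + 1) + 0))) \<le> 20 * (?k + 1) * ?n\<^sup>2"
    unfolding length_upto_n .
  ultimately show ?thesis by (rule within_mono)
qed

lemma within_better: "within (better new best) 0"
  by (auto simp: better_def intro!: within_ret within_alt split: option.split)

lemma within_try_preds:
  assumes "length js \<le> njobs I" "1 \<le> njobs I"
  shows "within (try_preds \<gamma> I js C f best) (22 * (length js + 1) * (njobs I)\<^sup>2)"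
proof -
  let ?k = "length js" let ?n = "njobs I"
  have n: "njobs (replace_ors I f) = ?n" by (simp add: replace_ors_def)
  have "within (try_preds \<gamma> I js C f best) (?n * ?n + (20 * (?k + 1) * ?n\<^sup>2 + (?n + 0)))"
    unfolding try_preds_def Let_def
  proof (intro within_bind within_spend)
    show "within (insert_jobs (replace_ors I f) js C) (20 * (?k + 1) * ?n\<^sup>2)"
      using within_insert_jobs[of js "replace_ors I f" C] assms by (simp add: n)
    show "within (case res of None \<Rightarrow> ret best | Some C' \<Rightarrow> bind_prog (spend ?n)
        (\<lambda>_. better (C', obj_value \<gamma> I (\<lambda>j. the (C' j))) best)) (?n + 0)" for res
    proof -
      have "within (bind_prog (spend ?n) (\<lambda>_. better new best)) (?n + 0)" for new
        by (intro within_bind within_spend within_better)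
      then show ?thesis by (cases res) (simp_all add: within_ret)
    qed
  qed
  moreover have "?n * ?n + (20 * (?k + 1) * ?n\<^sup>2 + (?n + 0)) \<le> 22 * (?k + 1) * ?n\<^sup>2"
    using assms(2) by (cases ?n) (simp_all add: power2_eq_square algebra_simps)
  ultimately show ?thesis by (rule within_mono)
qed

section \<open>Size and cost of the search tree\<close>

text \<open>Here \<open>a\<close> is the number of and-jobs, \<open>l\<close> bounds the time for a leaf, and \<open>v\<close> the time spent
  in one node of the search tree per subset.\<close>

primrec branch_time :: "nat \<Rightarrow> nat \<Rightarrow> nat \<Rightarrow> nat \<Rightarrow> nat" where
  "branch_time a l v 0 = Suc l"
| "branch_time a l v (Suc q) = 2 ^ (q + a) * (v + branch_time a l v q)"

text \<open>Per subset, \<open>11 * (k + 1) * njobs I\<close> pays for creating it, testing all jobs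
  as candidates and recording the choice. The bound \<open>k\<close> may exceed the number of jobs
  still listed, so this cost stays constant during the induction.\<close>

lemma within_branch:
  assumes leaf: "\<And>f best. within (leaf f best) l" and n: "k \<le> njobs I" "1 \<le> njobs I"
    and k: "length js + length ands \<le> k"
  shows "within (branch I ands leaf js f best)
    (branch_time (length ands) l (11 * (k + 1) * njobs I) (length js))"
  using k
proof (induction js arbitrary: f best)
  case Nil
  then show ?case by (simp add: within_tick leaf)
next
  case (Cons j js)
  let ?n = "njobs I" let ?a = "length ands" let ?q = "length js"
  define v where "v = 11 * (k + 1) * ?n"
  define B where "B = branch_time ?a l v ?q"
  have IH: "within (branch I ands leaf js f best) B" for f best
    using Cons unfolding B_def v_def by simp
  have v: "1 \<le> v" using n by (simp add: v_def)
  \<comment> \<open>A job that already has a predecessor costs one step and one recursive call,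
    which \<open>v \<ge> 1\<close> covers.\<close>
  have skip: "Suc B \<le> branch_time ?a l v (length (j # js))"
  proof -
    have eq: "branch_time ?a l v (length (j # js)) = 2 ^ (?q + ?a) * (v + B)" by (simp add: B_def)
    have "Suc B \<le> v + B" using v by simp
    also have "\<dots> = 1 * (v + B)" by (simp only: mult_1)
    also have "\<dots> \<le> 2 ^ (?q + ?a) * (v + B)" by (intro mult_le_mono order_refl) simp
    finally show ?thesis unfolding eq .
  qed
  let ?body = "?n + ((?n * (((?q + 1 + ?a) * (0 + 1) + 1) + 1) + 1) + (?n + (((?q + 1) * (?n + 1) + 1) + B)))"
  have body: "within (branch_body I ands leaf j js f T best) ?body" for T best
  proof -
    have len: "length ((j # js) @ ands) = ?q + 1 + ?a" "length (j # js) = ?q + 1" by simp_all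
    show ?thesis
      unfolding branch_body_def Let_def
    proof (intro within_bind within_spend)
      show "within (mfilter (\<lambda>i. if psi I i = Always
          then mall (\<lambda>k. ret ((i \<in> vars (psi I k)) = (k \<in> insert j T))) ((j # js) @ ands) else ret False) (upto_n I))
        (?n * (((?q + 1 + ?a) * (0 + 1) + 1) + 1) + 1)"
      proof -
        have "within (mfilter (\<lambda>i. if psi I i = Always
          then mall (\<lambda>k. ret ((i \<in> vars (psi I k)) = (k \<in> insert j T))) ((j # js) @ ands) else ret False) (upto_n I))
          (length (upto_n I) * ((length ((j # js) @ ands) * (0 + 1) + 1) + 1) + 1)"
          by (intro within_mfilter within_if within_mall within_ret)
        then show ?thesis unfolding len length_upto_n .
      qed
      fix cands assume "cands \<in> outs (mfilter (\<lambda>i. if psi I i = Always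
          then mall (\<lambda>k. ret ((i \<in> vars (psi I k)) = (k \<in> insert j T))) ((j # js) @ ands) else ret False) (upto_n I))"
      then have "length cands \<le> length (upto_n I)"
        unfolding outs_cands singleton_iff by (simp only: length_filter_le)
      then have "length cands \<le> ?n" by (simp only: length_upto_n)
      then have pick: "within (pick cands) ?n" if "cands \<noteq> []"
        by (rule within_mono[OF within_pick[OF that]])
      have "within (loop (\<lambda>k f. if k \<in> insert j T then store ?n f k (Some i) else ret f) (j # js) f)
          ((?q + 1) * (?n + 1) + 1)" for i
        unfolding len[symmetric] by (intro within_loop within_if within_store within_ret)
      then show "within (if cands = [] then ret best
        else bind_prog (pick cands) (\<lambda>i. bind_prog
          (loop (\<lambda>k f. if k \<in> insert j T then store ?n f k (Some i) else ret f) (j # js) f)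
          (\<lambda>f'. branch I ands leaf js f' best))) (?n + (((?q + 1) * (?n + 1) + 1) + B))"
        by (intro within_if within_ret within_bind IH pick)
    qed
  qed
  define Z where "Z = (2::nat) ^ (?q + ?a)"
  have "within (tick (bind_prog (spend ?q) (\<lambda>_. bind_prog (subsets_prog ?n (js @ ands))
      (\<lambda>Ts. loop (branch_body I ands leaf j js f) Ts best))))
    (Suc (?q + ((Z * (?n + 3) - 2) + (Z * (?body + 1) + 1))))"
  proof (intro within_tick within_bind within_spend)
    show "within (subsets_prog ?n (js @ ands)) (Z * (?n + 3) - 2)"
      using within_subsets[of ?n "js @ ands"] by (simp add: Z_def)
    fix Ts assume "Ts \<in> outs (subsets_prog ?n (js @ ands))"
    then have "length Ts = Z" using outs_subsets(2)[of Ts ?n "js @ ands"] by (simp add: Z_def)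
    then show "within (loop (branch_body I ands leaf j js f) Ts best) (Z * (?body + 1) + 1)"
      using within_loop[of Ts, OF body] by simp
  qed
  moreover have "Suc (?q + ((Z * (?n + 3) - 2) + (Z * (?body + 1) + 1))) \<le> branch_time ?a l v (length (j # js))"
  proof -
    have "1 \<le> Z" by (simp add: Z_def)
    \<comment> \<open>The overhead incurred once per node is charged to each of the
      \<open>Z \<ge> 1\<close> subsets, which makes \<open>Z\<close> a common factor.\<close>
    then have "?q \<le> Z * ?q" "2 \<le> Z * (?n + 3)" by (simp_all add: add_mult_distrib2)
    then have "Suc (?q + ((Z * (?n + 3) - 2) + (Z * (?body + 1) + 1))) \<le>
      Z * ?q + Z * (?n + 3) + Z * (?body + 1)" by linarith
    also have "\<dots> = Z * (?q + (?n + 3) + (?body + 1))" by (simp only: add_mult_distrib2)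
    also have "\<dots> \<le> Z * (v + B)"
    proof (intro mult_le_mono order_refl)
      have ineq: "q + (n + 3) + (n + ((n * (((q + 1 + a) * (0 + 1) + 1) + 1) + 1) +
          (n + (((q + 1) * (n + 1) + 1) + B))) + 1) \<le> 11 * (k + 1) * n + B"
        if le: "q + 1 + a \<le> k" "1 \<le> n" for q a n
      proof -
        obtain d e where "k = q + 1 + a + d" "n = 1 + e"
          using le_Suc_ex[OF le(1)] le_Suc_ex[OF le(2)] by blast
        then show ?thesis by (simp add: algebra_simps)
      qed
      have "?q + 1 + ?a \<le> k" using Cons.prems by simp
      then show "?q + (?n + 3) + (?body + 1) \<le> v + B"
        unfolding v_def using n(2) by (rule ineq)
    qed
    finally show ?thesis by (simp add: Z_def B_def)
  qed
  ultimately have "within (tick (bind_prog (spend ?q) (\<lambda>_. bind_prog (subsets_prog ?n (js @ ands))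
      (\<lambda>Ts. loop (branch_body I ands leaf j js f) Ts best)))) (branch_time ?a l v (length (j # js)))"
    by (rule within_mono)
  moreover have "within (tick (branch I ands leaf js f best)) (branch_time ?a l v (length (j # js)))"
    by (rule within_mono[OF within_tick[OF IH] skip])
  ultimately show ?case
    unfolding branch_Cons v_def[symmetric] if_distrib[of tick] by (intro within_if)
qed

text \<open>The branching factors multiply to \<open>2 ^ (q * a + q * (q - 1) div 2)\<close> only, which leaves room for the
  factor \<open>q + 1\<close>.\<close>

lemma branch_time_bound:
  "(branch_time a l v q + v) * (q + 1) \<le> 2 ^ (q * (q + a) + 1) * (Suc l + v)"
proof (induction q)
  case (Suc q)
  let ?X = "branch_time a l v q + v"
  \<comment> \<open>Adding \<open>v\<close> turns the recursion into a multiplicative one, at the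
    price of one factor two per level.\<close>
  have "branch_time a l v (Suc q) + v \<le> 2 ^ (q + a) * ?X + 2 ^ (q + a) * ?X"
  proof -
    have "1 * v \<le> 2 ^ (q + a) * ?X" by (intro mult_le_mono) simp_all
    then show ?thesis by (simp add: add.commute)
  qed
  also have "\<dots> = 2 ^ (q + a + 1) * ?X" by simp
  finally have step: "branch_time a l v (Suc q) + v \<le> 2 ^ (q + a + 1) * ?X" .
  show ?case
  \<comment> \<open>For \<open>q = 0\<close> the induction hypothesis loses a factor two, which
    would make the exponent one too large; there \<open>?X\<close> is simply
    \<open>Suc l + v\<close>.\<close>
  proof (cases "q = 0")
    case True
    then show ?thesis using step by simp
  next
    case False
    have "(branch_time a l v (Suc q) + v) * (Suc q + 1) \<le> (2 ^ (q + a + 1) * ?X) * (2 * (q + 1))"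
      using step by (intro mult_le_mono) simp_all
    also have "\<dots> = 2 ^ (q + a + 2) * (?X * (q + 1))" by (simp add: algebra_simps)
    also have "\<dots> \<le> 2 ^ (q + a + 2) * (2 ^ (q * (q + a) + 1) * (Suc l + v))"
      by (intro mult_le_mono order_refl Suc.IH)
    also have "\<dots> = 2 ^ (q + a + 2 + (q * (q + a) + 1)) * (Suc l + v)"
      by (simp only: power_add mult.assoc)
    also have "\<dots> \<le> 2 ^ (Suc q * (Suc q + a) + 1) * (Suc l + v)"
      using False by (intro mult_le_mono power_increasing order_refl) (simp_all add: algebra_simps)
    finally show ?thesis .
  qed
qed simp

text \<open>The cost factor splits by \<open>k + 1 \<le> (q + 1) * (a + 1)\<close>. The factor
  \<open>q + 1\<close> cancels against the one in \<open>branch_time_bound\<close>, and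
  \<open>a + 1 \<le> 2 ^ a\<close> goes into the exponent, where
  \<open>q * k + a \<le> k\<^sup>2\<close> because the and-jobs contribute no branching of their
  own.\<close>

lemma branch_time_le:
  assumes "k = q + a" "Suc l + v \<le> c * (k + 1)"
  shows "branch_time a l v q \<le> 2 * c * 2 ^ (k\<^sup>2)"
proof -
  have "branch_time a l v q * (q + 1) \<le> (branch_time a l v q + v) * (q + 1)"
    by (intro mult_le_mono) simp_all
  also have "\<dots> \<le> 2 ^ (q * k + 1) * (Suc l + v)" using branch_time_bound[of a l v q] assms(1) by simp
  also have "\<dots> \<le> 2 ^ (q * k + 1) * (c * (k + 1))" by (intro mult_le_mono order_refl assms(2))
  also have "\<dots> \<le> 2 ^ (q * k + 1) * (c * ((q + 1) * 2 ^ a))"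
  proof (intro mult_le_mono order_refl)
    have "a < 2 ^ a" by (rule less_exp)
    then have "a + 1 \<le> 2 ^ a" by linarith
    then have "(q + 1) * (a + 1) \<le> (q + 1) * 2 ^ a" by (intro mult_le_mono order_refl)
    then show "k + 1 \<le> (q + 1) * 2 ^ a" using assms(1) by (simp add: algebra_simps)
  qed
  also have "\<dots> = (2 * c * 2 ^ (q * k + a)) * (q + 1)"
    unfolding power_add power_one_right by (simp only: ac_simps)
  finally have "branch_time a l v q \<le> 2 * c * 2 ^ (q * k + a)" unfolding mult_le_cancel2 by simp
  also have "\<dots> \<le> 2 * c * 2 ^ (k\<^sup>2)"
  proof (intro mult_le_mono order_refl power_increasing)
    have "a \<le> a * k" using assms(1) by (cases a) simp_all
    then show "q * k + a \<le> k\<^sup>2" using assms(1) by (simp add: power2_eq_square algebra_simps)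
  qed simp
  finally show ?thesis .
qed

section \<open>The whole algorithm\<close>

definition valid_best :: "objective \<Rightarrow> inst \<Rightarrow> best \<Rightarrow> bool" where
  "valid_best \<gamma> I best \<longleftrightarrow> (\<forall>D v. best = Some (D, v) \<longrightarrow>
     dom D = jobs I \<and> feasible_schedule I (\<lambda>j. the (D j)) \<and> v = obj_value \<gamma> I (\<lambda>j. the (D j)))"

definition value_at_most :: "nat \<Rightarrow> best \<Rightarrow> bool" where
  "value_at_most v best \<longleftrightarrow> (\<exists>D w. best = Some (D, w) \<and> w \<le> v)"

lemma outs_better:
  "b \<in> outs (better new best) \<Longrightarrow>
    b = Some new \<and> (\<forall>old. best = Some old \<longrightarrow> snd new \<le> snd old) \<or>
    b = best \<and> (\<exists>old. best = Some old \<and> snd old \<le> snd new)"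
  by (cases best) (auto simp: better_def outs_ret outs_alt split: if_splits)

definition or_jobs :: "inst \<Rightarrow> nat set" where
  "or_jobs I = {j \<in> succs I. is_Or (psi I j)}"

lemma replace_ors_simps [simp]:
  "njobs (replace_ors I f) = njobs I" "machines (replace_ors I f) = machines I"
  "jobs (replace_ors I f) = jobs I" "schedule (replace_ors I f) = schedule I"
  "psi (replace_ors I f) j = (if is_Or (psi I j) then And {the (f j)} else psi I j)"
  by (simp_all add: replace_ors_def jobs_def schedule_def fun_eq_iff)

lemma outs_try_preds:
  assumes "b \<in> outs (try_preds \<gamma> I js C f best)"
  shows "None \<in> outs (insert_jobs (replace_ors I f) js C) \<and> b = best \<or>
    (\<exists>D. Some D \<in> outs (insert_jobs (replace_ors I f) js C) \<and>
      b \<in> outs (better (D, obj_value \<gamma> I (\<lambda>j. the (D j))) best))"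
proof -
  obtain res where "res \<in> outs (insert_jobs (replace_ors I f) js C)"
    "b \<in> outs (case res of None \<Rightarrow> ret best
      | Some C' \<Rightarrow> bind_prog (spend (njobs I)) (\<lambda>_. better (C', obj_value \<gamma> I (\<lambda>j. the (C' j))) best))"
    using assms unfolding try_preds_def Let_def outs_bind outs_spend by blast
  then show ?thesis by (cases res) (auto simp: outs_simps)
qed

locale configuration =
  fixes I :: inst and js :: "nat list" and C :: "nat \<rightharpoonup> nat"
  assumes wf: "wf_inst I" and machines: "1 \<le> machines I"
    and js: "distinct js" "set js = succs I" and config: "is_config I C"
begin

lemma dom_C: "dom C = succs I"
  using config by (simp add: is_config_def)

lemma insertion_replace_ors:
  assumes f: "partial_choice I f" "or_jobs I \<subseteq> dom f"
  shows "insertion (replace_ors I f) js C"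
proof
  show "distinct js" "set js = dom C" using js dom_C by auto
  show "dom C \<subseteq> jobs (replace_ors I f)" using dom_C by (auto simp: succs_def)
  have "the (C j) \<in> {1..njobs I}" if "j \<in> succs I" for j using config that unfolding is_config_def by blast
  then show "ran C \<subseteq> {1..njobs (replace_ors I f)}" using dom_C by (force simp: ran_def)
  show "card {j \<in> dom C. the (C j) = t} \<le> machines (replace_ors I f)" for t
    using config by (simp add: is_config_def dom_C)
  show "1 \<le> machines (replace_ors I f)" using machines by simp
  fix j assume "j \<in> dom C"
  then have j: "j \<in> succs I" by (simp add: dom_C)
  then have sub: "vars (psi I j) \<subseteq> jobs I" using wf by (simp add: wf_inst_def succs_def)
  show "vars (psi (replace_ors I f) j) \<subseteq> jobs (replace_ors I f)"
  proof (cases "is_Or (psi I j)")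
    case True
    then obtain i where "f j = Some i" using f(2) j by (auto simp: or_jobs_def)
    then show ?thesis using f(1) sub True by (auto simp: partial_choice_def)
  qed (use sub in simp)
qed

lemma sat_replace_ors:
  assumes f: "partial_choice I f" "or_jobs I \<subseteq> dom f" and j: "j \<in> succs I"
    and less: "\<And>i. i \<in> vars (psi (replace_ors I f) j) \<Longrightarrow> W i < W j"
  shows "sat (psi I j) (\<lambda>i. W i < W j)"
proof (cases "psi I j")
  case (Or A)
  then obtain i where "f j = Some i" using f(2) j by (auto simp: or_jobs_def)
  moreover from this have "i \<in> A" using f(1) Or by (force simp: partial_choice_def)
  ultimately show ?thesis using less Or by auto
qed (use less in auto)

lemma insert_jobs_feasible:
  assumes f: "partial_choice I f" "or_jobs I \<subseteq> dom f"
    and D: "Some D \<in> outs (insert_jobs (replace_ors I f) js C)"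
  shows "dom D = jobs I" "feasible_schedule I (\<lambda>j. the (D j))"
proof -
  interpret insertion "replace_ors I f" js C by (rule insertion_replace_ors[OF f])
  show "dom D = jobs I" using insert_jobs_sound(1)[OF D] by simp
  have "sat (psi I j) (\<lambda>i. the (D i) < the (D j))" if "j \<in> jobs I" for j
  proof (cases "psi I j = Always")
    case False
    then have "j \<in> succs I" using that by (simp add: succs_def)
    then show ?thesis using insert_jobs_sound(3)[OF D] dom_C by (intro sat_replace_ors[OF f]) auto
  qed simp
  then show "feasible_schedule I (\<lambda>j. the (D j))"
    using insert_jobs_sound(2)[OF D] by (simp add: feasible_schedule_def)
qed

lemma try_preds_valid:
  assumes f: "partial_choice I f" "or_jobs I \<subseteq> dom f" and best: "valid_best \<gamma> I best"
    and b: "b \<in> outs (try_preds \<gamma> I js C f best)"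
  shows "valid_best \<gamma> I b"
  using outs_try_preds[OF b]
proof
  assume "\<exists>D. Some D \<in> outs (insert_jobs (replace_ors I f) js C) \<and>
      b \<in> outs (better (D, obj_value \<gamma> I (\<lambda>j. the (D j))) best)"
  then obtain D where D: "Some D \<in> outs (insert_jobs (replace_ors I f) js C)"
    "b \<in> outs (better (D, obj_value \<gamma> I (\<lambda>j. the (D j))) best)" by blast
  consider "b = Some (D, obj_value \<gamma> I (\<lambda>j. the (D j)))" | "b = best"
    using outs_better[OF D(2)] by blast
  then show ?thesis
    using insert_jobs_feasible[OF f D(1)] best by cases (simp_all add: valid_best_def)
qed (use best in simp)

lemma try_preds_mono:
  assumes best: "value_at_most v best" and b: "b \<in> outs (try_preds \<gamma> I js C f best)"
  shows "value_at_most v b"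
  using outs_try_preds[OF b] best by (auto simp: value_at_most_def dest!: outs_better)

text \<open>At a leaf the guide satisfies all constraints of the modified instance, so the insertion
  is not discarded. The result is at least as good as the guide because it dominates it in the
  number of finished jobs.\<close>

lemma try_preds_reaches:
  assumes f: "partial_choice I f" "or_jobs I \<subseteq> dom f" and W: "witness \<gamma> I C v f [] W"
    and b: "b \<in> outs (try_preds \<gamma> I js C f best)"
  shows "value_at_most v b"
proof -
  interpret insertion "replace_ors I f" js C by (rule insertion_replace_ors[OF f])
  have sched: "schedule I W" and obj: "obj_value \<gamma> I W = v" and WC: "\<And>k. k \<in> succs I \<Longrightarrow> W k = the (C k)"
    and Wand: "\<And>k i. k \<in> succs I \<Longrightarrow> is_And (psi I k) \<Longrightarrow> i \<in> vars (psi I k) \<Longrightarrow> W i < W k"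
    and Wf: "\<And>k i. f k = Some i \<Longrightarrow> W i < W k"
    using W unfolding witness_def by blast+
  have WC': "W j = the (C j)" if "j \<in> dom C" for j using WC that by (simp add: dom_C)
  have "W i < W j" if "j \<in> dom C" "i \<in> vars (psi (replace_ors I f) j)" for i j
  proof -
    have j: "j \<in> succs I" using that by (simp add: dom_C)
    show ?thesis
    proof (cases "psi I j")
      case (Or A)
      then obtain i' where "f j = Some i'" using f(2) j by (auto simp: or_jobs_def)
      then show ?thesis using Wf that(2) Or by simp
    next
      case (And A)
      then show ?thesis using Wand j that(2) by simp
    qed (use that(2) in simp)
  qed
  then have "None \<notin> outs (insert_jobs (replace_ors I f) js C)"
    using sched WC' by (intro insert_jobs_complete[of W]) simp_all
  then obtain D where D: "Some D \<in> outs (insert_jobs (replace_ors I f) js C)"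
    "b \<in> outs (better (D, obj_value \<gamma> I (\<lambda>j. the (D j))) best)"
    using outs_try_preds[OF b] by blast
  have "obj_value \<gamma> I (\<lambda>j. the (D j)) \<le> v"
    unfolding obj[symmetric]
    by (rule obj_value_mono_counts[OF wf]) (use insert_jobs_sound(4)[OF D(1)] sched WC' in simp)
  then show ?thesis using outs_better[OF D(2)] by (auto simp: value_at_most_def)
qed

text \<open>The third fact is what the search relies on: an or-job left open has no early
  predecessor among the successors, so in any feasible schedule for this configuration a
  non-successor satisfies its constraint.\<close>

lemma outs_early_preds:
  assumes f: "f \<in> outs (early_preds I js ors C)" and ors: "set ors = or_jobs I"
  shows "partial_choice I f"
    "f j = Some i \<Longrightarrow> j \<in> succs I \<and> i \<in> succs I \<and> the (C i) < the (C j)"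
    "j \<in> or_jobs I \<Longrightarrow> f j = None \<Longrightarrow> i \<in> succs I \<Longrightarrow> i \<in> vars (psi I j) \<Longrightarrow> \<not> the (C i) < the (C j)"
proof -
  define cands where "cands j = filter (\<lambda>i. i \<in> vars (psi I j) \<and> the (C i) < the (C j)) js" for j
  define Inv where "Inv A f \<longleftrightarrow>
    (\<forall>j i. f j = Some i \<longrightarrow> j \<in> or_jobs I \<and> i \<in> set (cands j)) \<and> (\<forall>j\<in>A. f j = None \<longrightarrow> cands j = [])"
    for A and f :: "nat \<rightharpoonup> nat"
  have outs_cands: "outs (mfilter (\<lambda>i. ret (i \<in> vars (psi I j) \<and> the (C i) < the (C j))) js) = {cands j}" for j
    unfolding cands_def by (intro outs_mfilter outs_ret)
  have "f \<in> outs (loop (\<lambda>j f. bind_prog (mfilter (\<lambda>i. ret (i \<in> vars (psi I j) \<and> the (C i) < the (C j))) js)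
      (\<lambda>cands. if cands = [] then ret f else bind_prog (pick cands) (\<lambda>i. store (njobs I) f j (Some i)))) ors Map.empty)"
    using f by (simp add: early_preds_def outs_bind outs_spend)
  then have "Inv (set ors) f"
  proof (rule loop_prefix_induct[where Inv = "\<lambda>ys. Inv (set ys)"])
    show "Inv (set []) Map.empty" by (simp add: Inv_def)
    fix ys j zs f f'
    assume split: "ors = ys @ j # zs" and inv: "Inv (set ys) f"
      and f': "f' \<in> outs (bind_prog (mfilter (\<lambda>i. ret (i \<in> vars (psi I j) \<and> the (C i) < the (C j))) js)
      (\<lambda>cands. if cands = [] then ret f else bind_prog (pick cands) (\<lambda>i. store (njobs I) f j (Some i))))"
    have "j \<in> or_jobs I" using split ors by auto
    then show "Inv (set (ys @ [j])) f'"
      using f' inv unfolding outs_bind outs_cands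
      by (auto simp: Inv_def outs_simps outs_pick split: if_splits)
  qed
  then have inv: "\<And>j i. f j = Some i \<Longrightarrow> j \<in> or_jobs I \<and> i \<in> set (cands j)"
    "\<And>j. j \<in> or_jobs I \<Longrightarrow> f j = None \<Longrightarrow> cands j = []"
    using ors by (auto simp: Inv_def)
  show "partial_choice I f"
    unfolding partial_choice_def
  proof (intro allI impI)
    fix j i assume "f j = Some i"
    from inv(1)[OF this] show "is_Or (psi I j) \<and> i \<in> vars (psi I j)" by (simp add: or_jobs_def cands_def)
  qed
  show "j \<in> succs I \<and> i \<in> succs I \<and> the (C i) < the (C j)" if "f j = Some i"
    using inv(1)[OF that] js by (simp add: or_jobs_def cands_def)
  show "\<not> the (C i) < the (C j)" if "j \<in> or_jobs I" "f j = None" "i \<in> succs I" "i \<in> vars (psi I j)"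
    using inv(2)[OF that(1,2)] that(3,4) js by (auto simp: cands_def filter_empty_conv)
qed

lemma initial_witness:
  assumes f: "f \<in> outs (early_preds I js ors C)" and ors: "set ors = or_jobs I"
    and W: "feasible_schedule I W" "\<And>j. j \<in> succs I \<Longrightarrow> W j = the (C j)" and order: "set order = or_jobs I"
  shows "witness \<gamma> I C (obj_value \<gamma> I W) f order W"
proof -
  note e = outs_early_preds[OF f ors]
  have sat: "sat (psi I j) (\<lambda>i. W i < W j)" if "j \<in> succs I" for j
    using W(1) that by (simp add: feasible_schedule_def succs_def)
  have "W i < W j" if "j \<in> succs I" "is_And (psi I j)" "i \<in> vars (psi I j)" for i j
    using sat[OF that(1)] that(2,3) by (cases "psi I j") auto
  moreover have "W i < W j" if "f j = Some i" for i j
    using e(2)[OF that] W(2) by simp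
  moreover have "\<exists>i\<in>vars (psi I j). psi I i = Always \<and> W i < W j" if j: "j \<in> or_jobs I" "f j = None" for j
  proof -
    have js: "j \<in> succs I" "is_Or (psi I j)" using j by (simp_all add: or_jobs_def)
    then obtain i where i: "i \<in> vars (psi I j)" "W i < W j"
      using sat[OF js(1)] by (cases "psi I j") auto
    moreover have "psi I i = Always"
    proof (rule ccontr)
      assume "psi I i \<noteq> Always"
      then have "i \<in> succs I" using i(1) js(1) wf by (auto simp: succs_def wf_inst_def)
      then show False using e(3)[OF j _ i(1)] i(2) W(2) js(1) by simp
    qed
    ultimately show ?thesis by blast
  qed
  \<comment> \<open>Only successors have been chosen so far, so the last conjunct of
    \<open>witness\<close> holds vacuously at the root.\<close>
  moreover have "psi I i \<noteq> Always" if "f j = Some i" for i j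
    using e(2)[OF that] by (simp add: succs_def)
  ultimately show ?thesis
    using W order unfolding witness_def feasible_schedule_def by blast
qed

end

definition process_config where
  "process_config \<gamma> I js ands ors C best = do {
     f \<leftarrow> early_preds I js ors C;
     order \<leftarrow> sort_prog (\<lambda>j. the (C j)) ors;
     branch I ands (try_preds \<gamma> I js C) order f best}"

lemma and_or_alg_succ_eq:
  "and_or_alg_succ \<gamma> I = do {
     js \<leftarrow> mfilter (\<lambda>j. ret (psi I j \<noteq> Always)) (upto_n I);
     ands \<leftarrow> mfilter (\<lambda>j. ret (is_And (psi I j))) js;
     ors \<leftarrow> mfilter (\<lambda>j. ret (is_Or (psi I j))) js;
     Cs \<leftarrow> configs I js ands;
     best \<leftarrow> loop (process_config \<gamma> I js ands ors) Cs None;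
     ret (map_option fst best)}"
  by (simp only: and_or_alg_succ_def process_config_def[abs_def])

lemma outs_filter_ret: "outs (mfilter (\<lambda>x. ret (P x)) xs) = {filter P xs}"
  by (intro outs_mfilter outs_ret)

text \<open>The first fact gives soundness of the main loop. The other two are the premises of
  \<open>loop_reaches\<close>: the configuration of the guide attains the value whatever
  \<open>best\<close> was before, and every other configuration keeps it.\<close>

lemma process_config_correct:
  assumes I: "wf_inst I" "1 \<le> machines I" and js: "distinct js" "set js = succs I"
    and ands: "set ands = {j \<in> succs I. is_And (psi I j)}" and ors: "set ors = or_jobs I"
    and C: "is_config I C" and b: "b \<in> outs (process_config \<gamma> I js ands ors C best)"
  shows "valid_best \<gamma> I best \<Longrightarrow> valid_best \<gamma> I b"
    "value_at_most v best \<Longrightarrow> value_at_most v b"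
    "feasible_schedule I W \<Longrightarrow> (\<And>j. j \<in> succs I \<Longrightarrow> W j = the (C j)) \<Longrightarrow> value_at_most (obj_value \<gamma> I W) b"
proof -
  interpret configuration I js C using I js C by unfold_locales
  obtain f order where f: "f \<in> outs (early_preds I js ors C)"
    and sort: "order \<in> outs (sort_prog (\<lambda>j. the (C j)) ors)"
    and b': "b \<in> outs (branch I ands (try_preds \<gamma> I js C) order f best)"
    using b by (auto simp: process_config_def outs_bind)
  have order: "set order = or_jobs I" using outs_sort(1)[OF sort] ors by (metis set_mset_mset)
  have or: "k \<in> succs I \<and> is_Or (psi I k)" if "k \<in> set order" for k using that order by (simp add: or_jobs_def)
  have choice: "partial_choice I f" "or_jobs I \<subseteq> dom f \<union> set order"
    using outs_early_preds(1)[OF f ors] order by auto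
  show "valid_best \<gamma> I b" if "valid_best \<gamma> I best"
    by (rule branch_preserves[where R = "valid_best \<gamma> I" and A = "or_jobs I", OF _ b' choice that])
      (use try_preds_valid or in auto)
  show "value_at_most v b" if "value_at_most v best"
    by (rule branch_preserves[where R = "value_at_most v" and A = "or_jobs I", OF _ b' choice that])
      (use try_preds_mono or in auto)
  show "value_at_most (obj_value \<gamma> I W) b"
    if W: "feasible_schedule I W" "\<And>j. j \<in> succs I \<Longrightarrow> W j = the (C j)"
  proof (rule branch_reaches[where P = "\<lambda>_. True" and A = "or_jobs I" and Q = "value_at_most (obj_value \<gamma> I W)",
        OF I(1) ands _ _ _ b' choice _ or outs_sort(2)[OF sort] initial_witness[OF f ors W order]])
    show "value_at_most (obj_value \<gamma> I W) b"
      if "value_at_most (obj_value \<gamma> I W) best" "b \<in> outs (try_preds \<gamma> I js C f best)" for f best b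
      using that by (rule try_preds_mono)
    show "value_at_most (obj_value \<gamma> I W) b"
      if "partial_choice I f" "or_jobs I \<subseteq> dom f" "witness \<gamma> I C (obj_value \<gamma> I W) f [] W'"
        "b \<in> outs (try_preds \<gamma> I js C f best)" for f W' best b
      using that by (rule try_preds_reaches)
  qed simp_all
qed

lemma set_succs_list: "set (filter (\<lambda>j. psi I j \<noteq> Always) (upto_n I)) = succs I"
  by (auto simp: succs_def jobs_def)

lemma and_or_alg_succ_optimal:
  assumes I: "wf_inst I" "feasible_inst I" and r: "r \<in> outs (and_or_alg_succ \<gamma> I)"
  shows "\<exists>C. r = Some C \<and> dom C = jobs I \<and> optimal_schedule \<gamma> I (\<lambda>j. the (C j))"
proof -
  define js where "js = filter (\<lambda>j. psi I j \<noteq> Always) (upto_n I)"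
  define ands where "ands = filter (\<lambda>j. is_And (psi I j)) js"
  define ors where "ors = filter (\<lambda>j. is_Or (psi I j)) js"
  have js: "distinct js" "set js = succs I"
    unfolding js_def by (simp del: upt_Suc) (rule set_succs_list)
  have ands: "set ands = {j \<in> succs I. is_And (psi I j)}" and ors: "set ors = or_jobs I"
    using js by (auto simp: ands_def ors_def or_jobs_def)
  obtain Cs best where Cs: "Cs \<in> outs (configs I js ands)"
    and best: "best \<in> outs (loop (process_config \<gamma> I js ands ors) Cs None)" and r: "r = map_option fst best"
  proof -
    have "r \<in> (\<Union>Cs\<in>outs (configs I js ands).
        \<Union>best\<in>outs (loop (process_config \<gamma> I js ands ors) Cs None). {map_option fst best})"
      using r by (simp only: and_or_alg_succ_eq outs_bind outs_filter_ret outs_ret js_def[symmetric]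
          UN_insert UN_empty Un_empty_right ands_def[symmetric] ors_def[symmetric])
    then show thesis using that by blast
  qed
  have configs: "set Cs = {C. is_config I C}"
    by (rule configs_correct[OF js ands Cs[unfolded outs_def]])
  obtain W where W: "compact \<gamma> I W" using compact_exists[OF I(2)] .
  then have feas: "feasible_schedule I W" and opt: "optimal_schedule \<gamma> I W"
    by (simp_all add: compact_def optimal_schedule_def)
  have machines: "1 \<le> machines I"
    using feasible_imp_machines[OF I(1), of W] feas by (simp add: feasible_schedule_def)
  note correct = process_config_correct[OF I(1) machines js ands ors]
  define C where "C = (\<lambda>j. if j \<in> succs I then Some (W j) else None)"
  have C: "C \<in> set Cs" using compact_is_config[OF I(1) W] configs by (simp add: C_def)
  have valid: "valid_best \<gamma> I best"
  proof (rule loop_invariant[where R = "valid_best \<gamma> I", OF best])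
    show "valid_best \<gamma> I None" by (simp add: valid_best_def)
    fix C best b assume "C \<in> set Cs" "valid_best \<gamma> I best" "b \<in> outs (process_config \<gamma> I js ands ors C best)"
    then show "valid_best \<gamma> I b" using correct(1) configs by blast
  qed
  have "value_at_most (obj_value \<gamma> I W) best"
  proof (rule loop_reaches[where R = "\<lambda>_. True" and T = "value_at_most (obj_value \<gamma> I W)", OF best _ C])
    fix C best b assume "C \<in> set Cs" "value_at_most (obj_value \<gamma> I W) best"
      "b \<in> outs (process_config \<gamma> I js ands ors C best)"
    then show "value_at_most (obj_value \<gamma> I W) b" using correct(2) configs by blast
  next
    fix best b assume "b \<in> outs (process_config \<gamma> I js ands ors C best)"
    then show "value_at_most (obj_value \<gamma> I W) b"
      using correct(3)[of C b \<gamma> best W] C configs feas by (simp add: C_def)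
  qed simp_all
  then obtain D v where D: "best = Some (D, v)" "v \<le> obj_value \<gamma> I W"
    by (auto simp: value_at_most_def)
  with valid have v: "dom D = jobs I" "feasible_schedule I (\<lambda>j. the (D j))"
    "v = obj_value \<gamma> I (\<lambda>j. the (D j))"
    by (simp_all add: valid_best_def)
  have "optimal_schedule \<gamma> I (\<lambda>j. the (D j))"
    unfolding optimal_schedule_def
  proof (intro conjI allI impI)
    fix C' assume "feasible_schedule I C'"
    then have "obj_value \<gamma> I W \<le> obj_value \<gamma> I C'" using opt by (simp add: optimal_schedule_def)
    then show "obj_value \<gamma> I (\<lambda>j. the (D j)) \<le> obj_value \<gamma> I C'" using D(2) v(3) by linarith
  qed (fact v(2))
  then show ?thesis using r D(1) v(1) by simp
qed

section \<open>Total running time\<close>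

lemma within_process_config:
  assumes "length ands + length ors = length js" "length js \<le> njobs I" "1 \<le> njobs I"
  shows "within (process_config \<gamma> I js ands ors C best) (84 * 2 ^ ((length js)\<^sup>2) * (njobs I)\<^sup>2)"
proof -
  let ?k = "length js" let ?n = "njobs I" let ?l = "22 * (length js + 1) * (njobs I)\<^sup>2"
  let ?v = "11 * (?k + 1) * ?n"
  have "within (process_config \<gamma> I js ands ors C best)
    (6 * (?k + 1) * ?n + ((length ors + 1)\<^sup>2 + branch_time (length ands) ?l ?v (length ors)))"
    unfolding process_config_def
  proof (intro within_bind within_sort)
    show "within (early_preds I js ors C) (6 * (?k + 1) * ?n)"
      using assms by (intro within_early_preds) simp_all
    fix f order assume "order \<in> outs (sort_prog (\<lambda>j. the (C j)) ors)"
    then have len: "length order = length ors" using outs_sort(1) mset_eq_length by blast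
    show "within (branch I ands (try_preds \<gamma> I js C) order f best)
        (branch_time (length ands) ?l ?v (length ors))"
      unfolding len[symmetric] using assms len
      by (intro within_branch within_try_preds) simp_all
  qed
  moreover have "6 * (?k + 1) * ?n + ((length ors + 1)\<^sup>2 + branch_time (length ands) ?l ?v (length ors))
      \<le> 84 * 2 ^ (?k\<^sup>2) * ?n\<^sup>2"
  proof -
    have n: "?n \<le> ?n\<^sup>2" "1 \<le> ?n\<^sup>2" using assms(3) by (simp_all add: power2_eq_square)
    have "?v \<le> 11 * (?k + 1) * ?n\<^sup>2" using n by (intro mult_le_mono) simp_all
    moreover have "1 * 1 \<le> (?k + 1) * ?n\<^sup>2" using n by (intro mult_le_mono) simp_all
    moreover have "?l = 22 * ((?k + 1) * ?n\<^sup>2)" "11 * (?k + 1) * ?n\<^sup>2 = 11 * ((?k + 1) * ?n\<^sup>2)"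
      "34 * ?n\<^sup>2 * (?k + 1) = 34 * ((?k + 1) * ?n\<^sup>2)"
      by (simp_all only: mult.assoc mult.commute mult.left_commute)
    \<comment> \<open>The constant is \<open>22 + 11 + 1\<close>: insertion at a leaf, work per
      subset, and the single step at the leaf.\<close>
    ultimately have "Suc ?l + ?v \<le> 34 * ?n\<^sup>2 * (?k + 1)" by linarith
    then have 1: "branch_time (length ands) ?l ?v (length ors) \<le> 2 * (34 * ?n\<^sup>2) * 2 ^ (?k\<^sup>2)"
      using assms(1) by (intro branch_time_le) simp_all
    have "length ors + 1 \<le> 2 * ?n" "?k + 1 \<le> 2 * ?n" using assms by simp_all
    then have "(length ors + 1)\<^sup>2 \<le> (2 * ?n)\<^sup>2" "(?k + 1) * ?n \<le> (2 * ?n) * ?n"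
      by (intro power_mono mult_le_mono; simp)+
    moreover have "(2 * ?n)\<^sup>2 = 4 * ?n\<^sup>2" "(2 * ?n) * ?n = 2 * ?n\<^sup>2"
      by (simp_all add: power2_eq_square)
    moreover have "6 * (?k + 1) * ?n = 6 * ((?k + 1) * ?n)" by (rule mult.assoc)
    \<comment> \<open>Early predecessors contribute \<open>12\<close> and sorting \<open>4\<close>;
      together with \<open>2 * 34\<close> for the search this gives \<open>84\<close>.\<close>
    ultimately have "6 * (?k + 1) * ?n + (length ors + 1)\<^sup>2 \<le> 16 * ?n\<^sup>2" by linarith
    also have "\<dots> \<le> 16 * ?n\<^sup>2 * 2 ^ (?k\<^sup>2)" by simp
    finally show ?thesis using 1 by (simp add: algebra_simps)
  qed
  ultimately show ?thesis by (rule within_mono)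
qed

lemma within_and_or_alg_succ:
  assumes "wf_inst I" "k = card (succs I)" "n = njobs I"
  shows "within (and_or_alg_succ \<gamma> I) (200 * (k ^ k * 2 ^ (k\<^sup>2) * n ^ 3))"
proof -
  define js where "js = filter (\<lambda>j. psi I j \<noteq> Always) (upto_n I)"
  define ands where "ands = filter (\<lambda>j. is_And (psi I j)) js"
  define ors where "ors = filter (\<lambda>j. is_Or (psi I j)) js"
  have n: "1 \<le> njobs I" using assms(1) by (simp add: wf_inst_def)
  have "distinct js" unfolding js_def by (simp del: upt_Suc)
  then have k: "length js = k"
    using distinct_card[of js] set_succs_list[of I] assms(2) by (simp add: js_def)
  have kn: "k \<le> n" using length_filter_le[of _ "upto_n I"] k assms(3) length_upto_n by (metis js_def)
  have "is_Or (psi I j) \<longleftrightarrow> \<not> is_And (psi I j)" if "j \<in> set js" for j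
    using that unfolding js_def by (cases "psi I j") auto
  then have "ors = filter (\<lambda>j. \<not> is_And (psi I j)) js" unfolding ors_def by (intro filter_cong) auto
  then have parts: "length ands + length ors = k"
    using sum_length_filter_compl[of "\<lambda>j. is_And (psi I j)" js] by (simp add: ands_def k)
  let ?X = "k ^ k" let ?body = "84 * 2 ^ (k\<^sup>2) * n\<^sup>2"
  have "within (and_or_alg_succ \<gamma> I) ((length (upto_n I) * (0 + 1) + 1) + ((k * (0 + 1) + 1) + ((k * (0 + 1) + 1) +
      (20 * (k + 1) * ?X * n\<^sup>2 + ((n * ?X * (?body + 1) + 1) + 0)))))"
    unfolding and_or_alg_succ_eq
  proof (rule within_bind[OF within_mfilter[OF within_ret]])
    fix xs assume "xs \<in> outs (mfilter (\<lambda>j. ret (psi I j \<noteq> Always)) (upto_n I))"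
    then have xs: "xs = js" by (simp add: outs_filter_ret js_def del: upt_Suc)
    show "within (bind_prog (mfilter (\<lambda>j. ret (is_And (psi I j))) xs) (\<lambda>ands.
        bind_prog (mfilter (\<lambda>j. ret (is_Or (psi I j))) xs) (\<lambda>ors.
        bind_prog (configs I xs ands) (\<lambda>Cs. bind_prog (loop (process_config \<gamma> I xs ands ors) Cs None)
          (\<lambda>best. ret (map_option fst best))))))
      ((k * (0 + 1) + 1) + ((k * (0 + 1) + 1) +
      (20 * (k + 1) * ?X * n\<^sup>2 + ((n * ?X * (?body + 1) + 1) + 0))))"
      unfolding xs unfolding k[symmetric]
    proof (rule within_bind[OF within_mfilter[OF within_ret]], rule within_bind[OF within_mfilter[OF within_ret]])
      fix as os assume "as \<in> outs (mfilter (\<lambda>j. ret (is_And (psi I j))) js)"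
        "os \<in> outs (mfilter (\<lambda>j. ret (is_Or (psi I j))) js)"
      then have as: "as = ands" and os: "os = ors" by (simp_all add: outs_filter_ret ands_def ors_def)
      show "within (bind_prog (configs I js as) (\<lambda>Cs. bind_prog (loop (process_config \<gamma> I js as os) Cs None)
          (\<lambda>best. ret (map_option fst best))))
        (20 * (length js + 1) * length js ^ length js * n\<^sup>2 +
          ((n * length js ^ length js * (84 * 2 ^ ((length js)\<^sup>2) * n\<^sup>2 + 1) + 1) + 0))"
        unfolding as os assms(3)
      proof (intro within_bind within_ret)
        show "within (configs I js ands) (20 * (length js + 1) * length js ^ length js * (njobs I)\<^sup>2)"
          using parts k kn assms(3) n by (intro within_configs) simp_all
        fix Cs assume "Cs \<in> outs (configs I js ands)"
        then have len: "length Cs \<le> njobs I * length js ^ length js" using n by (rule length_configs)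
        have "within (loop (process_config \<gamma> I js ands ors) Cs None)
          (length Cs * (84 * 2 ^ ((length js)\<^sup>2) * (njobs I)\<^sup>2 + 1) + 1)"
          using parts k kn assms(3) n by (intro within_loop within_process_config) simp_all
        then show "within (loop (process_config \<gamma> I js ands ors) Cs None)
          (njobs I * length js ^ length js * (84 * 2 ^ ((length js)\<^sup>2) * (njobs I)\<^sup>2 + 1) + 1)"
          by (rule within_mono) (intro add_le_mono mult_le_mono order_refl len)
      qed
    qed
  qed
  moreover have "(length (upto_n I) * (0 + 1) + 1) + ((k * (0 + 1) + 1) + ((k * (0 + 1) + 1) +
      (20 * (k + 1) * ?X * n\<^sup>2 + ((n * ?X * (?body + 1) + 1) + 0)))) \<le> 200 * (k ^ k * 2 ^ (k\<^sup>2) * n ^ 3)"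
  proof -
    define P where "P = ?X * n ^ 3"
    define M where "M = P * 2 ^ (k\<^sup>2)"
    have n1: "1 \<le> n" using n assms(3) by simp
    have X1: "1 \<le> ?X" by (cases k) (simp_all add: Suc_le_eq)
    have cube: "n \<le> n ^ 3" using n1 self_le_power[of n 3] by simp
    have "1 * n ^ 3 \<le> P" unfolding P_def using X1 by (intro mult_le_mono order_refl)
    then have nP: "n \<le> P" using cube by simp
    have PM: "P \<le> M" by (simp add: M_def)
    \<comment> \<open>Apart from \<open>k + 1\<close> the enumeration of configurations is only
      quadratic in \<open>n\<close>, so this factor fits into the third power.\<close>
    have "(k + 1) * ?X * n\<^sup>2 \<le> (2 * n) * ?X * n\<^sup>2" using kn n1 by (intro mult_le_mono order_refl) simp
    also have "\<dots> = 2 * P" by (simp add: P_def power2_eq_square power3_eq_cube)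
    finally have 1: "20 * (k + 1) * ?X * n\<^sup>2 \<le> 40 * P" by (simp only: mult.assoc)
    have "n * ?X * (?body + 1) = 84 * M + n * ?X"
      by (simp add: M_def P_def power2_eq_square power3_eq_cube algebra_simps)
    moreover have "n * ?X \<le> P" using cube by (simp add: P_def mult.commute)
    ultimately have 2: "n * ?X * (?body + 1) \<le> 85 * M" using PM by linarith
    have M: "k ^ k * 2 ^ (k\<^sup>2) * n ^ 3 = M" by (simp add: M_def P_def)
    have "n * (0 + 1) + 1 + (k * (0 + 1) + 1 + (k * (0 + 1) + 1 + (u + (w + 1 + 0)))) \<le> 200 * M"
      if "u \<le> 40 * P" "w \<le> 85 * M" for u w
      using that nP PM kn n1 by simp
    from this[OF 1 2] show ?thesis unfolding assms(3) M[unfolded assms(3)] length_upto_n .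
  qed
  ultimately show ?thesis by (rule within_mono)
qed

theorem theorem7:
  shows "\<exists>c::nat. \<forall>(I::inst) \<gamma>. wf_inst I \<and> feasible_inst I \<longrightarrow>
    (let n = njobs I; m = machines I; k = card (succs I) in
       runs (and_or_alg_succ \<gamma> I) \<noteq> {} \<and>
       (\<forall>(r, t) \<in> runs (and_or_alg_succ \<gamma> I).
          (\<exists>C. r = Some C \<and> dom C = jobs I \<and> optimal_schedule \<gamma> I (\<lambda>j. the (C j))) \<and>
          t \<le> c * (k ^ k * 2 ^ (k\<^sup>2) * m * n ^ 3)))"
proof (intro exI[of _ 200] allI impI)
  fix I \<gamma> assume I: "wf_inst I \<and> feasible_inst I"
  define B where "B = card (succs I) ^ card (succs I) * 2 ^ ((card (succs I))\<^sup>2) * njobs I ^ 3"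
  define B' where "B' = card (succs I) ^ card (succs I) * 2 ^ ((card (succs I))\<^sup>2) * machines I * njobs I ^ 3"
  have time: "within (and_or_alg_succ \<gamma> I) (200 * B)"
    unfolding B_def using I by (intro within_and_or_alg_succ) simp_all
  have "1 \<le> machines I"
    using I feasible_imp_machines by (auto simp: feasible_inst_def feasible_schedule_def)
  \<comment> \<open>The time was bounded without the number of machines, which is at least one and
    can be inserted as a factor.\<close>
  then have "B * 1 \<le> B * machines I" by (intro mult_le_mono order_refl)
  then have "B \<le> B'" by (simp add: B_def B'_def ac_simps)
  then have "t \<le> 200 * B'" if "(r, t) \<in> runs (and_or_alg_succ \<gamma> I)" for r t
    using time that unfolding within_def by fastforce
  moreover have "\<exists>C. r = Some C \<and> dom C = jobs I \<and> optimal_schedule \<gamma> I (\<lambda>j. the (C j))"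
    if "(r, t) \<in> runs (and_or_alg_succ \<gamma> I)" for r t
    using that I by (intro and_or_alg_succ_optimal) (force simp: outs_def)+
  moreover have "runs (and_or_alg_succ \<gamma> I) \<noteq> {}" using time by (auto simp: within_def outs_def)
  ultimately show "let n = njobs I; m = machines I; k = card (succs I) in
       runs (and_or_alg_succ \<gamma> I) \<noteq> {} \<and>
       (\<forall>(r, t) \<in> runs (and_or_alg_succ \<gamma> I).
          (\<exists>C. r = Some C \<and> dom C = jobs I \<and> optimal_schedule \<gamma> I (\<lambda>j. the (C j))) \<and>
          t \<le> 200 * (k ^ k * 2 ^ (k\<^sup>2) * m * n ^ 3))"
    unfolding Let_def B'_def by blast
qed

end
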